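(* Let $b\in BMO^{-1}(\mathbb R^2)$ be divergence-free, and let $u$ be a weak subsolution of $-\Delta u+b\cdot\nabla u=0$ in $\mathbb R^2$. If $u$ is bounded, then $u$ is constant.
   Context: A divergence-free $b\in BMO^{-1}(\mathbb R^2)$ means $b=\nabla^\perp H=(H_{x_2},-H_{x_1})$ (in the distributional sense) with stream function $H\in BMO(\mathbb R^2)$. Set $$A(x)=\mathbb I+\begin{pmatrix}0&H(x)\\-H(x)&0\end{pmatrix},$$ so that formally $-\Delta+b\cdot\nabla=-\operatorname{div}(A\nabla)$. A function $u\in H^1_{\rm loc}(\mathbb R^2)$ is a weak subsolution of $-\Delta u+b\cdot\nabla u=0$ (i.e. a weak solution of $-\Delta u+b\cdot\nabla u\le0$) in $\mathbb R^2$ if $\int_{\mathbb R^2}(A\nabla u)\cdot\nabla v\,dx\le0$ for every nonnegative $v\in C_0^\infty(\mathbb R^2)$. *)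

theory Defs
  imports "HOL-Analysis.Analysis"
begin

definition partial_deriv :: "2 \<Rightarrow> (real^2 \<Rightarrow> real) \<Rightarrow> real^2 \<Rightarrow> real" where
  "partial_deriv i f x = frechet_derivative f (at x) (axis i 1)"

definition gradient :: "(real^2 \<Rightarrow> real) \<Rightarrow> real^2 \<Rightarrow> real^2" where
  "gradient f x = (\<chi> i. partial_deriv i f x)"

fun C_k :: "nat \<Rightarrow> (real^2 \<Rightarrow> real) \<Rightarrow> bool" where
  "C_k 0 f \<longleftrightarrow> continuous_on UNIV f"
| "C_k (Suc k) f \<longleftrightarrow> (\<forall>x. f differentiable (at x)) \<and> (\<forall>i. C_k k (partial_deriv i f))"

definition test_functions :: "(real^2 \<Rightarrow> real) set" where
  "test_functions = {\<phi>. (\<forall>k. C_k k \<phi>) \<and> compact (closure {x. \<phi> x \<noteq> 0})}"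

text \<open>As usual, elements of Lebesgue and Sobolev spaces are represented by functions,
  so statements about them hold up to null sets.\<close>

definition locally_integrable :: "(real^2 \<Rightarrow> 'b::{banach, second_countable_topology}) \<Rightarrow> bool" where
  "locally_integrable f \<longleftrightarrow> (\<forall>K. compact K \<longrightarrow> set_integrable lebesgue K f)"

definition L2_loc :: "(real^2 \<Rightarrow> 'b::{banach, second_countable_topology}) set" where
  "L2_loc = {f. f \<in> borel_measurable lebesgue \<and> locally_integrable (\<lambda>x. (norm (f x))\<^sup>2)}"

definition weak_gradient :: "(real^2 \<Rightarrow> real) \<Rightarrow> (real^2 \<Rightarrow> real^2) \<Rightarrow> bool" where
  "weak_gradient u G \<longleftrightarrow>
     (\<forall>\<phi>\<in>test_functions. \<forall>i.
        (LINT x|lebesgue. u x * partial_deriv i \<phi> x) = - (LINT x|lebesgue. G x $ i * \<phi> x))"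

definition H1_loc :: "(real^2 \<Rightarrow> real) set" where
  "H1_loc = {u. u \<in> L2_loc \<and> (\<exists>G\<in>L2_loc. weak_gradient u G)}"

definition average :: "(real^2) set \<Rightarrow> (real^2 \<Rightarrow> real) \<Rightarrow> real" where
  "average S f = (LINT x:S|lebesgue. f x) / measure lebesgue S"

definition BMO :: "(real^2 \<Rightarrow> real) set" where
  "BMO = {f. locally_integrable f \<and>
     (\<exists>C. \<forall>a. \<forall>r>0. average (ball a r) (\<lambda>x. \<bar>f x - average (ball a r) f\<bar>) \<le> C)}"

text \<open>A vector field with distributional components is represented by its action
  \<open>\<phi> \<mapsto> (\<langle>b\<^sub>1, \<phi>\<rangle>, \<langle>b\<^sub>2, \<phi>\<rangle>)\<close> on test functions; its values on
  other functions are irrelevant. The identity \<open>b = (\<partial>\<^sub>2 H, - \<partial>\<^sub>1 H)\<close> below, with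
  \<open>\<langle>\<partial>\<^sub>i H, \<phi>\<rangle> = - \<integral> H \<partial>\<^sub>i \<phi>\<close>, makes both components linear and
  continuous on test functions.\<close>

type_synonym distributional_field = "(real^2 \<Rightarrow> real) \<Rightarrow> real^2"

definition BMO_stream_function :: "distributional_field \<Rightarrow> (real^2 \<Rightarrow> real) \<Rightarrow> bool" where
  "BMO_stream_function b H \<longleftrightarrow> H \<in> BMO \<and>
     (\<forall>\<phi>\<in>test_functions.
        b \<phi> $ 1 = - (LINT x|lebesgue. H x * partial_deriv 2 \<phi> x) \<and>
        b \<phi> $ 2 = (LINT x|lebesgue. H x * partial_deriv 1 \<phi> x))"

definition div_free_BMO_inverse :: "distributional_field set" where
  "div_free_BMO_inverse = {b. \<exists>H. BMO_stream_function b H}"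

definition coeff_matrix :: "(real^2 \<Rightarrow> real) \<Rightarrow> real^2 \<Rightarrow> real^2^2" where
  "coeff_matrix H x = mat 1 + vector [vector [0, H x], vector [- H x, 0]]"

text \<open>Up to null sets, the weak gradient is unique and the stream function is unique up to an
  additive constant. Neither ambiguity affects the integral below,
  so the choice of \<open>H\<close> and \<open>G\<close> is immaterial.\<close>

definition weak_subsolution :: "distributional_field \<Rightarrow> (real^2 \<Rightarrow> real) \<Rightarrow> bool" where
  "weak_subsolution b u \<longleftrightarrow> u \<in> H1_loc \<and>
     (\<exists>H G. BMO_stream_function b H \<and> G \<in> L2_loc \<and> weak_gradient u G \<and>
        (\<forall>v\<in>test_functions. (\<forall>x. 0 \<le> v x) \<longrightarrow>
           (LINT x|lebesgue. (coeff_matrix H x *v G x) \<bullet> gradient v x) \<le> 0))"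

end

theory Submission
  imports Defs
begin

text \<open>Add a constant so that \<open>u \<ge> 0\<close> and test the equation with \<open>v = \<eta>\<^sup>2 u\<close>. The antisymmetric part
  contributes only through \<open>H\<close> multiplied by \<open>\<nabla>\<eta>\<close>, and \<open>H\<close> may be replaced there by \<open>H - h\<close> for any constant
  \<open>h\<close>, because gradients are curl free. For the cutoff \<open>\<eta>\<close> at scale \<open>R\<close>, the integral of
  \<open>(1 + \<bar>H - h\<bar>\<^sup>2) \<bar>\<nabla>\<eta>\<bar>\<^sup>2\<close> is bounded independently of \<open>R\<close> in two dimensions, by the John-Nirenberg
  inequality in \<open>L\<^sup>2\<close>. Hence the Dirichlet energy of \<open>u\<close> is finite; the Caccioppoli estimate then bounds it
  by the energy outside the ball of radius \<open>R\<close>, so it vanishes.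

  Justifying \<open>v\<close> as a test function is delicate, since \<open>H \<nabla>u\<close> is not square integrable. We use
  \<open>v = \<eta> ((\<eta> u) * \<rho>)\<close> with an even mollifier \<open>\<rho>\<close>: with \<open>F = \<eta> \<nabla>u\<close>, the critical term is the
  integral of \<open>(H x - H y) (F\<^sub>2 x F\<^sub>1 y - F\<^sub>1 x F\<^sub>2 y) \<rho> (x - y) / 2\<close>. Bounded mean oscillation makes this a
  bounded bilinear form on \<open>L\<^sup>2\<close>, uniformly in the scale of \<open>\<rho>\<close>; it tends to 0 for bounded \<open>F\<close> of
  compact support, hence for all \<open>F\<close>.\<close>

section \<open>Smooth functions\<close>

text \<open>The test function is linear in \<open>u\<close>, so only the weak gradient and
  convolutions enter; no chain rule for Sobolev functions is involved. Its sign comes from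
  \<open>u \<ge> 0\<close> and a nonnegative mollifier, which is what makes it admissible for a
  subsolution. Every term of the tested inequality is a pairing with a mollified function.
  \<open>H \<nabla>u\<close> is only locally integrable, so it may be paired with bounded functions,
  and \<open>\<eta> \<nabla>u\<close> with itself in L2; the commutator is what is left. The
  mollifier at scale e has height of order 1/e^2, so the commutator vanishes once the form
  restricted to \<open>dist x y < e\<close> is o(e^2). Cauchy-Schwarz on small balls gives O(e^2),
  and truncation together with L1-continuity of translations gives o(e^2). The L2 John-Nirenberg
  bound is obtained for bounded functions by induction over dyadic squares. It does not depend on
  the sup norm, so truncation and Fatou carry it over to \<open>H\<close>. In the energy inequality
  E \<le> 2 \<tau> E_tail + \<Lambda> / \<tau> the weight \<tau> stays free: a small \<tau> gives
  finite energy, and after the tail has disappeared a large \<tau> gives zero.\<close>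

lemma partial_deriv_eqI:
  "(f has_derivative f') (at x) \<Longrightarrow> partial_deriv i f x = f' (axis i 1)"
  unfolding partial_deriv_def using frechet_derivative_at by metis

lemma C_k_imp_continuous: "C_k k f \<Longrightarrow> continuous_on UNIV f"
proof (cases k)
  case (Suc l)
  moreover assume "C_k k f"
  ultimately show ?thesis
    by (metis C_k.simps(2) continuous_at_imp_continuous_on differentiable_imp_continuous_within)
qed simp

lemma C_k_Suc_imp_C_k: "C_k (Suc k) f \<Longrightarrow> C_k k f"
proof (induction k arbitrary: f)
  case 0
  show ?case using C_k_imp_continuous[OF 0] by simp
next
  case (Suc k)
  then show ?case by (metis C_k.simps(2))
qed

lemma C_k_const: "C_k k (\<lambda>x. c)"
proof (induction k arbitrary: c)
  case (Suc k)
  have "partial_deriv i (\<lambda>x. c) = (\<lambda>x. 0)" for i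
    by (intro ext partial_deriv_eqI[where f' = "\<lambda>h. 0", simplified]) auto
  then show ?case using Suc by simp
qed simp

lemma partial_deriv_add:
  assumes "f differentiable at x" "g differentiable at x"
  shows "partial_deriv i (\<lambda>x. f x + g x) x = partial_deriv i f x + partial_deriv i g x"
  using assms unfolding partial_deriv_def frechet_derivative_works
  by (subst frechet_derivative_at[OF has_derivative_add, symmetric]) auto

lemma partial_deriv_mult:
  assumes "f differentiable at x" "g differentiable at x"
  shows "partial_deriv i (\<lambda>x. f x * g x) x = f x * partial_deriv i g x + partial_deriv i f x * g x"
  using assms unfolding partial_deriv_def frechet_derivative_works
  by (subst frechet_derivative_at[OF has_derivative_mult, symmetric]) auto

lemma C_k_add: "C_k k f \<Longrightarrow> C_k k g \<Longrightarrow> C_k k (\<lambda>x. f x + g x)"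
proof (induction k arbitrary: f g)
  case 0
  then show ?case by (auto intro: continuous_intros)
next
  case (Suc k)
  then have "partial_deriv i (\<lambda>x. f x + g x) = (\<lambda>x. partial_deriv i f x + partial_deriv i g x)" for i
    by (intro ext partial_deriv_add) auto
  with Suc show ?case by (auto intro: differentiable_add)
qed

lemma C_k_mult: "C_k k f \<Longrightarrow> C_k k g \<Longrightarrow> C_k k (\<lambda>x. f x * g x)"
proof (induction k arbitrary: f g)
  case 0
  then show ?case by (auto intro: continuous_intros)
next
  case (Suc k)
  then have "partial_deriv i (\<lambda>x. f x * g x) = (\<lambda>x. f x * partial_deriv i g x + partial_deriv i f x * g x)" for i
    by (intro ext partial_deriv_mult) auto
  moreover have "C_k k f" "C_k k g" using Suc.prems C_k_Suc_imp_C_k by blast+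
  ultimately show ?case using Suc by (auto intro!: differentiable_mult C_k_add)
qed

lemma partial_deriv_affine:
  assumes "f differentiable at (a + s *\<^sub>R x)"
  shows "partial_deriv i (\<lambda>y. f (a + s *\<^sub>R y)) x = s * partial_deriv i f (a + s *\<^sub>R x)"
    and "(\<lambda>y. f (a + s *\<^sub>R y)) differentiable at x"
proof -
  let ?D = "frechet_derivative f (at (a + s *\<^sub>R x))"
  have D: "(f has_derivative ?D) (at (a + s *\<^sub>R x))"
    using assms frechet_derivative_works by blast
  have "((\<lambda>y. a + s *\<^sub>R y) has_derivative (\<lambda>h. s *\<^sub>R h)) (at x)"
    by (auto intro!: derivative_eq_intros)
  from has_derivative_compose[OF this D]
  have *: "((\<lambda>y. f (a + s *\<^sub>R y)) has_derivative (\<lambda>h. ?D (s *\<^sub>R h))) (at x)" .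
  then show "(\<lambda>y. f (a + s *\<^sub>R y)) differentiable at x" using differentiable_def by blast
  show "partial_deriv i (\<lambda>y. f (a + s *\<^sub>R y)) x = s * partial_deriv i f (a + s *\<^sub>R x)"
    using partial_deriv_eqI[OF *, of i] has_derivative_linear[OF D]
    by (simp add: partial_deriv_def linear_scale)
qed

lemma C_k_affine: "C_k k f \<Longrightarrow> C_k k (\<lambda>y. f (a + s *\<^sub>R y))"
proof (induction k arbitrary: f)
  case 0
  then show ?case by (auto intro!: continuous_on_compose2[of UNIV f] continuous_intros)
next
  case (Suc k)
  then have "partial_deriv i (\<lambda>y. f (a + s *\<^sub>R y)) = (\<lambda>x. s * partial_deriv i f (a + s *\<^sub>R x))" for i
    by (intro ext partial_deriv_affine) auto
  with Suc show ?case by (auto intro!: partial_deriv_affine C_k_mult C_k_const)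
qed

text \<open>The second difference of \<open>f\<close> over a square of side \<open>s\<close> at
  \<open>x\<close> is symmetric in the two directions. Applying the mean value theorem twice, in
  either order, writes it as \<open>s * s\<close> times a mixed partial at a point within
  \<open>2 * s\<close> of \<open>x\<close>; continuity then identifies the two limits.\<close>

lemma mixed_partials_eq:
  assumes "C_k (Suc (Suc 0)) f"
  shows "partial_deriv i (partial_deriv j f) = partial_deriv j (partial_deriv i f)"
proof
  fix x :: "real^2"
  have d1: "f differentiable at y" for y using assms by simp
  have d2: "partial_deriv j f differentiable at y" for j y using assms by simp
  have line: "((\<lambda>t. g (y + t *\<^sub>R axis k 1)) has_real_derivative partial_deriv k g (y + t *\<^sub>R axis k 1)) (at t)"
    if "\<And>z. g differentiable at z" for g :: "real^2 \<Rightarrow> real" and k y t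
  proof -
    let ?D = "frechet_derivative g (at (y + t *\<^sub>R axis k 1))"
    have D: "(g has_derivative ?D) (at (y + t *\<^sub>R axis k 1))"
      using that frechet_derivative_works by blast
    have "((\<lambda>t. y + t *\<^sub>R axis k 1) has_derivative (\<lambda>h. h *\<^sub>R axis k 1)) (at t)"
      by (auto intro!: derivative_eq_intros)
    from has_derivative_compose[OF this D] have "((\<lambda>t. g (y + t *\<^sub>R axis k 1)) has_derivative (\<lambda>h. ?D (h *\<^sub>R axis k 1))) (at t)" .
    moreover have "(\<lambda>h. ?D (h *\<^sub>R axis k 1)) = (*) (partial_deriv k g (y + t *\<^sub>R axis k 1))"
      using has_derivative_linear[OF D] by (auto simp: partial_deriv_def linear_scale)
    ultimately show ?thesis by (simp add: has_field_derivative_def)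
  qed
  have key: "\<exists>\<xi> \<zeta>. 0 < \<xi> \<and> \<xi> < s \<and> 0 < \<zeta> \<and> \<zeta> < s \<and>
     f (x + s *\<^sub>R axis i 1 + s *\<^sub>R axis j 1) - f (x + s *\<^sub>R axis i 1) - f (x + s *\<^sub>R axis j 1) + f x =
     s * s * partial_deriv j (partial_deriv i f) (x + \<xi> *\<^sub>R axis i 1 + \<zeta> *\<^sub>R axis j 1)"
    if "s > 0" for s i j
  proof -
    let ?g = "\<lambda>t. f ((x + s *\<^sub>R axis j 1) + t *\<^sub>R axis i 1) - f (x + t *\<^sub>R axis i 1)"
    have "\<exists>\<xi>. 0 < \<xi> \<and> \<xi> < s \<and> ?g s - ?g 0 = (s - 0) *
       (partial_deriv i f ((x + s *\<^sub>R axis j 1) + \<xi> *\<^sub>R axis i 1) - partial_deriv i f (x + \<xi> *\<^sub>R axis i 1))"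
      by (intro MVT2[OF that]) (intro DERIV_diff line d1)
    then obtain \<xi> where \<xi>: "0 < \<xi>" "\<xi> < s" "?g s - ?g 0 = s *
       (partial_deriv i f ((x + s *\<^sub>R axis j 1) + \<xi> *\<^sub>R axis i 1) - partial_deriv i f (x + \<xi> *\<^sub>R axis i 1))"
      by auto
    let ?k = "\<lambda>t. partial_deriv i f ((x + \<xi> *\<^sub>R axis i 1) + t *\<^sub>R axis j 1)"
    have "\<exists>\<zeta>. 0 < \<zeta> \<and> \<zeta> < s \<and> ?k s - ?k 0 = (s - 0) *
       partial_deriv j (partial_deriv i f) ((x + \<xi> *\<^sub>R axis i 1) + \<zeta> *\<^sub>R axis j 1)"
      by (intro MVT2[OF that]) (intro line d2)
    then obtain \<zeta> where \<zeta>: "0 < \<zeta>" "\<zeta> < s" "?k s - ?k 0 = s *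
       partial_deriv j (partial_deriv i f) ((x + \<xi> *\<^sub>R axis i 1) + \<zeta> *\<^sub>R axis j 1)"
      by auto
    have "?g s - ?g 0 = s * (?k s - ?k 0)" using \<xi>(3) by (simp add: algebra_simps)
    also have "\<dots> = s * s * partial_deriv j (partial_deriv i f) ((x + \<xi> *\<^sub>R axis i 1) + \<zeta> *\<^sub>R axis j 1)"
      using \<zeta>(3) by simp
    finally show ?thesis using \<xi>(1,2) \<zeta>(1,2)
      by (intro exI[of _ \<xi>] exI[of _ \<zeta>]) (simp add: algebra_simps)
  qed
  have close: "norm (x + \<xi> *\<^sub>R axis i 1 + \<zeta> *\<^sub>R axis j 1 - x) < 2 * s"
    if "0 < \<xi>" "\<xi> < s" "0 < \<zeta>" "\<zeta> < s" for \<xi> \<zeta> s :: real and i j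
  proof -
    have "norm (x + \<xi> *\<^sub>R axis i 1 + \<zeta> *\<^sub>R axis j 1 - x) \<le> \<bar>\<xi>\<bar> * norm (axis i (1::real)) + \<bar>\<zeta>\<bar> * norm (axis j (1::real))"
      using norm_triangle_ineq[of "\<xi> *\<^sub>R axis i 1" "\<zeta> *\<^sub>R axis j (1::real)"] by simp
    then show ?thesis using that by (simp add: norm_axis_1)
  qed
  have cont: "isCont (partial_deriv j (partial_deriv i f)) x" for i j
    using assms by (simp add: continuous_on_eq_continuous_at)
  let ?a = "partial_deriv j (partial_deriv i f)" and ?b = "partial_deriv i (partial_deriv j f)"
  have *: "\<bar>?a x - ?b x\<bar> \<le> e" if "e > 0" for e
  proof -
    have e2: "e / 2 > 0" using that by simp
    obtain d1 where d1: "d1 > 0" "\<And>y. norm (y - x) < d1 \<Longrightarrow> \<bar>?a y - ?a x\<bar> < e / 2"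
      using cont[of j i, unfolded continuous_at_eps_delta, rule_format, OF e2] by (auto simp: dist_norm)
    obtain d2 where d2: "d2 > 0" "\<And>y. norm (y - x) < d2 \<Longrightarrow> \<bar>?b y - ?b x\<bar> < e / 2"
      using cont[of i j, unfolded continuous_at_eps_delta, rule_format, OF e2] by (auto simp: dist_norm)
    define s where "s = min d1 d2 / 2"
    have s: "s > 0" "2 * s \<le> d1" "2 * s \<le> d2" using d1 d2 by (auto simp: s_def)
    obtain y where y: "norm (y - x) < 2 * s"
      "f (x + s *\<^sub>R axis i 1 + s *\<^sub>R axis j 1) - f (x + s *\<^sub>R axis i 1) - f (x + s *\<^sub>R axis j 1) + f x = s * s * ?a y"
      using key[OF s(1), of i j] close by blast
    obtain z where z: "norm (z - x) < 2 * s"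
      "f (x + s *\<^sub>R axis j 1 + s *\<^sub>R axis i 1) - f (x + s *\<^sub>R axis j 1) - f (x + s *\<^sub>R axis i 1) + f x = s * s * ?b z"
      using key[OF s(1), of j i] close by blast
    have "s * s * ?a y = s * s * ?b z" using y(2) z(2) by (simp add: algebra_simps)
    then have "?a y = ?b z" using s(1) by simp
    then show ?thesis using d1(2)[of y] d2(2)[of z] y(1) z(1) s by linarith
  qed
  have "\<bar>?a x - ?b x\<bar> \<le> 0"
  proof (rule field_le_epsilon)
    fix e :: real assume "0 < e"
    then show "\<bar>?a x - ?b x\<bar> \<le> 0 + e" using *[of e] by simp
  qed
  then show "?b x = ?a x" by simp
qed

section \<open>Test functions and convolution\<close>

lemma test_functionsI:
  assumes "\<And>k. C_k k \<phi>" "\<And>x. norm x > R \<Longrightarrow> \<phi> x = 0"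
  shows "\<phi> \<in> test_functions"
proof -
  have "{x. \<phi> x \<noteq> 0} \<subseteq> cball 0 R" using assms(2) by (force simp: not_less[symmetric])
  then have "bounded {x. \<phi> x \<noteq> 0}" using bounded_cball bounded_subset by blast
  then show ?thesis using assms(1) by (simp add: test_functions_def)
qed

lemma test_functions_C_k: "\<phi> \<in> test_functions \<Longrightarrow> C_k k \<phi>"
  by (simp add: test_functions_def)

lemma test_functions_support:
  assumes "\<phi> \<in> test_functions"
  obtains R where "R > 0" "\<And>x. norm x > R \<Longrightarrow> \<phi> x = 0"
proof -
  have "bounded {x. \<phi> x \<noteq> 0}"
    using assms compact_imp_bounded bounded_subset closure_subset unfolding test_functions_def by blast
  then obtain R where "R > 0" "\<And>x. \<phi> x \<noteq> 0 \<Longrightarrow> norm x \<le> R"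
    unfolding bounded_pos by blast
  then show ?thesis using that[of R] by force
qed

lemma test_functions_differentiable: "\<phi> \<in> test_functions \<Longrightarrow> \<phi> differentiable (at x)"
  using test_functions_C_k[of \<phi> 1] by simp

lemma test_functions_continuous: "\<phi> \<in> test_functions \<Longrightarrow> continuous_on UNIV \<phi>"
  using test_functions_C_k[of \<phi> 0] by simp

lemma test_functions_borel [measurable_dest]: "\<phi> \<in> test_functions \<Longrightarrow> \<phi> \<in> borel_measurable borel"
  by (simp add: test_functions_continuous borel_measurable_continuous_onI)

lemma partial_deriv_eq_0_outside:
  assumes "\<And>x. norm x > R \<Longrightarrow> \<phi> x = 0" "norm x > R"
  shows "partial_deriv i \<phi> x = 0"
proof -
  have "open {x::real^2. norm x > R}" by (intro open_Collect_less continuous_intros)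
  then have "(\<phi> has_derivative (\<lambda>h. 0)) (at x)"
    using assms by (intro has_derivative_transform_within_open[of "\<lambda>x. 0" "\<lambda>h. 0" x UNIV "{x. norm x > R}" \<phi>, simplified]) auto
  then show ?thesis by (rule partial_deriv_eqI)
qed

lemma test_functions_partial_deriv:
  assumes "\<phi> \<in> test_functions"
  shows "partial_deriv i \<phi> \<in> test_functions"
proof -
  obtain R where "R > 0" "\<And>x. norm x > R \<Longrightarrow> \<phi> x = 0" using test_functions_support[OF assms] by blast
  then show ?thesis
    using assms test_functions_C_k[OF assms, of "Suc _"]
    by (intro test_functionsI[of _ R] partial_deriv_eq_0_outside) auto
qed

lemma test_functions_mult:
  assumes "\<phi> \<in> test_functions" "\<And>k. C_k k \<psi>"
  shows "(\<lambda>x. \<phi> x * \<psi> x) \<in> test_functions"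
proof -
  obtain R where "R > 0" "\<And>x. norm x > R \<Longrightarrow> \<phi> x = 0" using test_functions_support[OF assms(1)] by blast
  then show ?thesis using assms
    by (intro test_functionsI[of _ R] C_k_mult) (auto simp: test_functions_C_k)
qed

lemma test_functions_affine:
  assumes "\<phi> \<in> test_functions" "s \<noteq> 0"
  shows "(\<lambda>x. \<phi> (a + s *\<^sub>R x)) \<in> test_functions"
proof -
  obtain R where R: "R > 0" "\<And>x. norm x > R \<Longrightarrow> \<phi> x = 0" using test_functions_support[OF assms(1)] by blast
  show ?thesis
  proof (rule test_functionsI[of _ "(R + norm a) / \<bar>s\<bar>"])
    fix x :: "real^2" assume "(R + norm a) / \<bar>s\<bar> < norm x"
    then have "R + norm a < norm (s *\<^sub>R x)" using assms(2) by (simp add: field_simps)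
    moreover have "norm (s *\<^sub>R x) \<le> norm (a + s *\<^sub>R x) + norm a"
      using norm_triangle_ineq4[of "a + s *\<^sub>R x" a] by simp
    ultimately show "\<phi> (a + s *\<^sub>R x) = 0" using R(2) by simp
  qed (simp add: C_k_affine test_functions_C_k assms)
qed

lemma test_functions_bounded:
  assumes "\<phi> \<in> test_functions"
  obtains B where "B > 0" "\<And>x. \<bar>\<phi> x\<bar> \<le> B"
proof -
  obtain R where R: "R > 0" "\<And>x. norm x > R \<Longrightarrow> \<phi> x = 0" using test_functions_support[OF assms] by blast
  have "compact (\<phi> ` cball 0 R)"
    by (intro compact_continuous_image continuous_on_subset[OF test_functions_continuous[OF assms]]) auto
  then obtain B where B: "B > 0" "\<And>y. y \<in> \<phi> ` cball 0 R \<Longrightarrow> norm y \<le> B"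
    using compact_imp_bounded bounded_pos by metis
  have "\<bar>\<phi> x\<bar> \<le> B" for x
    using B(1) B(2)[of "\<phi> x"] R(2)[of x] by (cases "norm x \<le> R") auto
  then show ?thesis using that B by blast
qed

lemma integrable_bounded_support:
  fixes f :: "real^2 \<Rightarrow> real"
  assumes [measurable]: "f \<in> borel_measurable borel" and "\<And>x. \<bar>f x\<bar> \<le> B" "\<And>x. norm x > R \<Longrightarrow> f x = 0"
  shows "integrable lborel f"
proof (rule Bochner_Integration.integrable_bound[of _ "\<lambda>x. B * indicator (cball 0 R) x"])
  show "integrable lborel (\<lambda>x::real^2. B * indicator (cball 0 R) x)"
    by (intro integrable_mult_right integrable_real_indicator)
      (use emeasure_bounded_finite[OF bounded_cball, of "0::real^2" R] in auto)
  show "AE x in lborel. norm (f x) \<le> norm (B * indicator (cball 0 R) x)"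
  proof (intro AE_I2)
    fix x
    show "norm (f x) \<le> norm (B * indicator (cball 0 R) x)"
      using assms(2)[of x] assms(3)[of x] by (cases "norm x > R") auto
  qed
qed simp

lemma test_functions_integrable:
  assumes "\<phi> \<in> test_functions"
  shows "integrable lborel \<phi>"
  using test_functions_support[OF assms] test_functions_bounded[OF assms]
  by (metis integrable_bounded_support test_functions_borel[OF assms])

lemma uniformly_continuous_compact_support:
  fixes f :: "real^2 \<Rightarrow> real"
  assumes "continuous_on UNIV f" "\<And>x. norm x > R \<Longrightarrow> f x = 0"
  shows "uniformly_continuous_on UNIV f"
  unfolding uniformly_continuous_on_def
proof (intro allI impI)
  fix e :: real assume e: "e > 0"
  \<comment> \<open>The margin 1 separates the cases: two points closer than 1 that do not both lie
    in the ball of radius \<open>R + 1\<close> both lie outside the ball of radius \<open>R\<close>,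
    where \<open>f\<close> vanishes.\<close>
  have "uniformly_continuous_on (cball 0 (R + 1)) f"
    using assms(1) by (intro compact_uniformly_continuous) (auto intro: continuous_on_subset)
  then obtain d where d: "d > 0" "\<And>x y. norm x \<le> R + 1 \<Longrightarrow> norm y \<le> R + 1 \<Longrightarrow> dist y x < d \<Longrightarrow> dist (f y) (f x) < e"
    using e unfolding uniformly_continuous_on_def by (metis mem_cball_0)
  have "dist (f y) (f x) < e" if "dist y x < min d 1" for x y
  proof (cases "norm x \<le> R + 1 \<and> norm y \<le> R + 1")
    case True
    then show ?thesis using d that by auto
  next
    case False
    have "norm x \<le> norm y + dist y x" "norm y \<le> norm x + dist y x"
      by norm+
    then have "norm x > R" "norm y > R" using False that by auto
    then show ?thesis using assms(2) e by simp
  qed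
  then show "\<exists>d>0. \<forall>x\<in>UNIV. \<forall>x'\<in>UNIV. dist x' x < d \<longrightarrow> dist (f x') (f x) < e"
    using d(1) by (intro exI[of _ "min d 1"]) auto
qed

section \<open>Differentiation of convolutions\<close>

lemma frechet_derivative_expand:
  assumes "f differentiable at x"
  shows "frechet_derivative f (at x) h = (\<Sum>i\<in>UNIV. h $ i * partial_deriv i f x)"
proof -
  have lin: "linear (frechet_derivative f (at x))"
    using assms frechet_derivative_works has_derivative_linear by blast
  have "h = (\<Sum>i\<in>UNIV. h $ i *\<^sub>R axis i 1)"
    using basis_expansion[of h] by (simp add: scalar_mult_eq_scaleR)
  then have "frechet_derivative f (at x) h = frechet_derivative f (at x) (\<Sum>i\<in>UNIV. h $ i *\<^sub>R axis i 1)"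
    by simp
  then show ?thesis using lin by (simp add: linear_sum linear_scale partial_deriv_def)
qed

text \<open>The point is that \<open>d\<close> does not depend on \<open>z\<close>, so the remainder
  can later be integrated. The partial derivatives are uniformly continuous, and the mean value
  inequality is applied to the remainder as a function of the increment; each of the two coordinates
  contributes \<open>e / 2\<close> to its derivative.\<close>

lemma uniform_first_order_expansion:
  assumes "\<phi> \<in> test_functions" "e > 0"
  obtains d where "d > 0"
    "\<And>z h. norm h < d \<Longrightarrow> \<bar>\<phi> (z + h) - \<phi> z - (\<Sum>i\<in>UNIV. h $ i * partial_deriv i \<phi> z)\<bar> \<le> e * norm h"
proof -
  have uc: "uniformly_continuous_on UNIV (partial_deriv i \<phi>)" for i
    using test_functions_support[OF test_functions_partial_deriv[OF assms(1)]]
      uniformly_continuous_compact_support test_functions_continuous[OF test_functions_partial_deriv[OF assms(1)]]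
    by metis
  have "\<exists>d>0. \<forall>x y. norm (y - x) < d \<longrightarrow> \<bar>partial_deriv i \<phi> y - partial_deriv i \<phi> x\<bar> < e / 2" for i
    using uc[of i] assms(2) unfolding uniformly_continuous_on_def dist_norm
    by (metis UNIV_I half_gt_zero real_norm_def)
  then obtain d where d: "\<And>i. d i > 0"
    "\<And>i x y. norm (y - x) < d i \<Longrightarrow> \<bar>partial_deriv i \<phi> y - partial_deriv i \<phi> x\<bar> < e / 2"
    by metis
  define D where "D = min (d 1) (d 2)"
  have D: "D > 0" "\<And>i. D \<le> d i" using d(1) exhaust_2 by (auto simp: D_def) (metis min.cobounded1 min.cobounded2 exhaust_2)
  have "\<bar>\<phi> (z + h) - \<phi> z - (\<Sum>i\<in>UNIV. h $ i * partial_deriv i \<phi> z)\<bar> \<le> e * norm h" if "norm h < D" for z h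
  proof -
    let ?T = "\<lambda>k. \<phi> (z + k) - (\<Sum>i\<in>UNIV. k $ i * partial_deriv i \<phi> z)"
    have der: "(?T has_derivative (\<lambda>v. (\<Sum>i\<in>UNIV. v $ i * partial_deriv i \<phi> (z + k)) - (\<Sum>i\<in>UNIV. v $ i * partial_deriv i \<phi> z)))
       (at k within ball 0 D)" for k
    proof -
      have 1: "((\<lambda>k. z + k) has_derivative (\<lambda>v. v)) (at k)" by (auto intro!: derivative_eq_intros)
      have 2: "(\<phi> has_derivative (\<lambda>v. \<Sum>i\<in>UNIV. v $ i * partial_deriv i \<phi> (z + k))) (at (z + k))"
        using test_functions_differentiable[OF assms(1), of "z + k"]
        unfolding frechet_derivative_works frechet_derivative_expand[OF test_functions_differentiable[OF assms(1)], abs_def]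
        by simp
      have 3: "((\<lambda>k. \<Sum>i\<in>UNIV. k $ i * partial_deriv i \<phi> z) has_derivative (\<lambda>v. \<Sum>i\<in>UNIV. v $ i * partial_deriv i \<phi> z)) (at k)"
        by (intro bounded_linear_imp_has_derivative bounded_linear_sum bounded_linear_mult_const bounded_linear_vec_nth)
      show ?thesis
        using has_derivative_diff[OF has_derivative_compose[OF 1 2] 3] by (rule has_derivative_at_withinI)
    qed
    have "norm (?T h - ?T 0) \<le> e * norm (h - 0)"
    proof (rule differentiable_bound[OF convex_ball der])
      fix k :: "real^2" assume "k \<in> ball 0 D"
      then have k: "norm k < D" by simp
      show "onorm (\<lambda>v. (\<Sum>i\<in>UNIV. v $ i * partial_deriv i \<phi> (z + k)) - (\<Sum>i\<in>UNIV. v $ i * partial_deriv i \<phi> z)) \<le> e"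
      proof (rule onorm_le)
        fix v :: "real^2"
        have "\<bar>partial_deriv i \<phi> (z + k) - partial_deriv i \<phi> z\<bar> < e / 2" for i
          using d(2)[of "z + k" z i] k D(2)[of i] by simp
        then have "\<bar>v $ i * (partial_deriv i \<phi> (z + k) - partial_deriv i \<phi> z)\<bar> \<le> norm v * (e / 2)" for i
          unfolding abs_mult by (intro mult_mono component_le_norm_cart) (auto simp: less_imp_le)
        from add_mono[OF this[of 1] this[of 2]]
        have "\<bar>v $ 1 * (partial_deriv 1 \<phi> (z + k) - partial_deriv 1 \<phi> z)\<bar>
          + \<bar>v $ 2 * (partial_deriv 2 \<phi> (z + k) - partial_deriv 2 \<phi> z)\<bar> \<le> e * norm v" by simp
        then show "norm ((\<Sum>i\<in>UNIV. v $ i * partial_deriv i \<phi> (z + k)) - (\<Sum>i\<in>UNIV. v $ i * partial_deriv i \<phi> z)) \<le> e * norm v"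
          unfolding sum_2 real_norm_def by (simp only: right_diff_distrib)
      qed
    qed (use that D(1) in simp_all)
    then show ?thesis by simp
  qed
  then show ?thesis using that D by blast
qed

definition convolution :: "(real^2 \<Rightarrow> real) \<Rightarrow> (real^2 \<Rightarrow> real) \<Rightarrow> real^2 \<Rightarrow> real" where
  "convolution \<phi> g x = (LINT y|lborel. \<phi> (x - y) * g y)"

lemma convolution_integrable:
  assumes "\<phi> \<in> test_functions" and g: "integrable lborel g"
  shows "integrable lborel (\<lambda>y. \<phi> (x - y) * g y)"
proof -
  obtain B where B: "B > 0" "\<And>x. \<bar>\<phi> x\<bar> \<le> B" using test_functions_bounded[OF assms(1)] by blast
  note [measurable] = test_functions_borel[OF assms(1)] borel_measurable_integrable[OF g]
  show ?thesis
  proof (rule Bochner_Integration.integrable_bound[of _ "\<lambda>y. B * g y"])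
    show "AE y in lborel. norm (\<phi> (x - y) * g y) \<le> norm (B * g y)"
      using B by (intro AE_I2) (simp add: abs_mult mult_right_mono)
  qed (use g in auto)
qed

text \<open>All derivatives fall on the test function, so mere integrability of \<open>g\<close>
  gives smoothness. The uniform remainder estimate is integrated against \<open>g\<close>, at the
  price of the L1 norm of \<open>g\<close>.\<close>

lemma convolution_has_derivative:
  assumes "\<phi> \<in> test_functions" and g: "integrable lborel g"
  shows "(convolution \<phi> g has_derivative (\<lambda>h. \<Sum>i\<in>UNIV. h $ i * convolution (partial_deriv i \<phi>) g x)) (at x)"
  unfolding has_derivative_at_alt
proof (intro conjI allI impI)
  show "bounded_linear (\<lambda>h. \<Sum>i\<in>UNIV. h $ i * convolution (partial_deriv i \<phi>) g x)"
    by (intro bounded_linear_sum bounded_linear_mult_const bounded_linear_vec_nth)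
  fix e :: real assume e: "e > 0"
  \<comment> \<open>The remainder is taken relative to \<open>e / (n + 1)\<close> because
    \<open>n\<close> may be 0.\<close>
  define n where "n = (LINT y|lborel. \<bar>g y\<bar>)"
  have n: "n \<ge> 0" by (simp add: n_def)
  obtain d where d: "d > 0"
    "\<And>z h. norm h < d \<Longrightarrow> \<bar>\<phi> (z + h) - \<phi> z - (\<Sum>i\<in>UNIV. h $ i * partial_deriv i \<phi> z)\<bar> \<le> (e / (n + 1)) * norm h"
    using uniform_first_order_expansion[OF assms(1), of "e / (n + 1)"] e n by auto
  have "norm (convolution \<phi> g y - convolution \<phi> g x - (\<Sum>i\<in>UNIV. (y - x) $ i * convolution (partial_deriv i \<phi>) g x)) \<le> e * norm (y - x)"
    if "norm (y - x) < d" for y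
  proof -
    let ?h = "y - x"
    note I = convolution_integrable[OF assms(1) g] convolution_integrable[OF test_functions_partial_deriv[OF assms(1)] g]
    let ?E = "\<lambda>t. \<phi> (y - t) * g t - \<phi> (x - t) * g t - (\<Sum>i\<in>UNIV. ?h $ i * (partial_deriv i \<phi> (x - t) * g t))"
    have J: "integrable lborel (\<lambda>t. ?h $ i * (partial_deriv i \<phi> (x - t) * g t))" for i
      by (intro integrable_mult_right I)
    have K: "integrable lborel (\<lambda>t. \<phi> (y - t) * g t - \<phi> (x - t) * g t)"
      by (intro Bochner_Integration.integrable_diff I)
    have "convolution \<phi> g y - convolution \<phi> g x - (\<Sum>i\<in>UNIV. ?h $ i * convolution (partial_deriv i \<phi>) g x) = (LINT t|lborel. ?E t)"
      unfolding convolution_def Bochner_Integration.integral_diff[OF K Bochner_Integration.integrable_sum[OF J]]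
          Bochner_Integration.integral_diff[OF I(1)[of y] I(1)[of x]] Bochner_Integration.integral_sum[OF J]
          integral_mult_right_zero ..
    also have "norm \<dots> \<le> (LINT t|lborel. (e / (n + 1)) * norm ?h * \<bar>g t\<bar>)"
    proof (rule order_trans[OF integral_norm_bound], rule Bochner_Integration.integral_mono)
      show "integrable lborel (\<lambda>t. norm (?E t))"
        using integrable_norm[OF Bochner_Integration.integrable_diff[OF K Bochner_Integration.integrable_sum[OF J]]] .
      show "integrable lborel (\<lambda>t. (e / (n + 1)) * norm ?h * \<bar>g t\<bar>)" using g by simp
      show "norm (?E t) \<le> (e / (n + 1)) * norm ?h * \<bar>g t\<bar>" for t
      proof -
        have "(\<Sum>i\<in>UNIV. ?h $ i * (partial_deriv i \<phi> (x - t) * g t)) = (\<Sum>i\<in>UNIV. ?h $ i * partial_deriv i \<phi> (x - t)) * g t"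
          by (simp only: sum_distrib_right mult.assoc)
        then have "?E t = (\<phi> ((x - t) + ?h) - \<phi> (x - t) - (\<Sum>i\<in>UNIV. ?h $ i * partial_deriv i \<phi> (x - t))) * g t"
          by (simp add: left_diff_distrib)
        then show ?thesis
          using mult_right_mono[OF d(2)[OF that, of "x - t"], of "\<bar>g t\<bar>"] by (simp add: abs_mult)
      qed
    qed
    also have "\<dots> = (e / (n + 1) * n) * norm ?h" by (simp add: n_def)
    also have "\<dots> \<le> e * norm ?h" using e n by (intro mult_right_mono) (auto simp: field_simps)
    finally show ?thesis .
  qed
  then show "\<exists>d>0. \<forall>y. norm (y - x) < d \<longrightarrow> norm (convolution \<phi> g y - convolution \<phi> g x - (\<Sum>i\<in>UNIV. (y - x) $ i * convolution (partial_deriv i \<phi>) g x)) \<le> e * norm (y - x)"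
    using d(1) by blast
qed

lemma partial_deriv_convolution:
  assumes "\<phi> \<in> test_functions" and g: "integrable lborel g"
  shows "partial_deriv i (convolution \<phi> g) = convolution (partial_deriv i \<phi>) g"
proof
  fix x
  have "partial_deriv i (convolution \<phi> g) x = (\<Sum>j\<in>UNIV. axis i 1 $ j * convolution (partial_deriv j \<phi>) g x)"
    by (rule partial_deriv_eqI[OF convolution_has_derivative[OF assms]])
  also have "\<dots> = (\<Sum>j\<in>UNIV. if j = i then convolution (partial_deriv j \<phi>) g x else 0)"
    by (intro sum.cong) (auto simp: axis_def)
  finally show "partial_deriv i (convolution \<phi> g) x = convolution (partial_deriv i \<phi>) g x" by simp
qed

lemma C_k_convolution:
  assumes "\<phi> \<in> test_functions" and g: "integrable lborel g"
  shows "C_k k (convolution \<phi> g)"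
  using assms(1)
proof (induction k arbitrary: \<phi>)
  case 0
  then show ?case using convolution_has_derivative[OF _ g]
    by (auto simp: continuous_on_eq_continuous_at intro: has_derivative_continuous)
next
  case (Suc k)
  then show ?case using convolution_has_derivative[OF _ g] test_functions_partial_deriv
    by (auto simp: differentiable_def partial_deriv_convolution[OF _ g])
qed

section \<open>Mollifiers and cutoff functions\<close>

lemma lborel_integral_affine:
  fixes f :: "real^2 \<Rightarrow> real"
  assumes [measurable]: "f \<in> borel_measurable borel" and "c \<noteq> 0"
  shows "(LINT x|lborel. f x) = c\<^sup>2 * (LINT x|lborel. f (t + c *\<^sub>R x))"
  by (subst lborel_affine[OF assms(2), of t], subst integral_density) (auto simp: integral_distr)

lemma area_cball: "r \<ge> 0 \<Longrightarrow> emeasure lborel (cball (x::real^2) r) = ennreal (pi * r\<^sup>2)"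
  and area_ball: "r \<ge> 0 \<Longrightarrow> emeasure lborel (ball (x::real^2) r) = ennreal (pi * r\<^sup>2)"
  by (simp_all add: emeasure_cball emeasure_ball unit_ball_vol_numeral)

text \<open>The classical flat function exp(-1/t) multiplied by powers of 1/t. With the exponent as
  a parameter the family is closed under differentiation up to linear combinations, so smoothness
  follows by an induction on the order that runs over all \<open>m\<close> at once.\<close>

definition flat :: "nat \<Rightarrow> real \<Rightarrow> real" where
  "flat m t = (if t > 0 then inverse t ^ m * exp (- inverse t) else 0)"

lemma power_div_fact_le_exp: "x \<ge> 0 \<Longrightarrow> x ^ n / fact n \<le> exp (x::real)"
proof -
  assume "x \<ge> 0"
  then have "(\<Sum>k\<in>{n}. inverse (fact k) *\<^sub>R x ^ k) \<le> (\<Sum>k. inverse (fact k) *\<^sub>R x ^ k)"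
    by (intro sum_le_suminf summable_exp_generic) auto
  then show ?thesis by (simp add: exp_def field_simps)
qed

text \<open>A quadratic bound gives derivative 0 at the origin. It is one term of the exponential
  series, y^(m+2) / (m+2)! \<le> exp y at y = 1/t.\<close>

lemma flat_bound: "\<bar>flat m t\<bar> \<le> fact (m + 2) * t\<^sup>2"
proof (cases "t > 0")
  case True
  let ?y = "inverse t"
  have y: "?y > 0" using True by simp
  have "?y ^ (m + 2) / fact (m + 2) \<le> exp ?y" using y by (intro power_div_fact_le_exp) simp
  then have "?y ^ (m + 2) \<le> fact (m + 2) * exp ?y"
    by (simp only: pos_divide_le_eq fact_gt_zero mult.commute)
  from mult_right_mono[OF this, of "exp (- ?y)"]
  have "?y ^ (m + 2) * exp (- ?y) \<le> fact (m + 2)"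
    by (simp only: mult.assoc exp_minus_inverse mult_1_right exp_ge_zero)
  then have "?y ^ m * exp (- ?y) * ?y\<^sup>2 \<le> fact (m + 2)"
    by (simp only: power_add mult_ac)
  then have "?y ^ m * exp (- ?y) * ?y\<^sup>2 * t\<^sup>2 \<le> fact (m + 2) * t\<^sup>2"
    by (intro mult_right_mono) auto
  moreover have "?y\<^sup>2 * t\<^sup>2 = 1" using True by (simp add: field_simps)
  ultimately show ?thesis using True by (simp add: flat_def mult.assoc abs_mult del: fact_Suc)
qed (simp add: flat_def)

lemma flat_has_derivative: "(flat m has_real_derivative flat (m + 2) t - m * flat (m + 1) t) (at t)"
proof -
  consider "t > 0" | "t < 0" | "t = 0" by linarith
  then show ?thesis
  proof cases
    case 1
    have "((\<lambda>t. inverse t ^ m * exp (- inverse t)) has_real_derivative flat (m + 2) t - m * flat (m + 1) t) (at t)"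
      using 1 by (auto intro!: derivative_eq_intros simp: flat_def power2_eq_square algebra_simps)
        (cases m; simp add: algebra_simps)
    then show ?thesis
      using 1 by (elim has_field_derivative_transform_within_open[where S = "{0<..}"]) (auto simp: flat_def)
  next
    case 2
    have "((\<lambda>t::real. 0) has_real_derivative flat (m + 2) t - m * flat (m + 1) t) (at t)"
      using 2 by (simp add: flat_def)
    then show ?thesis
      using 2 by (elim has_field_derivative_transform_within_open[where S = "{..<0}"]) (auto simp: flat_def)
  next
    case 3
    have "((\<lambda>h. flat m h / h) \<longlongrightarrow> 0) (at 0)"
    proof (rule Lim_null_comparison)
      show "\<forall>\<^sub>F h in at 0. norm (flat m h / h) \<le> fact (m + 2) * \<bar>h\<bar>"
      proof (rule eventuallyI)
        fix h
        have "\<bar>flat m h\<bar> \<le> fact (m + 2) * \<bar>h\<bar> * \<bar>h\<bar>"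
          using flat_bound[of m h] by (simp add: power2_eq_square mult.assoc)
        then show "norm (flat m h / h) \<le> fact (m + 2) * \<bar>h\<bar>"
          by (cases "h = 0") (simp_all add: divide_le_eq del: fact_Suc)
      qed
      have "((\<lambda>h::real. fact (m + 2) * \<bar>h\<bar>) \<longlongrightarrow> fact (m + 2) * \<bar>0\<bar>) (at 0)"
        by (intro tendsto_intros)
      then show "((\<lambda>h::real. fact (m + 2) * \<bar>h\<bar>) \<longlongrightarrow> 0) (at 0)" by simp
    qed
    then have "(flat m has_real_derivative 0) (at 0)"
      by (simp add: has_field_derivative_iff flat_def[of _ 0])
    then show ?thesis using 3 by (simp add: flat_def[of _ 0])
  qed
qed

lemma C_k_component: "C_k k (\<lambda>x. x $ i)"
proof (cases k)
  case (Suc l)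
  have D: "((\<lambda>x. x $ i) has_derivative (\<lambda>h. h $ i)) (at x)" for x :: "real^2"
    by (intro bounded_linear_imp_has_derivative bounded_linear_vec_nth)
  have "partial_deriv j (\<lambda>x. x $ i) = (\<lambda>x. axis j 1 $ i)" for j
    using partial_deriv_eqI[OF D] by auto
  then show ?thesis using D Suc by (auto simp: C_k_const differentiable_def)
qed (auto intro: continuous_intros)

lemma C_k_flat: "C_k k (\<lambda>x. flat m (1 - x \<bullet> x))"
proof (induction k arbitrary: m)
  case 0
  have "continuous_on UNIV (flat m)"
    using DERIV_isCont[OF flat_has_derivative] by (auto simp: continuous_on_eq_continuous_at)
  then show ?case by (auto intro!: continuous_on_compose2[of UNIV "flat m"] continuous_intros)
next
  case (Suc k)
  have D: "((\<lambda>x. flat m (1 - x \<bullet> x)) has_derivative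
     (\<lambda>h. (flat (m + 2) (1 - x \<bullet> x) - m * flat (m + 1) (1 - x \<bullet> x)) * (- (x \<bullet> h + h \<bullet> x)))) (at x)" for x :: "real^2"
  proof -
    have "((\<lambda>x. 1 - x \<bullet> x) has_derivative (\<lambda>h. - (x \<bullet> h + h \<bullet> x))) (at x)"
      by (auto intro!: derivative_eq_intros)
    from has_derivative_compose[OF this flat_has_derivative[unfolded has_field_derivative_def]]
    show ?thesis by (simp add: mult.commute)
  qed
  have "partial_deriv i (\<lambda>x. flat m (1 - x \<bullet> x)) =
     (\<lambda>x. (flat (m + 2) (1 - x \<bullet> x) + (- real m) * flat (m + 1) (1 - x \<bullet> x)) * (- 2 * x $ i))" for i
    using partial_deriv_eqI[OF D, of i] by (auto simp: inner_axis inner_axis')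
  moreover have "C_k k (\<lambda>x. (flat (m + 2) (1 - x \<bullet> x) + (- real m) * flat (m + 1) (1 - x \<bullet> x)) * (- 2 * x $ i))" for i
    by (intro C_k_mult C_k_add C_k_const Suc C_k_component)
  ultimately show ?case using D by (auto simp: differentiable_def)
qed

definition bump :: "real^2 \<Rightarrow> real" where "bump x = flat 0 (1 - x \<bullet> x)"

lemma bump_nonneg: "bump x \<ge> 0" and bump_le_1: "bump x \<le> 1" and bump_minus: "bump (- x) = bump x"
  by (simp_all add: bump_def flat_def)

lemma bump_eq_0: "norm x \<ge> 1 \<Longrightarrow> bump x = 0"
  using mult_mono[of 1 "norm x" 1 "norm x"] by (simp add: bump_def flat_def dot_square_norm power2_eq_square)

lemma bump_test_functions: "bump \<in> test_functions"
  unfolding bump_def[abs_def] by (rule test_functionsI[of _ 1])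
   (use C_k_flat bump_eq_0 in \<open>auto simp: bump_def\<close>)

lemma bump_integral_pos: "(LINT x|lborel. bump x) > 0"
proof -
  have I: "integrable lborel bump" by (rule test_functions_integrable[OF bump_test_functions])
  \<comment> \<open>On this ball \<open>1 - x \<bullet> x\<close> is at least 3/4, so its inverse is
    below 2 with room to spare.\<close>
  have "bump x \<ge> exp (- 2) * indicator (ball 0 (1/2)) x" for x
  proof (cases "norm x < 1 / 2")
    case True
    then have "norm x * norm x \<le> 1 / 2 * (1 / 2)" by (intro mult_mono) auto
    then have n: "x \<bullet> x \<le> 1 / 4" by (simp add: dot_square_norm power2_eq_square)
    then have "inverse (1 - x \<bullet> x) \<le> 2"
      by (simp add: inverse_eq_divide divide_le_eq)
    then show ?thesis using n by (auto simp: bump_def flat_def indicator_def)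
  qed (use bump_nonneg in auto)
  moreover have "integrable lborel (\<lambda>x. exp (- 2) * indicator (ball (0::real^2) (1/2)) x :: real)"
    using area_ball[of "1/2" "0::real^2"] by (intro integrable_mult_right integrable_real_indicator) auto
  ultimately have "(LINT x|lborel. exp (- 2) * indicator (ball (0::real^2) (1/2)) x) \<le> (LINT x|lborel. bump x)"
    using I by (intro Bochner_Integration.integral_mono) auto
  then have "exp (- 2) * measure lborel (ball (0::real^2) (1/2)) \<le> (LINT x|lborel. bump x)"
    by simp
  moreover have "measure lborel (ball (0::real^2) (1/2)) = pi * (1 / 2)\<^sup>2"
    using area_ball[of "1/2" "0::real^2"] by (simp add: measure_def)
  moreover have "exp (- 2 :: real) * (pi * (1 / 2)\<^sup>2) > 0" by simp
  ultimately show ?thesis by (metis order_less_le_trans)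
qed

definition moll :: "real \<Rightarrow> real^2 \<Rightarrow> real" where
  "moll e x = bump ((1 / e) *\<^sub>R x) * (1 / (e\<^sup>2 * (LINT x|lborel. bump x)))"

lemma moll_nonneg: "moll e x \<ge> 0"
  using bump_integral_pos by (simp add: moll_def bump_nonneg)

lemma moll_minus: "moll e (- x) = moll e x"
  by (simp add: moll_def bump_minus)

lemma moll_commute: "moll e (x - y) = moll e (y - x)"
  using moll_minus[of e "x - y"] by simp

lemma moll_eq_0: "e > 0 \<Longrightarrow> norm x \<ge> e \<Longrightarrow> moll e x = 0"
  by (simp add: moll_def bump_eq_0)

lemma moll_test_functions: "e > 0 \<Longrightarrow> moll e \<in> test_functions"
  unfolding moll_def[abs_def]
  by (intro test_functions_mult C_k_const) (use test_functions_affine[OF bump_test_functions, of "1 / e" 0] in simp)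

lemma moll_borel [measurable]: "e > 0 \<Longrightarrow> moll e \<in> borel_measurable borel"
  by (rule test_functions_borel[OF moll_test_functions])

lemma moll_integral:
  assumes "e > 0"
  shows "(LINT y|lborel. moll e (x - y)) = 1" and "(LINT y|lborel. moll e (y - x)) = 1"
proof -
  note [measurable] = moll_borel[OF assms] test_functions_borel[OF bump_test_functions]
  have "(LINT x|lborel. bump x) = (1 / e)\<^sup>2 * (LINT x|lborel. bump (0 + (1 / e) *\<^sub>R x))"
    using assms by (intro lborel_integral_affine) auto
  then have "(LINT x|lborel. bump ((1 / e) *\<^sub>R x)) = e\<^sup>2 * (LINT x|lborel. bump x)"
    using assms by (simp add: field_simps)
  then have 1: "(LINT x|lborel. moll e x) = 1"
    using bump_integral_pos assms by (simp add: moll_def)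
  show "(LINT y|lborel. moll e (x - y)) = 1"
    using lborel_integral_affine[of "moll e" "-1" x] 1 assms by simp
  then show "(LINT y|lborel. moll e (y - x)) = 1"
    by (simp add: moll_commute[of e x])
qed

text \<open>Scaling: unit mass in two dimensions forces height 1/e^2, and each derivative costs a
  further factor 1/e. One constant serves all scales; it is the sup bound of the bump and its
  partial derivatives divided by the integral of the bump.\<close>

lemma moll_bounds:
  obtains c where "c > 0" "\<And>e x. e > 0 \<Longrightarrow> moll e x \<le> c / e\<^sup>2"
    "\<And>e x i. e > 0 \<Longrightarrow> \<bar>partial_deriv i (moll e) x\<bar> \<le> c / e ^ 3"
proof -
  let ?I = "LINT x|lborel. bump x"
  note I = bump_integral_pos
  have "\<exists>B. \<forall>x. \<bar>partial_deriv i bump x\<bar> \<le> B" for i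
    using test_functions_bounded[OF test_functions_partial_deriv[OF bump_test_functions]] by metis
  then obtain B where B: "\<And>i x. \<bar>partial_deriv i bump x\<bar> \<le> B i" by metis
  define c where "c = (1 + \<bar>B 1\<bar> + \<bar>B 2\<bar>) / ?I"
  have Bc: "\<bar>partial_deriv i bump x\<bar> \<le> 1 + \<bar>B 1\<bar> + \<bar>B 2\<bar>" for i x
    using B[where x = x and i = i] exhaust_2[of i] by auto
  have "c > 0" using I by (simp add: c_def field_simps add_pos_nonneg)
  moreover have "moll e x \<le> c / e\<^sup>2" if "e > 0" for e x
  proof -
    have "bump ((1 / e) *\<^sub>R x) \<le> 1 + \<bar>B 1\<bar> + \<bar>B 2\<bar>"
      using bump_le_1[of "(1 / e) *\<^sub>R x"] by linarith
    then show ?thesis using that I by (simp add: moll_def c_def divide_simps)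
  qed
  moreover have "\<bar>partial_deriv i (moll e) x\<bar> \<le> c / e ^ 3" if "e > 0" for e x i
  proof -
    have d: "bump differentiable at z" for z by (rule test_functions_differentiable[OF bump_test_functions])
    have "partial_deriv i (moll e) x = (1 / e) * partial_deriv i bump ((1 / e) *\<^sub>R x) * (1 / (e\<^sup>2 * ?I))"
      unfolding moll_def[abs_def] using partial_deriv_affine(1)[of bump 0 "1 / e" x i] partial_deriv_affine(2)[of bump 0 "1 / e" x] d
      by (subst partial_deriv_mult) (auto simp: partial_deriv_eqI[OF has_derivative_const])
    then have "\<bar>partial_deriv i (moll e) x\<bar> = \<bar>partial_deriv i bump ((1 / e) *\<^sub>R x)\<bar> / (e ^ 3 * ?I)"
      using that I by (simp add: abs_mult power2_eq_square power3_eq_cube)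
    also have "\<dots> \<le> (1 + \<bar>B 1\<bar> + \<bar>B 2\<bar>) / (e ^ 3 * ?I)"
      using Bc that I by (intro divide_right_mono) auto
    finally show ?thesis by (simp add: c_def mult.commute)
  qed
  ultimately show ?thesis using that by blast
qed

text \<open>The indicator of the ball of radius 3R/2 is mollified at scale R/2, which leaves it
  untouched within radius R and beyond 2R. The gradient bound is (c / e^3) times the area
  \<open>pi * e\<^sup>2\<close> with e = R/2, whence the value of \<open>K\<close>. Its independence
  of R makes the integral of the squared gradient bounded in R.\<close>

lemma cutoff_functions:
  obtains K where "K > 0" "\<And>R. R > 0 \<Longrightarrow> \<exists>\<eta>\<in>test_functions. (\<forall>x. 0 \<le> \<eta> x \<and> \<eta> x \<le> 1) \<and>
    (\<forall>x. norm x \<le> R \<longrightarrow> \<eta> x = 1) \<and> (\<forall>x. norm x > 2 * R \<longrightarrow> \<eta> x = 0) \<and>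
    (\<forall>x i. \<bar>partial_deriv i \<eta> x\<bar> \<le> K / R)"
proof -
  obtain c where c: "c > 0" "\<And>e x. e > 0 \<Longrightarrow> moll e x \<le> c / e\<^sup>2"
    "\<And>e x i. e > 0 \<Longrightarrow> \<bar>partial_deriv i (moll e) x\<bar> \<le> c / e ^ 3" using moll_bounds by blast
  define K where "K = 2 * pi * c"
  have "K > 0" using c by (simp add: K_def)
  moreover have "\<exists>\<eta>\<in>test_functions. (\<forall>x. 0 \<le> \<eta> x \<and> \<eta> x \<le> 1) \<and>
    (\<forall>x. norm x \<le> R \<longrightarrow> \<eta> x = 1) \<and> (\<forall>x. norm x > 2 * R \<longrightarrow> \<eta> x = 0) \<and>
    (\<forall>x i. \<bar>partial_deriv i \<eta> x\<bar> \<le> K / R)" if R: "R > 0" for R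
  proof -
    define e where "e = R / 2"
    have e: "e > 0" using R by (simp add: e_def)
    note M = moll_test_functions[OF e]
    let ?g = "indicator (cball 0 (3 * e)) :: real^2 \<Rightarrow> real"
    let ?\<eta> = "convolution (moll e) ?g"
    have g: "integrable lborel ?g"
      using area_cball[of "3 * e" "0::real^2"] e by (intro integrable_real_indicator) auto
    have I: "integrable lborel (\<lambda>y. moll e (x - y) * ?g y)" for x
      by (rule convolution_integrable[OF M g])
    have I': "integrable lborel (\<lambda>y. moll e (x - y))" for x
      using test_functions_integrable[OF test_functions_affine[OF M, of "-1" x]] by simp
    have 1: "?\<eta> x \<ge> 0" for x
      unfolding convolution_def by (intro Bochner_Integration.integral_nonneg mult_nonneg_nonneg moll_nonneg) auto
    have 2: "?\<eta> x \<le> 1" for x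
      unfolding convolution_def moll_integral(1)[OF e, of x, symmetric]
      by (intro Bochner_Integration.integral_mono I I') (auto simp: indicator_def moll_nonneg)
    have 3: "?\<eta> x = 1" if "norm x \<le> R" for x
    proof -
      have "moll e (x - y) * ?g y = moll e (x - y)" for y
      proof (cases "norm (x - y) \<ge> e")
        case False
        then have "norm y \<le> 3 * e" using that norm_triangle_ineq4[of x "x - y"] by (simp add: e_def)
        then show ?thesis by simp
      qed (simp add: moll_eq_0 e)
      then show ?thesis by (simp only: convolution_def moll_integral(1)[OF e])
    qed
    have 4: "?\<eta> x = 0" if "norm x > 2 * R" for x
    proof -
      have "moll e (x - y) * ?g y = 0" for y
      proof (cases "norm (x - y) \<ge> e")
        case False
        then have "norm y > 3 * e" using that norm_triangle_ineq2[of x y] R by (simp add: e_def)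
        then show ?thesis by simp
      qed (simp add: moll_eq_0 e)
      then show ?thesis by (simp only: convolution_def Bochner_Integration.integral_zero)
    qed
    have 5: "\<bar>partial_deriv i ?\<eta> x\<bar> \<le> K / R" for x i
    proof -
      have z: "partial_deriv i (moll e) z = 0" if "norm z > e" for z
        using moll_eq_0[OF e] that by (intro partial_deriv_eq_0_outside[of e]) auto
      have J: "integrable lborel (\<lambda>y. c / e ^ 3 * indicator (cball x e) y)"
        using area_cball[of e x] e by (intro integrable_mult_right integrable_real_indicator) auto
      have "\<bar>partial_deriv i ?\<eta> x\<bar> = norm (LINT y|lborel. partial_deriv i (moll e) (x - y) * ?g y)"
        by (simp add: partial_deriv_convolution[OF M g] convolution_def)
      also have "\<dots> \<le> (LINT y|lborel. c / e ^ 3 * indicator (cball x e) y)"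
      proof (rule order_trans[OF integral_norm_bound], rule Bochner_Integration.integral_mono)
        show "integrable lborel (\<lambda>y. norm (partial_deriv i (moll e) (x - y) * ?g y))"
          by (intro integrable_norm convolution_integrable g test_functions_partial_deriv M)
        show "norm (partial_deriv i (moll e) (x - y) * ?g y) \<le> c / e ^ 3 * indicator (cball x e) y" for y
          using c(1) c(3)[OF e, of i "x - y"] z[of "x - y"] e by (auto simp: indicator_def dist_norm)
      qed (rule J)
      also have "\<dots> = c / e ^ 3 * (pi * e\<^sup>2)"
        using area_cball[of e x] e by (simp add: measure_def)
      also have "\<dots> = K / R" using e by (simp add: K_def e_def power2_eq_square power3_eq_cube field_simps)
      finally show ?thesis .
    qed
    have "?\<eta> \<in> test_functions"
      by (rule test_functionsI[of _ "2 * R"]) (use 4 C_k_convolution[OF M g] in auto)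
    with 1 2 3 4 5 show ?thesis by blast
  qed
  ultimately show ?thesis using that by blast
qed

section \<open>Continuity of translations in the mean\<close>

text \<open>Values in \<open>ennreal\<close>, because the kernel occurs only inside nonnegative
  iterated integrals, where Tonelli asks for nothing but measurability.\<close>

definition near :: "real \<Rightarrow> real^2 \<Rightarrow> real^2 \<Rightarrow> ennreal" where
  "near s x y = (if dist x y < s then 1 else 0)"

lemma near_measurable [measurable]:
  assumes [measurable]: "f \<in> borel_measurable M" "g \<in> borel_measurable M"
  shows "(\<lambda>p. near s (f p) (g p)) \<in> borel_measurable M"
  unfolding near_def by measurable

lemma near_commute: "near s x y = near s y x"
  by (simp add: near_def dist_commute)

lemma nn_integral_near: "s \<ge> 0 \<Longrightarrow> (\<integral>\<^sup>+y. near s x y \<partial>lborel) = ennreal (pi * s\<^sup>2)"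
proof -
  assume "s \<ge> 0"
  have "near s x = indicator (ball x s)"
    by (auto simp: near_def indicator_def)
  then show ?thesis using area_ball[OF \<open>s \<ge> 0\<close>, of x] by simp
qed

definition L1_modulus :: "real \<Rightarrow> (real^2 \<Rightarrow> real) \<Rightarrow> ennreal" where
  "L1_modulus s f = (\<integral>\<^sup>+x. \<integral>\<^sup>+y. ennreal \<bar>f x - f y\<bar> * near s x y \<partial>lborel \<partial>lborel)"

lemma nn_integral_near_left:
  assumes [measurable]: "h \<in> borel_measurable borel" and "s \<ge> 0"
  shows "(\<integral>\<^sup>+x. \<integral>\<^sup>+y. h x * near s x y \<partial>lborel \<partial>lborel) = ennreal (pi * s\<^sup>2) * (\<integral>\<^sup>+x. h x \<partial>lborel)"
proof -
  have "(\<integral>\<^sup>+x. \<integral>\<^sup>+y. h x * near s x y \<partial>lborel \<partial>lborel) = (\<integral>\<^sup>+x. h x * ennreal (pi * s\<^sup>2) \<partial>lborel)"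
    by (simp add: nn_integral_cmult nn_integral_near assms(2))
  then show ?thesis by (simp add: nn_integral_multc mult.commute)
qed

lemma nn_integral_near_right:
  assumes [measurable]: "h \<in> borel_measurable borel" and "s \<ge> 0"
  shows "(\<integral>\<^sup>+x. \<integral>\<^sup>+y. h y * near s x y \<partial>lborel \<partial>lborel) = ennreal (pi * s\<^sup>2) * (\<integral>\<^sup>+x. h x \<partial>lborel)"
proof -
  have "(\<integral>\<^sup>+x. \<integral>\<^sup>+y. h y * near s x y \<partial>lborel \<partial>lborel) = (\<integral>\<^sup>+y. \<integral>\<^sup>+x. h y * near s x y \<partial>lborel \<partial>lborel)"
    by (intro lborel_pair.Fubini'[symmetric]) measurable
  also have "\<dots> = (\<integral>\<^sup>+y. \<integral>\<^sup>+x. h y * near s y x \<partial>lborel \<partial>lborel)"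
    by (simp add: near_commute)
  finally show ?thesis using nn_integral_near_left[OF assms] by simp
qed

lemma L1_modulus_perturb:
  assumes [measurable]: "f \<in> borel_measurable borel" "g \<in> borel_measurable borel" and s: "s \<ge> 0"
  shows "L1_modulus s f \<le> L1_modulus s g + ennreal (2 * pi * s\<^sup>2) * (\<integral>\<^sup>+x. ennreal \<bar>f x - g x\<bar> \<partial>lborel)"
proof -
  let ?h = "\<lambda>x. ennreal \<bar>f x - g x\<bar>"
  have "L1_modulus s f \<le> (\<integral>\<^sup>+x. \<integral>\<^sup>+y. ennreal \<bar>g x - g y\<bar> * near s x y + (?h x * near s x y + ?h y * near s x y) \<partial>lborel \<partial>lborel)"
    unfolding L1_modulus_def
  proof (intro nn_integral_mono)
    fix x y
    have "ennreal \<bar>f x - f y\<bar> \<le> ennreal (\<bar>g x - g y\<bar> + (\<bar>f x - g x\<bar> + \<bar>f y - g y\<bar>))"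
      by (intro ennreal_leI) linarith
    also have "\<dots> = ennreal \<bar>g x - g y\<bar> + (?h x + ?h y)" by (simp add: ennreal_plus)
    finally show "ennreal \<bar>f x - f y\<bar> * near s x y \<le> ennreal \<bar>g x - g y\<bar> * near s x y + (?h x * near s x y + ?h y * near s x y)"
      by (simp add: distrib_right[symmetric] mult_right_mono)
  qed
  also have "\<dots> = L1_modulus s g + (ennreal (pi * s\<^sup>2) * (\<integral>\<^sup>+x. ?h x \<partial>lborel) + ennreal (pi * s\<^sup>2) * (\<integral>\<^sup>+x. ?h x \<partial>lborel))"
    unfolding L1_modulus_def
    by (subst nn_integral_near_left[symmetric, OF _ s], simp)
       (subst nn_integral_near_right[symmetric, OF _ s], simp, simp add: nn_integral_add)
  also have "ennreal (pi * s\<^sup>2) * (\<integral>\<^sup>+x. ?h x \<partial>lborel) + ennreal (pi * s\<^sup>2) * (\<integral>\<^sup>+x. ?h x \<partial>lborel)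
     = ennreal (2 * pi * s\<^sup>2) * (\<integral>\<^sup>+x. ?h x \<partial>lborel)"
    by (simp add: distrib_right[symmetric] ennreal_plus[symmetric] del: ennreal_plus)
  finally show ?thesis .
qed

text \<open>Divided by the area of the disc of radius s, \<open>L1_modulus s f\<close> is the mean
  over shifts h with |h| < s of the L1 norm of f(. + h) - f. So this is L1-continuity of
  translations in averaged form, written as o(s^2) to match kernels of height 1/s^2.\<close>

definition L1_continuous :: "(real^2 \<Rightarrow> real) \<Rightarrow> bool" where
  "L1_continuous f \<longleftrightarrow> (\<forall>e>0. \<exists>s0>0. \<forall>s. 0 < s \<and> s < s0 \<longrightarrow> L1_modulus s f \<le> ennreal (e * s\<^sup>2))"

text \<open>By \<open>L1_modulus_perturb\<close> an L1 error costs a multiple of s^2, the same order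
  as the quantity to be bounded, uniformly in s. The tolerance \<open>e / (4 * pi)\<close> turns
  this cost into half of the budget.\<close>

lemma L1_continuous_closed:
  assumes [measurable]: "f \<in> borel_measurable borel"
    and "\<And>d. d > 0 \<Longrightarrow> \<exists>g. g \<in> borel_measurable borel \<and> L1_continuous g \<and> (\<integral>\<^sup>+x. ennreal \<bar>f x - g x\<bar> \<partial>lborel) \<le> ennreal d"
  shows "L1_continuous f"
  unfolding L1_continuous_def
proof (intro allI impI)
  fix e :: real assume e: "e > 0"
  then have "e / (4 * pi) > 0" by simp
  from assms(2)[OF this] obtain g where g[measurable]: "g \<in> borel_measurable borel" "L1_continuous g"
    and d: "(\<integral>\<^sup>+x. ennreal \<bar>f x - g x\<bar> \<partial>lborel) \<le> ennreal (e / (4 * pi))" by blast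
  from g(2) e obtain s0 where s0: "s0 > 0" "\<And>s. 0 < s \<Longrightarrow> s < s0 \<Longrightarrow> L1_modulus s g \<le> ennreal (e / 2 * s\<^sup>2)"
    unfolding L1_continuous_def by (metis half_gt_zero)
  have "L1_modulus s f \<le> ennreal (e * s\<^sup>2)" if "0 < s" "s < s0" for s
  proof -
    have "L1_modulus s f \<le> L1_modulus s g + ennreal (2 * pi * s\<^sup>2) * (\<integral>\<^sup>+x. ennreal \<bar>f x - g x\<bar> \<partial>lborel)"
      using that by (intro L1_modulus_perturb) auto
    also have "\<dots> \<le> ennreal (e / 2 * s\<^sup>2) + ennreal (2 * pi * s\<^sup>2) * ennreal (e / (4 * pi))"
      by (intro add_mono mult_left_mono s0 that d) auto
    also have "\<dots> = ennreal (e * s\<^sup>2)"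
      using e by (simp add: ennreal_mult[symmetric] ennreal_plus[symmetric] del: ennreal_plus)
    finally show ?thesis .
  qed
  then show "\<exists>s0>0. \<forall>s. 0 < s \<and> s < s0 \<longrightarrow> L1_modulus s f \<le> ennreal (e * s\<^sup>2)" using s0(1) by blast
qed

text \<open>A pair closer than \<open>s\<close> contributes at most \<open>L * s\<close>, and only
  if one of its points lies in \<open>A\<close>. The total is \<open>2 * pi * L * m * s ^ 3\<close>,
  one order better than required; \<open>m + 1\<close> in \<open>s0\<close> guards against a null
  set \<open>A\<close>.\<close>

lemma L1_continuous_Lipschitz:
  fixes f :: "real^2 \<Rightarrow> real"
  assumes [measurable]: "A \<in> sets borel" and fin: "emeasure lborel A < \<infinity>"
    and lip: "\<And>x y. \<bar>f x - f y\<bar> \<le> L * dist x y" and L: "L > 0" and z: "\<And>x. x \<notin> A \<Longrightarrow> f x = 0"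
  shows "L1_continuous f"
  unfolding L1_continuous_def
proof (intro allI impI)
  fix e :: real assume e: "e > 0"
  define m where "m = measure lborel A"
  have m: "m \<ge> 0" "emeasure lborel A = ennreal m"
    using fin by (auto simp: m_def emeasure_eq_ennreal_measure)
  define s0 where "s0 = e / (2 * pi * L * (m + 1))"
  have s0: "s0 > 0" using e L m by (simp add: s0_def)
  have "L1_modulus s f \<le> ennreal (e * s\<^sup>2)" if s: "0 < s" "s < s0" for s
  proof -
    have "L1_modulus s f \<le> (\<integral>\<^sup>+x. \<integral>\<^sup>+y. ennreal (L * s) * indicator A x * near s x y + ennreal (L * s) * indicator A y * near s x y \<partial>lborel \<partial>lborel)"
      unfolding L1_modulus_def
    proof (intro nn_integral_mono)
      fix x y
      show "ennreal \<bar>f x - f y\<bar> * near s x y \<le> ennreal (L * s) * indicator A x * near s x y + ennreal (L * s) * indicator A y * near s x y"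
      proof (cases "dist x y < s")
        case True
        have "\<bar>f x - f y\<bar> \<le> L * s"
          using lip[of x y] mult_left_mono[of "dist x y" s L] True L by linarith
        then have "ennreal \<bar>f x - f y\<bar> \<le> ennreal (L * s)" by (rule ennreal_leI)
        then show ?thesis using z[of x] z[of y] True
          by (cases "x \<in> A"; cases "y \<in> A") (auto simp: near_def intro: order_trans)
      qed (simp add: near_def)
    qed
    also have "\<dots> = ennreal (pi * s\<^sup>2) * (\<integral>\<^sup>+x. ennreal (L * s) * indicator A x \<partial>lborel) + ennreal (pi * s\<^sup>2) * (\<integral>\<^sup>+x. ennreal (L * s) * indicator A x \<partial>lborel)"
      using s by (subst nn_integral_near_left[symmetric]) (simp_all, subst nn_integral_near_right[symmetric], simp_all add: nn_integral_add)
    also have "\<dots> = ennreal (2 * (pi * s\<^sup>2 * (L * s * m)))"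
      using s L m by (simp add: nn_integral_cmult m(2) ennreal_mult[symmetric] ennreal_plus[symmetric] del: ennreal_plus)
    also have "\<dots> \<le> ennreal (e * s\<^sup>2)"
    proof (intro ennreal_leI)
      have "s * (2 * pi * L * (m + 1)) \<le> e"
      proof -
        have "2 * pi * L * (m + 1) > 0" using L m by simp
        then show ?thesis using s(2) by (simp only: s0_def pos_less_divide_eq less_imp_le)
      qed
      moreover have "s * (2 * pi * L * m) \<le> s * (2 * pi * L * (m + 1))"
        using s L by (intro mult_left_mono) auto
      ultimately have "s * (2 * pi * L * m) \<le> e" by linarith
      from mult_right_mono[OF this, of "s\<^sup>2"]
      show "2 * (pi * s\<^sup>2 * (L * s * m)) \<le> e * s\<^sup>2" by (simp add: algebra_simps)
    qed
    finally show ?thesis .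
  qed
  then show "\<exists>s0>0. \<forall>s. 0 < s \<and> s < s0 \<longrightarrow> L1_modulus s f \<le> ennreal (e * s\<^sup>2)" using s0 by blast
qed

lemma L1_continuous_cmult:
  assumes [measurable]: "f \<in> borel_measurable borel" and "L1_continuous f"
  shows "L1_continuous (\<lambda>x. c * f x)"
  unfolding L1_continuous_def
proof (intro allI impI)
  fix e :: real assume e: "e > 0"
  then have "e / (\<bar>c\<bar> + 1) > 0" by (simp add: add_nonneg_pos)
  with assms(2) obtain s0 where s0: "s0 > 0" "\<And>s. 0 < s \<Longrightarrow> s < s0 \<Longrightarrow> L1_modulus s f \<le> ennreal (e / (\<bar>c\<bar> + 1) * s\<^sup>2)"
    unfolding L1_continuous_def by metis
  have "L1_modulus s (\<lambda>x. c * f x) \<le> ennreal (e * s\<^sup>2)" if "0 < s" "s < s0" for s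
  proof -
    have "\<bar>c * a - c * b\<bar> = \<bar>c\<bar> * \<bar>a - b\<bar>" for a b by (simp add: abs_mult[symmetric] right_diff_distrib)
    then have "L1_modulus s (\<lambda>x. c * f x) = ennreal \<bar>c\<bar> * L1_modulus s f"
      by (simp add: L1_modulus_def ennreal_mult nn_integral_cmult mult.assoc)
    also have "\<dots> \<le> ennreal \<bar>c\<bar> * ennreal (e / (\<bar>c\<bar> + 1) * s\<^sup>2)"
      by (intro mult_left_mono s0 that) auto
    also have "\<dots> = ennreal (\<bar>c\<bar> * (e / (\<bar>c\<bar> + 1) * s\<^sup>2))" using e by (intro ennreal_mult[symmetric]) auto
    also have "\<dots> \<le> ennreal (e * s\<^sup>2)"
    proof (intro ennreal_leI)
      have "\<bar>c\<bar> * (e / (\<bar>c\<bar> + 1)) \<le> e" using e by (simp add: field_simps)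
      from mult_right_mono[OF this, of "s\<^sup>2"] show "\<bar>c\<bar> * (e / (\<bar>c\<bar> + 1) * s\<^sup>2) \<le> e * s\<^sup>2" by (simp add: mult.assoc)
    qed
    finally show ?thesis .
  qed
  then show "\<exists>s0>0. \<forall>s. 0 < s \<and> s < s0 \<longrightarrow> L1_modulus s (\<lambda>x. c * f x) \<le> ennreal (e * s\<^sup>2)" using s0(1) by blast
qed

lemma L1_continuous_add:
  assumes [measurable]: "f \<in> borel_measurable borel" "g \<in> borel_measurable borel" and "L1_continuous f" "L1_continuous g"
  shows "L1_continuous (\<lambda>x. f x + g x)"
  unfolding L1_continuous_def
proof (intro allI impI)
  fix e :: real assume e: "e > 0"
  then have e2: "e / 2 > 0" by simp
  from assms(3) e2 obtain s0 where s0: "s0 > 0" "\<And>s. 0 < s \<Longrightarrow> s < s0 \<Longrightarrow> L1_modulus s f \<le> ennreal (e / 2 * s\<^sup>2)"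
    unfolding L1_continuous_def by metis
  from assms(4) e2 obtain s1 where s1: "s1 > 0" "\<And>s. 0 < s \<Longrightarrow> s < s1 \<Longrightarrow> L1_modulus s g \<le> ennreal (e / 2 * s\<^sup>2)"
    unfolding L1_continuous_def by metis
  have "L1_modulus s (\<lambda>x. f x + g x) \<le> ennreal (e * s\<^sup>2)" if "0 < s" "s < min s0 s1" for s
  proof -
    have "L1_modulus s (\<lambda>x. f x + g x) \<le> (\<integral>\<^sup>+x. \<integral>\<^sup>+y. ennreal \<bar>f x - f y\<bar> * near s x y + ennreal \<bar>g x - g y\<bar> * near s x y \<partial>lborel \<partial>lborel)"
      unfolding L1_modulus_def
    proof (intro nn_integral_mono)
      fix x y
      have "ennreal \<bar>f x + g x - (f y + g y)\<bar> \<le> ennreal (\<bar>f x - f y\<bar> + \<bar>g x - g y\<bar>)"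
        by (intro ennreal_leI) linarith
      then show "ennreal \<bar>f x + g x - (f y + g y)\<bar> * near s x y \<le> ennreal \<bar>f x - f y\<bar> * near s x y + ennreal \<bar>g x - g y\<bar> * near s x y"
        by (simp add: distrib_right[symmetric] mult_right_mono ennreal_plus)
    qed
    also have "\<dots> = L1_modulus s f + L1_modulus s g"
      unfolding L1_modulus_def by (simp add: nn_integral_add)
    also have "\<dots> \<le> ennreal (e / 2 * s\<^sup>2) + ennreal (e / 2 * s\<^sup>2)"
      using that by (intro add_mono s0 s1) auto
    also have "\<dots> = ennreal (e * s\<^sup>2)"
      using e by (simp add: ennreal_plus[symmetric] del: ennreal_plus)
    finally show ?thesis .
  qed
  then show "\<exists>s0>0. \<forall>s. 0 < s \<and> s < s0 \<longrightarrow> L1_modulus s (\<lambda>x. f x + g x) \<le> ennreal (e * s\<^sup>2)" using s0(1) s1(1)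
    by (intro exI[of _ "min s0 s1"]) auto
qed

lemma tendsto_nn_integral_imp_le:
  assumes "(\<lambda>n. \<integral>\<^sup>+x. ennreal (h n x) \<partial>M) \<longlonglongrightarrow> 0" "d > 0"
  shows "\<exists>n. (\<integral>\<^sup>+x. ennreal (h n x) \<partial>M) \<le> ennreal d"
proof -
  have "\<forall>\<^sub>F n in sequentially. (\<integral>\<^sup>+x. ennreal (h n x) \<partial>M) < ennreal d"
    using assms by (intro order_tendstoD(2)[OF assms(1)]) auto
  then obtain N where "\<And>n. n \<ge> N \<Longrightarrow> (\<integral>\<^sup>+x. ennreal (h n x) \<partial>M) < ennreal d"
    unfolding eventually_sequentially by auto
  then show ?thesis by (intro exI[of _ N] less_imp_le) simp
qed

text \<open>Two approximations in L1: outer regularity replaces \<open>A\<close> by an open set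
  \<open>U\<close>, and the indicator of \<open>U\<close> is the increasing limit of Lipschitz
  functions of the distance to the complement.\<close>

lemma L1_continuous_indicator:
  assumes A: "A \<in> sets borel" and fin: "emeasure lborel A < \<infinity>"
  shows "L1_continuous (indicator A)"
proof (rule L1_continuous_closed[OF borel_measurable_indicator[OF A]])
  fix d :: real assume d: "d > 0"
  obtain U where U: "open U" "A \<subseteq> U" "emeasure lborel (U - A) < d"
    using outer_regular_lborel[OF A d] by blast
  have U_borel[measurable]: "U \<in> sets borel" using U by simp
  note A[measurable]
  have "emeasure lborel U \<le> emeasure lborel A + emeasure lborel (U - A)"
    using emeasure_subadditive[of A lborel "U - A"] U(2) A by (simp add: Un_absorb1)
  also have "\<dots> < \<infinity>"
    using fin order_less_trans[OF U(3) ennreal_less_top] by simp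
  finally have finU: "emeasure lborel U < \<infinity>" .
  show "\<exists>g. g \<in> borel_measurable borel \<and> L1_continuous g \<and> (\<integral>\<^sup>+x. ennreal \<bar>indicator A x - g x\<bar> \<partial>lborel) \<le> ennreal d"
  proof (intro exI[of _ "indicator U"] conjI)
    show "L1_continuous (indicator U)"
    proof (rule L1_continuous_closed)
      fix d :: real assume d: "d > 0"
      define f where "f n x = min 1 (real (Suc n) * infdist x (- U))" for n and x :: "real^2"
      have f_cont: "continuous_on UNIV (f n)" for n
        unfolding f_def by (intro continuous_intros)
      then have [measurable]: "f n \<in> borel_measurable borel" for n
        by (rule borel_measurable_continuous_onI)
      \<comment> \<open>\<open>infdist\<close> to the empty set is 0 by convention, so the
        approximants would vanish identically if \<open>U\<close> were the whole plane; finite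
        measure excludes this.\<close>
      have nU: "- U \<noteq> {}"
      proof
        assume "- U = {}"
        then have "U = UNIV" by auto
        then show False using finU by simp
      qed
      have f01: "0 \<le> f n x" "f n x \<le> 1" "x \<notin> U \<Longrightarrow> f n x = 0" for n x
        by (auto simp: f_def infdist_nonneg)
      have lim: "(\<lambda>n. f n x) \<longlonglongrightarrow> indicator U x" for x
      proof (cases "x \<in> U")
        case True
        then have pos: "infdist x (- U) > 0"
          using nU U(1) by (metis ComplD closed_Compl in_closed_iff_infdist_zero infdist_nonneg order_le_less)
        obtain N where N: "1 / infdist x (- U) < real N" using reals_Archimedean2 by blast
        have "f n x = 1" if "n \<ge> N" for n
        proof -
          have "1 / infdist x (- U) \<le> real (Suc n)" using N that by linarith
          then show ?thesis using pos by (simp add: f_def field_simps)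
        qed
        then have "\<forall>\<^sub>F n in sequentially. f n x = indicator U x"
          using True by (auto simp: eventually_sequentially)
        then show ?thesis by (rule tendsto_eventually)
      qed (simp add: f01)
      have "(\<lambda>n. \<integral>\<^sup>+x. ennreal \<bar>indicator U x - f n x\<bar> \<partial>lborel) \<longlonglongrightarrow> (\<integral>\<^sup>+x. 0 \<partial>(lborel::(real^2) measure))"
      proof (rule nn_integral_dominated_convergence[where w = "indicator U"])
        show "AE x in lborel. ennreal \<bar>indicator U x - f n x\<bar> \<le> indicator U x" for n
        proof (intro AE_I2)
          fix x
          show "ennreal \<bar>indicator U x - f n x\<bar> \<le> indicator U x"
            using f01(1)[of n x] f01(2)[of n x] f01(3)[of x n] by (cases "x \<in> U") auto
        qed
        show "AE x in lborel. (\<lambda>n. ennreal \<bar>indicator U x - f n x\<bar>) \<longlonglongrightarrow> 0"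
        proof (intro AE_I2)
          fix x
          have "(\<lambda>n. ennreal \<bar>indicator U x - f n x\<bar>) \<longlonglongrightarrow> ennreal \<bar>indicator U x - indicator U x\<bar>"
            by (intro tendsto_intros lim tendsto_ennrealI)
          then show "(\<lambda>n. ennreal \<bar>indicator U x - f n x\<bar>) \<longlonglongrightarrow> 0" by simp
        qed
        show "(\<integral>\<^sup>+ x. indicator U x \<partial>lborel) < \<infinity>" using finU by simp
      qed measurable
      then have "(\<lambda>n. \<integral>\<^sup>+x. ennreal \<bar>indicator U x - f n x\<bar> \<partial>lborel) \<longlonglongrightarrow> 0" by simp
      from tendsto_nn_integral_imp_le[OF this d]
      obtain n where n: "(\<integral>\<^sup>+x. ennreal \<bar>indicator U x - f n x\<bar> \<partial>lborel) \<le> ennreal d" by blast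
      have "\<bar>f n x - f n y\<bar> \<le> real (Suc n) * dist x y" for x y
      proof -
        have "\<bar>infdist x (- U) - infdist y (- U)\<bar> \<le> dist x y"
          using infdist_triangle[of x "- U" y] infdist_triangle[of y "- U" x] by (simp add: dist_commute abs_le_iff)
        from mult_left_mono[OF this, of "real (Suc n)"]
        have "\<bar>real (Suc n) * infdist x (- U) - real (Suc n) * infdist y (- U)\<bar> \<le> real (Suc n) * dist x y"
          by (simp add: abs_mult[symmetric] right_diff_distrib[symmetric] del: of_nat_Suc) (simp add: abs_mult)
        then show ?thesis unfolding f_def by linarith
      qed
      then have "L1_continuous (f n)"
        using finU f01(3) by (intro L1_continuous_Lipschitz[of U _ "real (Suc n)"]) auto
      with n show "\<exists>g. g \<in> borel_measurable borel \<and> L1_continuous g \<and> (\<integral>\<^sup>+x. ennreal \<bar>indicator U x - g x\<bar> \<partial>lborel) \<le> ennreal d"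
        by (intro exI[of _ "f n"]) auto
    qed measurable
    have "(\<integral>\<^sup>+x. ennreal \<bar>indicator A x - indicator U x\<bar> \<partial>lborel) = (\<integral>\<^sup>+x. indicator (U - A) x \<partial>lborel)"
      using U(2) by (intro nn_integral_cong) (auto simp: indicator_def)
    then show "(\<integral>\<^sup>+x. ennreal \<bar>indicator A x - indicator U x\<bar> \<partial>lborel) \<le> ennreal d"
      using U(3) by (simp add: less_imp_le)
  qed measurable
qed

text \<open>This is used three times: for L1 convergence of mollifications, for the error at the
  finest dyadic scale, and for the bounded part of the commutator.\<close>

lemma L1_continuous_integrable:
  assumes "integrable lborel f"
  shows "L1_continuous f"
  using assms
proof (induction rule: integrable_induct)
  case (base A c)
  then show ?case
    using L1_continuous_cmult[OF _ L1_continuous_indicator[of A], of c] by (simp add: mult.commute)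
next
  case (add f g)
  then show ?case by (intro L1_continuous_add) auto
next
  case (lim f s)
  note [measurable] = borel_measurable_integrable[OF lim(4)] borel_measurable_integrable[OF lim(1)]
  have fm: "f \<in> borel_measurable borel" using borel_measurable_integrable[OF lim(4)] by simp
  show ?case
  proof (rule L1_continuous_closed[OF fm])
    fix d :: real assume d: "d > 0"
    have "(\<lambda>n. \<integral>\<^sup>+x. ennreal \<bar>f x - s n x\<bar> \<partial>lborel) \<longlonglongrightarrow> (\<integral>\<^sup>+x. 0 \<partial>(lborel::(real^2) measure))"
    proof (rule nn_integral_dominated_convergence[where w = "\<lambda>x. ennreal (3 * \<bar>f x\<bar>)"])
      show "AE x in lborel. ennreal \<bar>f x - s n x\<bar> \<le> ennreal (3 * \<bar>f x\<bar>)" for n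
      proof (intro AE_I2 ennreal_leI)
        \<comment> \<open>The induction rule supplies
          \<open>\<bar>s n x\<bar> \<le> 2 * \<bar>f x\<bar>\<close>, hence the factor 3.\<close>
        fix x show "\<bar>f x - s n x\<bar> \<le> 3 * \<bar>f x\<bar>" using lim(3)[of x n] by simp
      qed
      show "AE x in lborel. (\<lambda>n. ennreal \<bar>f x - s n x\<bar>) \<longlonglongrightarrow> 0"
      proof (intro AE_I2)
        fix x
        have "(\<lambda>n. ennreal \<bar>f x - s n x\<bar>) \<longlonglongrightarrow> ennreal \<bar>f x - f x\<bar>"
          using lim(2)[of x] by (intro tendsto_intros tendsto_ennrealI) auto
        then show "(\<lambda>n. ennreal \<bar>f x - s n x\<bar>) \<longlonglongrightarrow> 0" by simp
      qed
      show "(\<integral>\<^sup>+ x. ennreal (3 * \<bar>f x\<bar>) \<partial>lborel) < \<infinity>"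
        using lim(4) by (subst nn_integral_eq_integral) auto
    qed measurable
    then have "(\<lambda>n. \<integral>\<^sup>+x. ennreal \<bar>f x - s n x\<bar> \<partial>lborel) \<longlonglongrightarrow> 0" by simp
    from tendsto_nn_integral_imp_le[OF this d]
    obtain n where n: "(\<integral>\<^sup>+x. ennreal \<bar>f x - s n x\<bar> \<partial>lborel) \<le> ennreal d" by blast
    show "\<exists>g. g \<in> borel_measurable borel \<and> L1_continuous g \<and> (\<integral>\<^sup>+x. ennreal \<bar>f x - g x\<bar> \<partial>lborel) \<le> ennreal d"
      using n lim(5)[of n] borel_measurable_integrable[OF lim(1)[of n]] by (intro exI[of _ "s n"]) auto
  qed
qed

section \<open>Convergence of mollifications\<close>

lemma tendsto_at_right_0I:
  fixes f :: "real \<Rightarrow> real"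
  assumes "\<And>d. d > 0 \<Longrightarrow> \<exists>e0>0. \<forall>e. 0 < e \<and> e < e0 \<longrightarrow> \<bar>f e - l\<bar> \<le> d"
  shows "(f \<longlongrightarrow> l) (at_right 0)"
proof (rule tendstoI)
  fix d :: real assume "d > 0"
  then obtain e0 where "e0 > 0" "\<forall>e. 0 < e \<and> e < e0 \<longrightarrow> \<bar>f e - l\<bar> \<le> d / 2"
    using assms[of "d / 2"] by auto
  then show "\<forall>\<^sub>F e in at_right 0. dist (f e) l < d"
    using \<open>d > 0\<close> unfolding eventually_at_right_field dist_real_def
    by (intro exI[of _ e0]) (auto intro: order_le_less_trans)
qed

text \<open>For a function that is not integrable the left side is 0, the default value of the
  Bochner integral.\<close>

lemma abs_integral_le_nn_integral:
  fixes f :: "'a \<Rightarrow> real"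
  shows "ennreal \<bar>integral\<^sup>L M f\<bar> \<le> (\<integral>\<^sup>+x. ennreal \<bar>f x\<bar> \<partial>M)"
  using integral_norm_bound_ennreal[of M f] not_integrable_integral_eq[of M f]
  by (cases "integrable M f") auto

section \<open>Truncation\<close>

definition truncate :: "real \<Rightarrow> real \<Rightarrow> real" where
  "truncate N t = max (- N) (min N t)"

lemma truncate_borel [measurable]: "truncate N \<in> borel_measurable borel"
  unfolding truncate_def by measurable

lemma abs_truncate_le: "N \<ge> 0 \<Longrightarrow> \<bar>truncate N t\<bar> \<le> N" "N \<ge> 0 \<Longrightarrow> \<bar>truncate N t\<bar> \<le> \<bar>t\<bar>" "N \<ge> 0 \<Longrightarrow> \<bar>t - truncate N t\<bar> \<le> \<bar>t\<bar>"
  "N \<ge> 0 \<Longrightarrow> truncate N 0 = 0"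
  and truncate_eq: "\<bar>t\<bar> \<le> N \<Longrightarrow> truncate N t = t"
  unfolding truncate_def by auto

text \<open>Common core of the L1 and L2 versions: \<open>k n\<close> is the truncation error at
  height \<open>n\<close>, which at each point vanishes for large \<open>n\<close>, so dominated
  convergence applies.\<close>

lemma truncation_tendsto:
  fixes h :: "'a \<Rightarrow> real"
  assumes "integrable M h" and "\<And>n. k n \<in> borel_measurable M" and "\<And>n x. \<bar>k n x\<bar> \<le> h x"
    and "\<And>n x. \<bar>f x\<bar> \<le> real n \<Longrightarrow> k n x = 0" and "d > 0"
  obtains N :: nat where "N > 0" "(LINT x|M. k N x) \<le> d"
proof -
  have "(\<lambda>n. LINT x|M. k n x) \<longlonglongrightarrow> (LINT x|M. 0)"
  proof (rule integral_dominated_convergence[where w = h])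
    show "AE x in M. (\<lambda>n. k n x) \<longlonglongrightarrow> 0"
    proof (intro AE_I2 tendsto_eventually)
      fix x
      obtain N where "\<bar>f x\<bar> \<le> real N" using real_arch_simple by blast
      then show "\<forall>\<^sub>F n in sequentially. k n x = 0"
        using assms(4) by (auto simp: eventually_sequentially intro!: exI[of _ N])
    qed
  qed (use assms in auto)
  then have "\<forall>\<^sub>F n in sequentially. (LINT x|M. k n x) < d"
    using assms(5) by (intro order_tendstoD(2)) auto
  then obtain N where N: "\<And>n. n \<ge> N \<Longrightarrow> (LINT x|M. k n x) < d" unfolding eventually_sequentially by auto
  \<comment> \<open>The successor secures a positive height.\<close>
  show ?thesis using N[of "Suc N"] by (intro that[of "Suc N"]) auto
qed

lemma truncation_L1:
  assumes f: "integrable M f" and "d > 0"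
  obtains N :: real where "N > 0" "(LINT x|M. \<bar>f x - truncate N (f x)\<bar>) \<le> d"
proof -
  note [measurable] = borel_measurable_integrable[OF f]
  obtain N :: nat where "N > 0" "(LINT x|M. \<bar>f x - truncate (real N) (f x)\<bar>) \<le> d"
    by (rule truncation_tendsto[of M "\<lambda>x. \<bar>f x\<bar>" "\<lambda>n x. \<bar>f x - truncate (real n) (f x)\<bar>" f d])
      (use assms in \<open>auto simp: abs_truncate_le truncate_eq\<close>)
  then show ?thesis using that[of "real N"] by simp
qed

lemma truncation_L2:
  assumes [measurable]: "f \<in> borel_measurable M" and f: "integrable M (\<lambda>x. (f x)\<^sup>2)" and "d > 0"
  obtains N :: real where "N > 0" "(LINT x|M. (f x - truncate N (f x))\<^sup>2) \<le> d"
proof -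
  have "\<bar>(f x - truncate (real n) (f x))\<^sup>2\<bar> \<le> (f x)\<^sup>2" for n x
    using abs_truncate_le(3)[of "real n" "f x"] by (simp add: abs_le_square_iff)
  then obtain N :: nat where "N > 0" "(LINT x|M. (f x - truncate (real N) (f x))\<^sup>2) \<le> d"
    using truncation_tendsto[of M "\<lambda>x. (f x)\<^sup>2" "\<lambda>n x. (f x - truncate (real n) (f x))\<^sup>2" f d] assms
    by (auto simp: truncate_eq)
  then show ?thesis using that[of "real N"] by simp
qed

lemma integrable_truncated_sq:
  assumes [measurable]: "f \<in> borel_measurable M" and f: "integrable M (\<lambda>x. (f x)\<^sup>2)" and "N \<ge> 0"
  shows "integrable M (\<lambda>x. (f x - truncate N (f x))\<^sup>2)" "integrable M (\<lambda>x. (truncate N (f x))\<^sup>2)"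
  using abs_truncate_le[OF assms(3)]
  by (auto intro!: Bochner_Integration.integrable_bound[OF f] simp: abs_le_square_iff[symmetric])

lemma integrable_truncated:
  assumes f: "integrable M f" and "N \<ge> 0"
  shows "integrable M (\<lambda>x. f x - truncate N (f x))" "integrable M (\<lambda>x. truncate N (f x))"
proof -
  note [measurable] = borel_measurable_integrable[OF f]
  show "integrable M (\<lambda>x. f x - truncate N (f x))" "integrable M (\<lambda>x. truncate N (f x))"
    using abs_truncate_le[OF assms(2)] by (auto intro!: Bochner_Integration.integrable_bound[OF f])
qed

lemma convolution_borel:
  assumes "e > 0" "integrable lborel g"
  shows "convolution (moll e) g \<in> borel_measurable borel"
  using C_k_convolution[OF moll_test_functions[OF assms(1)] assms(2), of 0]
  by (simp add: borel_measurable_continuous_onI)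

lemma integrable_moll_shift: "e > 0 \<Longrightarrow> integrable lborel (\<lambda>y. moll e (x - y))"
  using test_functions_integrable[OF test_functions_affine[OF moll_test_functions, of e "-1" x]] by simp

lemma nn_integral_moll:
  assumes "e > 0"
  shows "(\<integral>\<^sup>+y. ennreal (moll e (x - y)) \<partial>lborel) = 1"
  using integrable_moll_shift[OF assms] moll_integral(1)[OF assms]
  by (subst nn_integral_eq_integral) (auto simp: moll_nonneg)

text \<open>Allows every estimate for the kernel \<open>near\<close> to be used for the mollifier;
  the factor \<open>c / e\<^sup>2\<close> is what the o(s^2) bounds have to beat.\<close>

lemma moll_le_near:
  obtains c where "c > 0" "\<And>e x y. e > 0 \<Longrightarrow> ennreal (moll e (x - y)) \<le> ennreal (c / e\<^sup>2) * near e x y"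
proof -
  obtain c where c: "c > 0" "\<And>e x. e > 0 \<Longrightarrow> moll e x \<le> c / e\<^sup>2" using moll_bounds by metis
  have "ennreal (moll e (x - y)) \<le> ennreal (c / e\<^sup>2) * near e x y" if "e > 0" for e x y
    using c(2)[OF that, of "x - y"] moll_eq_0[OF that, of "x - y"]
    by (cases "dist x y < e") (auto simp: near_def dist_norm intro: ennreal_leI)
  then show ?thesis using that c(1) by blast
qed

lemma convolution_moll_bounded:
  assumes "e > 0" "integrable lborel g" "\<And>x. \<bar>g x\<bar> \<le> B"
  shows "\<bar>convolution (moll e) g x\<bar> \<le> B"
proof -
  have "\<bar>convolution (moll e) g x\<bar> \<le> (LINT y|lborel. \<bar>moll e (x - y) * g y\<bar>)"
    unfolding convolution_def by (rule integral_abs_bound)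
  also have "\<dots> \<le> (LINT y|lborel. moll e (x - y) * B)"
  proof (rule Bochner_Integration.integral_mono)
    show "integrable lborel (\<lambda>y. \<bar>moll e (x - y) * g y\<bar>)"
      by (intro integrable_abs convolution_integrable moll_test_functions assms)
    show "integrable lborel (\<lambda>y. moll e (x - y) * B)"
      using integrable_moll_shift[OF assms(1)] by simp
    show "\<bar>moll e (x - y) * g y\<bar> \<le> moll e (x - y) * B" for y
      using assms(3) by (simp add: abs_mult moll_nonneg mult_left_mono)
  qed
  also have "\<dots> = B" by (simp add: moll_integral(1)[OF assms(1)])
  finally show ?thesis .
qed

text \<open>Unit mass writes the difference as an average of \<open>g y - g x\<close>, so its L1
  norm is at most \<open>c / e\<^sup>2\<close> times \<open>L1_modulus e g\<close>, and the powers
  of \<open>e\<close> cancel.\<close>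

lemma convolution_moll_L1:
  assumes g: "integrable lborel g" and d: "d > 0"
  shows "\<exists>e0>0. \<forall>e. 0 < e \<and> e < e0 \<longrightarrow> (\<integral>\<^sup>+x. ennreal \<bar>convolution (moll e) g x - g x\<bar> \<partial>lborel) \<le> ennreal d"
proof -
  note [measurable] = borel_measurable_integrable[OF g]
  obtain c where c: "c > 0" "\<And>e x y. e > 0 \<Longrightarrow> ennreal (moll e (x - y)) \<le> ennreal (c / e\<^sup>2) * near e x y"
    using moll_le_near by blast
  have "d / c > 0" using d c by simp
  then obtain e0 where e0: "e0 > 0" "\<And>e. 0 < e \<Longrightarrow> e < e0 \<Longrightarrow> L1_modulus e g \<le> ennreal (d / c * e\<^sup>2)"
    using L1_continuous_integrable[OF g] unfolding L1_continuous_def by metis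
  have "(\<integral>\<^sup>+x. ennreal \<bar>convolution (moll e) g x - g x\<bar> \<partial>lborel) \<le> ennreal d" if e: "0 < e" "e < e0" for e
  proof -
    note [measurable] = moll_borel[OF e(1)]
    have "ennreal \<bar>convolution (moll e) g x - g x\<bar> \<le> ennreal (c / e\<^sup>2) * (\<integral>\<^sup>+y. ennreal \<bar>g x - g y\<bar> * near e x y \<partial>lborel)" for x
    proof -
      have "convolution (moll e) g x - g x = (LINT y|lborel. moll e (x - y) * g y) - (LINT y|lborel. moll e (x - y) * g x)"
        by (simp add: convolution_def moll_integral(1)[OF e(1)])
      also have "\<dots> = (LINT y|lborel. moll e (x - y) * g y - moll e (x - y) * g x)"
        using convolution_integrable[OF moll_test_functions[OF e(1)] g, of x] integrable_moll_shift[OF e(1)]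
        by (intro Bochner_Integration.integral_diff[symmetric]) auto
      finally have "ennreal \<bar>convolution (moll e) g x - g x\<bar> \<le> (\<integral>\<^sup>+y. ennreal \<bar>moll e (x - y) * g y - moll e (x - y) * g x\<bar> \<partial>lborel)"
        using abs_integral_le_nn_integral by metis
      also have "\<dots> \<le> (\<integral>\<^sup>+y. ennreal (c / e\<^sup>2) * (ennreal \<bar>g x - g y\<bar> * near e x y) \<partial>lborel)"
      proof (intro nn_integral_mono)
        fix y
        have "\<bar>moll e (x - y) * g y - moll e (x - y) * g x\<bar> = moll e (x - y) * \<bar>g x - g y\<bar>"
          by (simp add: right_diff_distrib[symmetric] abs_mult moll_nonneg abs_minus_commute)
        then have "ennreal \<bar>moll e (x - y) * g y - moll e (x - y) * g x\<bar> = ennreal (moll e (x - y)) * ennreal \<bar>g x - g y\<bar>"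
          by (simp add: ennreal_mult moll_nonneg)
        also have "\<dots> \<le> ennreal (c / e\<^sup>2) * near e x y * ennreal \<bar>g x - g y\<bar>"
          by (intro mult_right_mono c e) simp
        finally show "ennreal \<bar>moll e (x - y) * g y - moll e (x - y) * g x\<bar> \<le> ennreal (c / e\<^sup>2) * (ennreal \<bar>g x - g y\<bar> * near e x y)"
          by (simp add: mult_ac)
      qed
      also have "\<dots> = ennreal (c / e\<^sup>2) * (\<integral>\<^sup>+y. ennreal \<bar>g x - g y\<bar> * near e x y \<partial>lborel)"
        by (simp add: nn_integral_cmult)
      finally show ?thesis .
    qed
    then have "(\<integral>\<^sup>+x. ennreal \<bar>convolution (moll e) g x - g x\<bar> \<partial>lborel) \<le> (\<integral>\<^sup>+x. ennreal (c / e\<^sup>2) * (\<integral>\<^sup>+y. ennreal \<bar>g x - g y\<bar> * near e x y \<partial>lborel) \<partial>lborel)"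
      by (intro nn_integral_mono)
    also have "\<dots> = ennreal (c / e\<^sup>2) * L1_modulus e g"
      unfolding L1_modulus_def by (simp add: nn_integral_cmult)
    also have "\<dots> \<le> ennreal (c / e\<^sup>2) * ennreal (d / c * e\<^sup>2)"
      by (intro mult_left_mono e0 e) simp
    also have "\<dots> = ennreal d"
      using c e d by (simp add: ennreal_mult[symmetric])
    finally show ?thesis .
  qed
  then show ?thesis using e0(1) by blast
qed

lemma integrable_mult_bounded:
  fixes f g :: "'a \<Rightarrow> real"
  assumes "integrable M f" "g \<in> borel_measurable M" "\<And>x. \<bar>g x\<bar> \<le> B"
  shows "integrable M (\<lambda>x. f x * g x)"
proof (rule Bochner_Integration.integrable_bound[of _ "\<lambda>x. f x * B"])
  show "AE x in M. norm (f x * g x) \<le> norm (f x * B)"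
    using assms(3) by (intro AE_I2) (simp add: abs_mult mult_left_mono order_trans[OF _ abs_ge_self])
qed (use assms in auto)

text \<open>Meant for \<open>\<Phi>\<close> that is barely integrable, such as a product of
  \<open>H\<close> with a gradient. The part of \<open>\<Phi>\<close> truncated at height
  \<open>N\<close> is paired with the L1 convergence of the mollification; the rest is small in L1
  and meets a factor bounded by \<open>2 * B\<close>.\<close>

lemma convolution_moll_tendsto_bounded:
  assumes \<Phi>: "integrable lborel \<Phi>" and g: "integrable lborel g" and B: "\<And>x. \<bar>g x\<bar> \<le> B"
  shows "((\<lambda>e. LINT x|lborel. \<Phi> x * convolution (moll e) g x) \<longlongrightarrow> (LINT x|lborel. \<Phi> x * g x)) (at_right 0)"
proof (rule tendsto_at_right_0I)
  fix d :: real assume d: "d > 0"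
  have B0: "B \<ge> 0" using B[of 0] by linarith
  have [measurable]: "g \<in> borel_measurable borel" "\<Phi> \<in> borel_measurable borel" using g \<Phi> by auto
  \<comment> \<open>The rest of \<open>\<Phi>\<close> is weighted by \<open>2 * B\<close> and must
    cost at most \<open>d / 2\<close>; \<open>B + 1\<close> covers \<open>B = 0\<close>.\<close>
  have "d / (4 * (B + 1)) > 0" using d B0 by simp
  then obtain N where N: "N > 0" "(LINT x|lborel. \<bar>\<Phi> x - truncate N (\<Phi> x)\<bar>) \<le> d / (4 * (B + 1))"
    using truncation_L1[OF \<Phi>] by blast
  have "d / (2 * N) > 0" using d N by simp
  from convolution_moll_L1[OF g this] obtain e0 where e0: "e0 > 0"
    "\<And>e. 0 < e \<Longrightarrow> e < e0 \<Longrightarrow> (\<integral>\<^sup>+x. ennreal \<bar>convolution (moll e) g x - g x\<bar> \<partial>lborel) \<le> ennreal (d / (2 * N))" by blast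
  have "\<bar>(LINT x|lborel. \<Phi> x * convolution (moll e) g x) - (LINT x|lborel. \<Phi> x * g x)\<bar> \<le> d" if e: "0 < e" "e < e0" for e
  proof -
    let ?c = "convolution (moll e) g"
    note [measurable] = convolution_borel[OF e(1) g]
    have cB: "\<bar>?c x\<bar> \<le> B" for x by (rule convolution_moll_bounded[OF e(1) g B])
    have "(\<integral>\<^sup>+x. ennreal \<bar>?c x - g x\<bar> \<partial>lborel) < \<infinity>"
      using e0(2)[OF e] ennreal_less_top order_le_less_trans by fastforce
    then have I: "integrable lborel (\<lambda>x. \<bar>?c x - g x\<bar>)"
      by (intro integrableI_bounded) auto
    have I2: "integrable lborel (\<lambda>x. \<bar>\<Phi> x - truncate N (\<Phi> x)\<bar>)"
      using integrable_truncated(1)[OF \<Phi>, of N] N by simp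
    have "(LINT x|lborel. \<bar>?c x - g x\<bar>) \<le> d / (2 * N)"
      using e0(2)[OF e] N d by (subst (asm) nn_integral_eq_integral[OF I]) auto
    then have 1: "N * (LINT x|lborel. \<bar>?c x - g x\<bar>) \<le> d / 2" using N by (simp add: field_simps)
    have "2 * B * (LINT x|lborel. \<bar>\<Phi> x - truncate N (\<Phi> x)\<bar>) \<le> 2 * B * (d / (4 * (B + 1)))"
      using N B0 by (intro mult_left_mono) auto
    also have "\<dots> \<le> d / 2" using B0 d by (simp add: field_simps)
    finally have 2: "2 * B * (LINT x|lborel. \<bar>\<Phi> x - truncate N (\<Phi> x)\<bar>) \<le> d / 2" .
    have "(LINT x|lborel. \<Phi> x * ?c x) - (LINT x|lborel. \<Phi> x * g x) = (LINT x|lborel. \<Phi> x * ?c x - \<Phi> x * g x)"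
      using integrable_mult_bounded[OF \<Phi> _ cB] integrable_mult_bounded[OF \<Phi> _ B]
      by (intro Bochner_Integration.integral_diff[symmetric]) auto
    then have "\<bar>(LINT x|lborel. \<Phi> x * ?c x) - (LINT x|lborel. \<Phi> x * g x)\<bar> \<le> (LINT x|lborel. \<bar>\<Phi> x * ?c x - \<Phi> x * g x\<bar>)"
      using integral_abs_bound[of lborel "\<lambda>x. \<Phi> x * ?c x - \<Phi> x * g x"] by simp
    also have "\<dots> \<le> (LINT x|lborel. N * \<bar>?c x - g x\<bar> + 2 * B * \<bar>\<Phi> x - truncate N (\<Phi> x)\<bar>)"
    proof (rule Bochner_Integration.integral_mono)
      show "integrable lborel (\<lambda>x. \<bar>\<Phi> x * ?c x - \<Phi> x * g x\<bar>)"
        using integrable_mult_bounded[OF \<Phi> _ cB] integrable_mult_bounded[OF \<Phi> _ B] by auto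
      show "integrable lborel (\<lambda>x. N * \<bar>?c x - g x\<bar> + 2 * B * \<bar>\<Phi> x - truncate N (\<Phi> x)\<bar>)"
        using I I2 by auto
      fix x
      have "\<bar>\<Phi> x\<bar> \<le> N + \<bar>\<Phi> x - truncate N (\<Phi> x)\<bar>" using abs_truncate_le(1)[of N "\<Phi> x"] N by linarith
      then have "\<bar>\<Phi> x\<bar> * \<bar>?c x - g x\<bar> \<le> (N + \<bar>\<Phi> x - truncate N (\<Phi> x)\<bar>) * \<bar>?c x - g x\<bar>"
        by (intro mult_right_mono) auto
      moreover have "\<bar>\<Phi> x - truncate N (\<Phi> x)\<bar> * \<bar>?c x - g x\<bar> \<le> \<bar>\<Phi> x - truncate N (\<Phi> x)\<bar> * (2 * B)"
        using cB[of x] B[of x] by (intro mult_left_mono) auto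
      moreover have "(N + \<bar>\<Phi> x - truncate N (\<Phi> x)\<bar>) * \<bar>?c x - g x\<bar> =
          N * \<bar>?c x - g x\<bar> + \<bar>\<Phi> x - truncate N (\<Phi> x)\<bar> * \<bar>?c x - g x\<bar>" by (rule distrib_right)
      moreover have "\<bar>\<Phi> x - truncate N (\<Phi> x)\<bar> * (2 * B) = 2 * B * \<bar>\<Phi> x - truncate N (\<Phi> x)\<bar>" by (rule mult.commute)
      moreover have "\<bar>\<Phi> x * ?c x - \<Phi> x * g x\<bar> = \<bar>\<Phi> x\<bar> * \<bar>?c x - g x\<bar>"
        by (simp add: right_diff_distrib[symmetric] abs_mult)
      ultimately show "\<bar>\<Phi> x * ?c x - \<Phi> x * g x\<bar> \<le> N * \<bar>?c x - g x\<bar> + 2 * B * \<bar>\<Phi> x - truncate N (\<Phi> x)\<bar>"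
        by linarith
    qed
    also have "\<dots> = N * (LINT x|lborel. \<bar>?c x - g x\<bar>) + 2 * B * (LINT x|lborel. \<bar>\<Phi> x - truncate N (\<Phi> x)\<bar>)"
      using I I2 by (subst Bochner_Integration.integral_add) auto
    finally show ?thesis using 1 2 by linarith
  qed
  then show "\<exists>e0>0. \<forall>e. 0 < e \<and> e < e0 \<longrightarrow>
     \<bar>(LINT x|lborel. \<Phi> x * convolution (moll e) g x) - (LINT x|lborel. \<Phi> x * g x)\<bar> \<le> d" using e0(1) by blast
qed

text \<open>A Schur test: the kernel has mass 1 in either variable, so after |a b| \<le> a^2 + b^2
  each square is integrated against total mass 1. No power of \<open>e\<close> appears.\<close>

lemma double_integral_moll_bound:
  assumes e: "e > 0" and [measurable]: "f \<in> borel_measurable borel" "g \<in> borel_measurable borel"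
  shows "(\<integral>\<^sup>+x. \<integral>\<^sup>+y. ennreal (\<bar>f x\<bar> * \<bar>g y\<bar>) * ennreal (moll e (x - y)) \<partial>lborel \<partial>lborel) \<le>
    (\<integral>\<^sup>+x. ennreal ((f x)\<^sup>2) \<partial>lborel) + (\<integral>\<^sup>+x. ennreal ((g x)\<^sup>2) \<partial>lborel)"
proof -
  note [measurable] = moll_borel[OF e]
  have "(\<integral>\<^sup>+x. \<integral>\<^sup>+y. ennreal (\<bar>f x\<bar> * \<bar>g y\<bar>) * ennreal (moll e (x - y)) \<partial>lborel \<partial>lborel)
    \<le> (\<integral>\<^sup>+x. \<integral>\<^sup>+y. ennreal ((f x)\<^sup>2) * ennreal (moll e (x - y)) + ennreal ((g y)\<^sup>2) * ennreal (moll e (x - y)) \<partial>lborel \<partial>lborel)"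
  proof (intro nn_integral_mono)
    fix x y
    have "\<bar>f x\<bar> * \<bar>g y\<bar> \<le> (f x)\<^sup>2 + (g y)\<^sup>2"
      using sum_squares_bound[of "\<bar>f x\<bar>" "\<bar>g y\<bar>"] abs_ge_zero[of "f x * g y"] unfolding power2_abs abs_mult by linarith
    then have "ennreal (\<bar>f x\<bar> * \<bar>g y\<bar>) \<le> ennreal ((f x)\<^sup>2) + ennreal ((g y)\<^sup>2)"
      by (simp add: ennreal_plus[symmetric] ennreal_leI del: ennreal_plus)
    then show "ennreal (\<bar>f x\<bar> * \<bar>g y\<bar>) * ennreal (moll e (x - y)) \<le> ennreal ((f x)\<^sup>2) * ennreal (moll e (x - y)) + ennreal ((g y)\<^sup>2) * ennreal (moll e (x - y))"
      by (simp add: distrib_right[symmetric] mult_right_mono)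
  qed
  also have "\<dots> = (\<integral>\<^sup>+x. \<integral>\<^sup>+y. ennreal ((f x)\<^sup>2) * ennreal (moll e (x - y)) \<partial>lborel \<partial>lborel) +
      (\<integral>\<^sup>+x. \<integral>\<^sup>+y. ennreal ((g y)\<^sup>2) * ennreal (moll e (x - y)) \<partial>lborel \<partial>lborel)"
    by (simp add: nn_integral_add)
  also have "(\<integral>\<^sup>+x. \<integral>\<^sup>+y. ennreal ((g y)\<^sup>2) * ennreal (moll e (x - y)) \<partial>lborel \<partial>lborel) =
      (\<integral>\<^sup>+y. \<integral>\<^sup>+x. ennreal ((g y)\<^sup>2) * ennreal (moll e (x - y)) \<partial>lborel \<partial>lborel)"
    by (intro lborel_pair.Fubini'[symmetric]) measurable
  also have "\<dots> = (\<integral>\<^sup>+y. \<integral>\<^sup>+x. ennreal ((g y)\<^sup>2) * ennreal (moll e (y - x)) \<partial>lborel \<partial>lborel)"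
    by (simp add: moll_commute)
  finally show ?thesis by (simp add: nn_integral_cmult nn_integral_moll[OF e])
qed

lemma integral_convolution_le_double:
  assumes e: "e > 0" and [measurable]: "f \<in> borel_measurable borel" "g \<in> borel_measurable borel"
  shows "ennreal \<bar>LINT x|lborel. f x * convolution (moll e) g x\<bar> \<le>
    (\<integral>\<^sup>+x. \<integral>\<^sup>+y. ennreal (\<bar>f x\<bar> * \<bar>g y\<bar>) * ennreal (moll e (x - y)) \<partial>lborel \<partial>lborel)"
proof -
  note [measurable] = moll_borel[OF e]
  have "ennreal \<bar>LINT x|lborel. f x * convolution (moll e) g x\<bar> \<le> (\<integral>\<^sup>+x. ennreal \<bar>f x * convolution (moll e) g x\<bar> \<partial>lborel)"
    by (rule abs_integral_le_nn_integral)
  also have "\<dots> \<le> (\<integral>\<^sup>+x. ennreal \<bar>f x\<bar> * (\<integral>\<^sup>+y. ennreal \<bar>moll e (x - y) * g y\<bar> \<partial>lborel) \<partial>lborel)"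
    unfolding convolution_def abs_mult[of "f _"] ennreal_mult[OF abs_ge_zero abs_ge_zero]
    by (intro nn_integral_mono mult_left_mono abs_integral_le_nn_integral) auto
  also have "\<dots> = (\<integral>\<^sup>+x. \<integral>\<^sup>+y. ennreal \<bar>f x\<bar> * ennreal \<bar>moll e (x - y) * g y\<bar> \<partial>lborel \<partial>lborel)"
    by (simp add: nn_integral_cmult)
  finally show ?thesis by (simp add: abs_mult ennreal_mult moll_nonneg mult_ac)
qed

text \<open>The preceding estimate applied to \<open>sqrt t * f\<close> and
  \<open>g / sqrt t\<close>. The free weight lets a small \<open>g\<close> compensate a fixed
  \<open>f\<close>, in the role of a product of L2 norms.\<close>

lemma convolution_pairing_bound:
  assumes e: "e > 0" and [measurable]: "f \<in> borel_measurable borel" "g \<in> borel_measurable borel"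
    and "integrable lborel (\<lambda>x. (f x)\<^sup>2)" "integrable lborel (\<lambda>x. (g x)\<^sup>2)" and t: "t > 0"
  shows "\<bar>LINT x|lborel. f x * convolution (moll e) g x\<bar> \<le> t * (LINT x|lborel. (f x)\<^sup>2) + (LINT x|lborel. (g x)\<^sup>2) / t"
proof -
  let ?s = "sqrt t"
  have s: "?s > 0" "?s * ?s = t" using t by auto
  have "(LINT x|lborel. f x * convolution (moll e) g x) = (LINT x|lborel. (?s * f x) * convolution (moll e) (\<lambda>x. g x / ?s) x)"
    using s unfolding convolution_def by simp
  then have "ennreal \<bar>LINT x|lborel. f x * convolution (moll e) g x\<bar> \<le>
     (\<integral>\<^sup>+x. ennreal ((?s * f x)\<^sup>2) \<partial>lborel) + (\<integral>\<^sup>+x. ennreal ((g x / ?s)\<^sup>2) \<partial>lborel)"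
    using order_trans[OF integral_convolution_le_double double_integral_moll_bound, OF e _ _ e, of "\<lambda>x. ?s * f x" "\<lambda>x. g x / ?s"] by simp
  also have "\<dots> = ennreal (LINT x|lborel. t * (f x)\<^sup>2) + ennreal (LINT x|lborel. (g x)\<^sup>2 / t)"
    using assms t by (subst (1 2) nn_integral_eq_integral) (auto simp: power_mult_distrib power_divide)
  also have "\<dots> = ennreal (t * (LINT x|lborel. (f x)\<^sup>2) + (LINT x|lborel. (g x)\<^sup>2) / t)"
    using t by (simp add: ennreal_plus[symmetric] del: ennreal_plus)
  finally show ?thesis using t by (subst (asm) ennreal_le_iff) auto
qed

lemma convolution_add:
  assumes "e > 0" "integrable lborel g" "integrable lborel h"
  shows "convolution (moll e) (\<lambda>x. g x + h x) x = convolution (moll e) g x + convolution (moll e) h x"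
  using convolution_integrable[OF moll_test_functions[OF assms(1)] assms(2), of x]
    convolution_integrable[OF moll_test_functions[OF assms(1)] assms(3), of x]
  by (simp add: convolution_def distrib_left)

lemma convolution_moll_bounded_L1:
  assumes "e > 0" "integrable lborel g"
  obtains B where "\<And>x. \<bar>convolution (moll e) g x\<bar> \<le> B"
proof -
  obtain C where C: "C > 0" "\<And>x. \<bar>moll e x\<bar> \<le> C" using test_functions_bounded[OF moll_test_functions[OF assms(1)]] by blast
  have "\<bar>convolution (moll e) g x\<bar> \<le> (LINT y|lborel. C * \<bar>g y\<bar>)" for x
  proof -
    have "\<bar>convolution (moll e) g x\<bar> \<le> (LINT y|lborel. \<bar>moll e (x - y) * g y\<bar>)"
      unfolding convolution_def by (rule integral_abs_bound)
    also have "\<dots> \<le> (LINT y|lborel. C * \<bar>g y\<bar>)"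
    proof (rule Bochner_Integration.integral_mono)
      show "integrable lborel (\<lambda>y. \<bar>moll e (x - y) * g y\<bar>)"
        by (intro integrable_abs convolution_integrable moll_test_functions assms)
      show "integrable lborel (\<lambda>y. C * \<bar>g y\<bar>)" using assms(2) by simp
      show "\<bar>moll e (x - y) * g y\<bar> \<le> C * \<bar>g y\<bar>" for y
        using C(2) by (simp add: abs_mult mult_right_mono)
    qed
    finally show ?thesis .
  qed
  then show ?thesis using that by blast
qed

lemma integrable_mult_convolution:
  assumes "e > 0" "integrable lborel f" "integrable lborel g"
  shows "integrable lborel (\<lambda>x. f x * convolution (moll e) g x)"
proof -
  obtain B where "\<And>x. \<bar>convolution (moll e) g x\<bar> \<le> B" using convolution_moll_bounded_L1[OF assms(1,3)] by blast
  then show ?thesis using convolution_borel[OF assms(1,3)] by (intro integrable_mult_bounded[OF assms(2)]) auto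
qed

lemma integrable_mult_L2:
  fixes f g :: "'a \<Rightarrow> real"
  assumes "f \<in> borel_measurable M" "g \<in> borel_measurable M"
    and "integrable M (\<lambda>x. (f x)\<^sup>2)" "integrable M (\<lambda>x. (g x)\<^sup>2)"
  shows "integrable M (\<lambda>x. f x * g x)"
proof (rule Bochner_Integration.integrable_bound[of _ "\<lambda>x. (f x)\<^sup>2 + (g x)\<^sup>2"])
  show "AE x in M. norm (f x * g x) \<le> norm ((f x)\<^sup>2 + (g x)\<^sup>2)"
  proof (intro AE_I2)
    fix x
    show "norm (f x * g x) \<le> norm ((f x)\<^sup>2 + (g x)\<^sup>2)"
      using sum_squares_bound[of "\<bar>f x\<bar>" "\<bar>g x\<bar>"] abs_ge_zero[of "f x * g x"]
      unfolding power2_abs abs_mult real_norm_def by linarith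
  qed
qed (use assms in auto)

text \<open>Truncate \<open>g\<close>: the bounded part converges by the previous case, and the
  remainder is small in L2, uniformly in the scale by
  \<open>convolution_pairing_bound\<close>.\<close>

lemma convolution_moll_tendsto_L2:
  assumes f: "integrable lborel f" and g: "integrable lborel g"
    and f2: "integrable lborel (\<lambda>x. (f x)\<^sup>2)" and g2: "integrable lborel (\<lambda>x. (g x)\<^sup>2)"
  shows "((\<lambda>e. LINT x|lborel. f x * convolution (moll e) g x) \<longlongrightarrow> (LINT x|lborel. f x * g x)) (at_right 0)"
proof (rule tendsto_at_right_0I)
  fix d :: real assume d: "d > 0"
  have [measurable]: "g \<in> borel_measurable borel" "f \<in> borel_measurable borel" using g f by auto
  define F where "F = (LINT x|lborel. (f x)\<^sup>2)"
  have F: "F \<ge> 0" by (simp add: F_def)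
  \<comment> \<open>First \<open>t\<close> makes the contribution of \<open>f\<close> at most
    \<open>d / 6\<close>, then the truncation height is chosen in terms of \<open>t\<close>. Four
    errors of size \<open>d / 6\<close> and one of size \<open>d / 3\<close> add up to
    \<open>d\<close>.\<close>
  define t where "t = d / (6 * (F + 1))"
  have t: "t > 0" using d F by (simp add: t_def)
  have tF: "t * F \<le> d / 6" using d F by (simp add: t_def field_simps)
  have "d * t / 6 > 0" and gm: "g \<in> borel_measurable lborel" using d t by simp_all
  then obtain N where N: "N > 0" "(LINT x|lborel. (g x - truncate N (g x))\<^sup>2) \<le> d * t / 6"
    by (metis truncation_L2[OF gm g2])
  define h where "h x = g x - truncate N (g x)" for x
  define k where "k x = truncate N (g x)" for x
  have [measurable]: "h \<in> borel_measurable borel" "k \<in> borel_measurable borel" unfolding h_def k_def by measurable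
  have h: "integrable lborel h" "integrable lborel k" "integrable lborel (\<lambda>x. (h x)\<^sup>2)"
    unfolding h_def[abs_def] k_def[abs_def] using integrable_truncated[OF g, of N] integrable_truncated_sq[OF _ g2, of N] N(1) by auto
  have hb: "(LINT x|lborel. (h x)\<^sup>2) / t \<le> d / 6" using N(2) t by (simp add: h_def field_simps)
  have ghk: "g = (\<lambda>x. k x + h x)" by (simp add: h_def k_def)
  have kB: "\<bar>k x\<bar> \<le> N" for x using abs_truncate_le(1) N(1) by (simp add: k_def)
  have "\<forall>\<^sub>F e in at_right 0. \<bar>(LINT x|lborel. f x * convolution (moll e) k x) - (LINT x|lborel. f x * k x)\<bar> < d / 3"
    using tendstoD[OF convolution_moll_tendsto_bounded[OF f h(2) kB], of "d / 3"] d by (simp add: dist_real_def)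
  then obtain e0 where e0: "e0 > 0"
    "\<And>e. 0 < e \<Longrightarrow> e < e0 \<Longrightarrow> \<bar>(LINT x|lborel. f x * convolution (moll e) k x) - (LINT x|lborel. f x * k x)\<bar> < d / 3"
    unfolding eventually_at_right_field by auto
  have "\<bar>(LINT x|lborel. f x * convolution (moll e) g x) - (LINT x|lborel. f x * g x)\<bar> \<le> d" if e: "0 < e" "e < e0" for e
  proof -
    have 1: "(LINT x|lborel. f x * convolution (moll e) g x) = (LINT x|lborel. f x * convolution (moll e) k x) + (LINT x|lborel. f x * convolution (moll e) h x)"
      unfolding ghk convolution_add[OF e(1) h(2,1)] distrib_left
      by (intro Bochner_Integration.integral_add integrable_mult_convolution e f h)
    have fh: "integrable lborel (\<lambda>x. f x * h x)" by (intro integrable_mult_L2 f2 h) auto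
    have 2: "(LINT x|lborel. f x * g x) = (LINT x|lborel. f x * k x) + (LINT x|lborel. f x * h x)"
      unfolding ghk distrib_left
      by (intro Bochner_Integration.integral_add fh integrable_mult_bounded[OF f _ kB]) auto
    have 3: "\<bar>LINT x|lborel. f x * convolution (moll e) h x\<bar> \<le> t * F + (LINT x|lborel. (h x)\<^sup>2) / t"
      unfolding F_def by (intro convolution_pairing_bound e f2 h t) auto
    have "\<bar>LINT x|lborel. f x * h x\<bar> \<le> (LINT x|lborel. \<bar>f x * h x\<bar>)" by (rule integral_abs_bound)
    also have "\<dots> \<le> (LINT x|lborel. t * (f x)\<^sup>2 + (h x)\<^sup>2 / t)"
    proof (rule Bochner_Integration.integral_mono)
      fix x
      have "0 \<le> (t * \<bar>f x\<bar> - \<bar>h x\<bar>)\<^sup>2" by simp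
      then have "2 * (t * (\<bar>f x\<bar> * \<bar>h x\<bar>)) \<le> (t * \<bar>f x\<bar>)\<^sup>2 + (h x)\<^sup>2" by (simp add: power2_diff mult_ac)
      moreover have "0 \<le> t * (\<bar>f x\<bar> * \<bar>h x\<bar>)" using t by simp
      ultimately have "t * (\<bar>f x\<bar> * \<bar>h x\<bar>) \<le> t * (t * (f x)\<^sup>2) + (h x)\<^sup>2"
        unfolding power_mult_distrib power2_abs power2_eq_square[of t] mult.assoc by linarith
      then have "t * (\<bar>f x\<bar> * \<bar>h x\<bar>) / t \<le> (t * (t * (f x)\<^sup>2) + (h x)\<^sup>2) / t" using t by (intro divide_right_mono) auto
      then show "\<bar>f x * h x\<bar> \<le> t * (f x)\<^sup>2 + (h x)\<^sup>2 / t" using t by (simp add: abs_mult add_divide_distrib)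
    qed (use fh f2 h in auto)
    also have "\<dots> = t * F + (LINT x|lborel. (h x)\<^sup>2) / t" using f2 h by (simp add: F_def)
    finally have 4: "\<bar>LINT x|lborel. f x * h x\<bar> \<le> t * F + (LINT x|lborel. (h x)\<^sup>2) / t" .
    show ?thesis using 1 2 3 4 e0(2)[OF e] tF hb by linarith
  qed
  then show "\<exists>e0>0. \<forall>e. 0 < e \<and> e < e0 \<longrightarrow>
     \<bar>(LINT x|lborel. f x * convolution (moll e) g x) - (LINT x|lborel. f x * g x)\<bar> \<le> d" using e0(1) by blast
qed

text \<open>Fubini and evenness of the mollifier; the integrand on the product space is integrable
  because the mollifier is bounded.\<close>

lemma convolution_adjoint:
  assumes e: "e > 0" and \<Phi>: "integrable lborel \<Phi>" and g: "integrable lborel g"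
  shows "(LINT x|lborel. \<Phi> x * convolution (moll e) g x) = (LINT x|lborel. g x * convolution (moll e) \<Phi> x)"
proof -
  note [measurable] = moll_borel[OF e]
  have [measurable]: "g \<in> borel_measurable borel" "\<Phi> \<in> borel_measurable borel" using g \<Phi> by auto
  obtain C where C: "C > 0" "\<And>x. \<bar>moll e x\<bar> \<le> C" using test_functions_bounded[OF moll_test_functions[OF e]] by blast
  have "(\<integral>\<^sup>+x. ennreal (norm (g x)) \<partial>lborel) < \<infinity>" "(\<integral>\<^sup>+x. ennreal (norm (\<Phi> x)) \<partial>lborel) < \<infinity>"
    using g \<Phi> unfolding integrable_iff_bounded by auto
  then have fin: "(\<integral>\<^sup>+x. ennreal C * ennreal \<bar>\<Phi> x\<bar> * (\<integral>\<^sup>+y. ennreal \<bar>g y\<bar> \<partial>lborel) \<partial>lborel) < \<infinity>"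
    by (simp add: nn_integral_cmult nn_integral_multc ennreal_mult_less_top)
  have I: "integrable (lborel \<Otimes>\<^sub>M lborel) (\<lambda>(x, y). \<Phi> x * (moll e (x - y) * g y))"
  proof (rule integrableI_bounded)
    have "(\<integral>\<^sup>+p. ennreal (norm (case p of (x, y) \<Rightarrow> \<Phi> x * (moll e (x - y) * g y))) \<partial>(lborel \<Otimes>\<^sub>M lborel))
      = (\<integral>\<^sup>+x. \<integral>\<^sup>+y. ennreal (norm (\<Phi> x * (moll e (x - y) * g y))) \<partial>lborel \<partial>lborel)"
      by (subst lborel.nn_integral_fst[symmetric]) auto
    also have "\<dots> \<le> (\<integral>\<^sup>+x. \<integral>\<^sup>+y. ennreal C * ennreal \<bar>\<Phi> x\<bar> * ennreal \<bar>g y\<bar> \<partial>lborel \<partial>lborel)"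
    proof (intro nn_integral_mono)
      fix x y
      have "\<bar>\<Phi> x\<bar> * (\<bar>moll e (x - y)\<bar> * \<bar>g y\<bar>) \<le> \<bar>\<Phi> x\<bar> * (C * \<bar>g y\<bar>)"
        by (intro mult_left_mono mult_right_mono C) auto
      then have "ennreal (norm (\<Phi> x * (moll e (x - y) * g y))) \<le> ennreal (\<bar>\<Phi> x\<bar> * (C * \<bar>g y\<bar>))"
        by (intro ennreal_leI) (simp add: abs_mult)
      then show "ennreal (norm (\<Phi> x * (moll e (x - y) * g y))) \<le> ennreal C * ennreal \<bar>\<Phi> x\<bar> * ennreal \<bar>g y\<bar>"
        using C(1) by (simp add: ennreal_mult mult_ac)
    qed
    also have "\<dots> < \<infinity>" using fin by (simp add: nn_integral_cmult)
    finally show "(\<integral>\<^sup>+p. ennreal (norm (case p of (x, y) \<Rightarrow> \<Phi> x * (moll e (x - y) * g y))) \<partial>(lborel \<Otimes>\<^sub>M lborel)) < \<infinity>" .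
  qed measurable
  have "(LINT x|lborel. \<Phi> x * convolution (moll e) g x) = (LINT x|lborel. LINT y|lborel. \<Phi> x * (moll e (x - y) * g y))"
    by (simp add: convolution_def)
  also have "\<dots> = (LINT y|lborel. LINT x|lborel. \<Phi> x * (moll e (x - y) * g y))"
    using lborel_pair.Fubini_integral[OF I] by simp
  also have "\<dots> = (LINT y|lborel. g y * convolution (moll e) \<Phi> y)"
  proof (intro Bochner_Integration.integral_cong refl)
    fix y
    have "(LINT x|lborel. \<Phi> x * (moll e (x - y) * g y)) = (LINT x|lborel. g y * (moll e (y - x) * \<Phi> x))"
      by (intro Bochner_Integration.integral_cong refl) (simp add: moll_commute[of e y] mult_ac)
    then show "(LINT x|lborel. \<Phi> x * (moll e (x - y) * g y)) = g y * convolution (moll e) \<Phi> y"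
      by (simp add: convolution_def)
  qed
  finally show ?thesis .
qed

section \<open>Dyadic variance bounds\<close>

text \<open>Half open, so that a square is exactly the disjoint union of its four dyadic children.
  The first argument is the lower left corner.\<close>

definition sq :: "real^2 \<Rightarrow> real \<Rightarrow> (real^2) set" where
  "sq a s = {x. a $ 1 \<le> x $ 1 \<and> x $ 1 < a $ 1 + s \<and> a $ 2 \<le> x $ 2 \<and> x $ 2 < a $ 2 + s}"

lemma sq_borel [measurable]: "sq a s \<in> sets borel"
proof -
  have [measurable]: "(\<lambda>x::real^2. x $ i) \<in> borel_measurable borel" for i
    by (intro borel_measurable_continuous_onI continuous_intros)
  show ?thesis unfolding sq_def by measurable
qed

lemma emeasure_sq:
  assumes "s > 0"
  shows "emeasure lborel (sq a s) = ennreal (s\<^sup>2)"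
proof -
  let ?b = "a + (\<chi> i. s)"
  have card: "card (Basis :: (real^2) set) = 2" by simp
  have le: "a \<bullet> j \<le> ?b \<bullet> j" and diff: "(?b - a) \<bullet> j = s" if "j \<in> Basis" for j
    using that assms by (auto simp: Basis_vec_def inner_axis)
  have "(\<Prod>j\<in>Basis. (?b - a) \<bullet> j) = (\<Prod>j\<in>(Basis::(real^2) set). s)"
    by (intro prod.cong refl diff)
  then have p: "(\<Prod>j\<in>Basis. (?b - a) \<bullet> j) = s\<^sup>2" using card by simp
  have 1: "emeasure lborel (cbox a ?b) = ennreal (s\<^sup>2)" "emeasure lborel (box a ?b) = ennreal (s\<^sup>2)"
    using le p by (simp_all add: emeasure_lborel_cbox emeasure_lborel_box)
  have sub: "box a ?b \<subseteq> sq a s" "sq a s \<subseteq> cbox a ?b"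
    by (auto simp: sq_def mem_box_cart forall_2)
  show ?thesis
    using emeasure_mono[OF sub(1), of lborel] emeasure_mono[OF sub(2), of lborel] unfolding 1 by simp
qed

lemma dist_sq:
  assumes "x \<in> sq a s" "y \<in> sq a s"
  shows "dist x y < 2 * s"
proof -
  have "dist x y \<le> \<bar>x $ 1 - y $ 1\<bar> + \<bar>x $ 2 - y $ 2\<bar>"
    unfolding dist_norm using norm_le_l1_cart[of "x - y"] by (simp add: sum_2)
  then show ?thesis using assms by (auto simp: sq_def)
qed

lemma indicator_sq_split:
  assumes "s > 0"
  shows "indicator (sq a (2 * s)) x = (indicator (sq a s) x + indicator (sq (a + s *\<^sub>R axis 1 1) s) x
    + indicator (sq (a + s *\<^sub>R axis 2 1) s) x + indicator (sq (a + s *\<^sub>R axis 1 1 + s *\<^sub>R axis 2 1) s) x :: real)"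
  using assms by (auto simp: sq_def indicator_def axis_def)

definition sint :: "real^2 \<Rightarrow> real \<Rightarrow> (real^2 \<Rightarrow> real) \<Rightarrow> real" where
  "sint a s f = (LINT x|lborel. indicator (sq a s) x * f x)"

lemma abs_power2_le: "\<bar>t\<bar> \<le> B \<Longrightarrow> \<bar>t\<^sup>2\<bar> \<le> (B::real)\<^sup>2"
  using power_mono[of "\<bar>t\<bar>" B 2] by simp

lemma sint_integrable:
  fixes f :: "real^2 \<Rightarrow> real"
  assumes [measurable]: "f \<in> borel_measurable borel" and B: "\<And>x. \<bar>f x\<bar> \<le> B"
  shows "integrable lborel (\<lambda>x. indicator (sq a s) x * f x)"
proof (rule integrable_bounded_support[of _ B "norm a + 2 * \<bar>s\<bar>"])
  show "\<bar>indicator (sq a s) x * f x\<bar> \<le> B" for x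
    using B[of x] by (cases "x \<in> sq a s") auto
  fix x :: "real^2" assume x: "norm a + 2 * \<bar>s\<bar> < norm x"
  show "indicator (sq a s) x * f x = 0"
  proof (cases "x \<in> sq a s")
    case True
    then have "a \<in> sq a s" by (auto simp: sq_def)
    from dist_sq[OF True this] norm_triangle_ineq2[of x a] x show ?thesis by (simp add: dist_norm)
  qed simp
qed measurable

lemma sint_split:
  assumes "f \<in> borel_measurable borel" "\<And>x. \<bar>f x\<bar> \<le> B" "s > 0"
  shows "sint a (2 * s) f = sint a s f + sint (a + s *\<^sub>R axis 1 1) s f
    + sint (a + s *\<^sub>R axis 2 1) s f + sint (a + s *\<^sub>R axis 1 1 + s *\<^sub>R axis 2 1) s f"
  unfolding sint_def indicator_sq_split[OF assms(3)] distrib_right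
  using sint_integrable[OF assms(1,2)] by simp

lemma sint_mono:
  assumes "f \<in> borel_measurable borel" "\<And>x. \<bar>f x\<bar> \<le> B" "g \<in> borel_measurable borel" "\<And>x. \<bar>g x\<bar> \<le> B'"
    and "\<And>x. x \<in> sq a s \<Longrightarrow> f x \<le> g x"
  shows "sint a s f \<le> sint a s g"
  unfolding sint_def using assms(5)
  by (intro Bochner_Integration.integral_mono sint_integrable[OF assms(1,2)] sint_integrable[OF assms(3,4)])
     (auto simp: indicator_def)

lemma sint_nonneg: "(\<And>x. 0 \<le> f x) \<Longrightarrow> 0 \<le> sint a s f"
  unfolding sint_def by (intro Bochner_Integration.integral_nonneg) auto

lemma sint_add:
  assumes "f \<in> borel_measurable borel" "\<And>x. \<bar>f x\<bar> \<le> B" "g \<in> borel_measurable borel" "\<And>x. \<bar>g x\<bar> \<le> B'"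
  shows "sint a s (\<lambda>x. f x + g x) = sint a s f + sint a s g"
  unfolding sint_def distrib_left
  by (intro Bochner_Integration.integral_add sint_integrable[OF assms(1,2)] sint_integrable[OF assms(3,4)])

lemma sint_cmult: "sint a s (\<lambda>x. c * f x) = c * sint a s f"
  unfolding sint_def by (simp add: mult.left_commute)

lemma sint_const: "s > 0 \<Longrightarrow> sint a s (\<lambda>x. c) = c * s\<^sup>2"
  unfolding sint_def by (simp add: measure_def emeasure_sq)

definition mean :: "real^2 \<Rightarrow> real \<Rightarrow> (real^2 \<Rightarrow> real) \<Rightarrow> real" where
  "mean a s f = sint a s f / s\<^sup>2"

lemma sint_abs: "\<bar>sint a s f\<bar> \<le> sint a s (\<lambda>x. \<bar>f x\<bar>)"
  unfolding sint_def using integral_abs_bound[of lborel "\<lambda>x. indicator (sq a s) x * f x"] by (simp add: abs_mult)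

lemma mean_diff:
  assumes "f \<in> borel_measurable borel" "\<And>x. \<bar>f x\<bar> \<le> N" "s > 0"
  shows "\<bar>mean a s f - c\<bar> * s\<^sup>2 \<le> sint a s (\<lambda>x. \<bar>f x - c\<bar>)"
proof -
  have "sint a s (\<lambda>x. f x + (- c)) = sint a s f + sint a s (\<lambda>x. - c)"
    by (rule sint_add[where B = N and B' = "\<bar>c\<bar>"]) (use assms in auto)
  then have "sint a s (\<lambda>x. f x - c) = sint a s f - c * s\<^sup>2"
    using sint_const[OF assms(3), of a "-c"] by simp
  then have "(mean a s f - c) * s\<^sup>2 = sint a s (\<lambda>x. f x - c)"
    using assms(3) by (simp add: mean_def left_diff_distrib)
  then have "\<bar>mean a s f - c\<bar> * s\<^sup>2 = \<bar>sint a s (\<lambda>x. f x - c)\<bar>"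
    by (metis abs_mult abs_power2)
  then show ?thesis using sint_abs by metis
qed

lemma mean_bound:
  assumes "f \<in> borel_measurable borel" "\<And>x. \<bar>f x\<bar> \<le> N" "s > 0"
  shows "\<bar>mean a s f\<bar> \<le> N"
proof -
  have "\<bar>mean a s f\<bar> * s\<^sup>2 \<le> sint a s (\<lambda>x. \<bar>f x\<bar>)" using mean_diff[OF assms, of a 0] by simp
  also have "\<dots> \<le> sint a s (\<lambda>x. N)"
    using assms by (intro sint_mono[where B = N and B' = "\<bar>N\<bar>"]) (auto intro: order_trans[OF _ abs_ge_self])
  finally show ?thesis using assms(3) sint_const[OF assms(3), of a N] by simp
qed

text \<open>The cross term vanishes because \<open>f\<close> minus its mean integrates to 0. The
  last summand is the price of changing the centre, which the stopping argument pays.\<close>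

lemma sint_variance:
  assumes f: "f \<in> borel_measurable borel" "\<And>x. \<bar>f x\<bar> \<le> N" and s: "s > 0"
  shows "sint a s (\<lambda>x. (f x - c)\<^sup>2) = sint a s (\<lambda>x. (f x - mean a s f)\<^sup>2) + (mean a s f - c)\<^sup>2 * s\<^sup>2"
proof -
  let ?m = "mean a s f"
  note f(1)[measurable]
  have N0: "N \<ge> 0" using f(2)[of 0] by linarith
  have d: "\<bar>f x - ?m\<bar> \<le> 2 * N" for x
    using f(2)[of x] mean_bound[OF f s, of a] by linarith
  then have b: "\<bar>(f x - ?m)\<^sup>2\<bar> \<le> (2 * N)\<^sup>2" for x by (rule abs_power2_le)
  have b2: "\<bar>2 * (?m - c) * (f x - ?m)\<bar> \<le> \<bar>2 * (?m - c)\<bar> * (2 * N)" for x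
    unfolding abs_mult[of _ "f x - ?m"] by (intro mult_left_mono d) auto
  have "sint a s (\<lambda>x. f x + (- ?m)) = sint a s f + sint a s (\<lambda>x. - ?m)"
    by (rule sint_add[where B = N and B' = "\<bar>?m\<bar>"]) (use f in auto)
  then have z: "sint a s (\<lambda>x. f x - ?m) = 0"
    using sint_const[OF s, of a "- ?m"] s by (simp add: mean_def)
  have "(\<lambda>x. (f x - c)\<^sup>2) = (\<lambda>x. ((f x - ?m)\<^sup>2 + 2 * (?m - c) * (f x - ?m)) + (?m - c)\<^sup>2)"
    by (auto simp: power2_eq_square algebra_simps)
  then have "sint a s (\<lambda>x. (f x - c)\<^sup>2) = sint a s (\<lambda>x. ((f x - ?m)\<^sup>2 + 2 * (?m - c) * (f x - ?m)) + (?m - c)\<^sup>2)" by simp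
  also have "\<dots> = sint a s (\<lambda>x. (f x - ?m)\<^sup>2 + 2 * (?m - c) * (f x - ?m)) + sint a s (\<lambda>x. (?m - c)\<^sup>2)"
    by (rule sint_add[where B = "(2 * N)\<^sup>2 + \<bar>2 * (?m - c)\<bar> * (2 * N)" and B' = "(?m - c)\<^sup>2"])
       (measurable, use b b2 in \<open>auto intro!: order_trans[OF abs_triangle_ineq add_mono]\<close>)
  also have "sint a s (\<lambda>x. (f x - ?m)\<^sup>2 + 2 * (?m - c) * (f x - ?m)) =
    sint a s (\<lambda>x. (f x - ?m)\<^sup>2) + sint a s (\<lambda>x. 2 * (?m - c) * (f x - ?m))"
    by (rule sint_add[OF _ b _ b2]) measurable
  also have "sint a s (\<lambda>x. 2 * (?m - c) * (f x - ?m)) = 0" unfolding sint_cmult z by simp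
  finally show ?thesis by (simp add: sint_const[OF s])
qed

text \<open>Bellman-function form of the Calderon-Zygmund stopping argument: a square is split until the mean of
  \<open>\<bar>f - c\<bar>\<close> on a child exceeds \<open>2 C\<close>; there \<open>c\<close> is replaced by the mean of \<open>f\<close>, at the cost of at most
  \<open>(8 C)\<^sup>2\<close> per unit area. The factor \<open>64 C\<close> is what makes the linear bound absorb this cost. The function
  \<open>e\<close> accounts for the error at the finest scale.\<close>

lemma dyadic_variance_bound:
  assumes f: "f \<in> borel_measurable borel" "\<And>x. \<bar>f x\<bar> \<le> N" and s: "s > 0" and C: "C \<ge> 0"
    and e: "e \<in> borel_measurable borel" "\<And>x. \<bar>e x\<bar> \<le> E"
    and base: "\<And>a. sint a s (\<lambda>x. \<bar>f x - mean a s f\<bar>) \<le> sint a s e"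
    and osc: "\<And>a t. t > 0 \<Longrightarrow> sint a t (\<lambda>x. \<bar>f x - mean a t f\<bar>) \<le> C * t\<^sup>2"
    and c: "\<bar>c\<bar> \<le> N" and start: "sint a (2 ^ n * s) (\<lambda>x. \<bar>f x - c\<bar>) \<le> 2 * C * (2 ^ n * s)\<^sup>2"
  shows "sint a (2 ^ n * s) (\<lambda>x. (f x - c)\<^sup>2) \<le> 64 * C * sint a (2 ^ n * s) (\<lambda>x. \<bar>f x - c\<bar>) + 2 * N * sint a (2 ^ n * s) e"
  using c start
proof (induction n arbitrary: a c)
  case 0
  note f(1)[measurable] e(1)[measurable]
  let ?m = "mean a s f"
  have N0: "N \<ge> 0" using f(2)[of 0] by linarith
  have m: "\<bar>?m\<bar> \<le> N" by (rule mean_bound[OF f s])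
  have d: "\<bar>f x - c\<bar> \<le> 2 * N" "\<bar>f x - ?m\<bar> \<le> 2 * N" for x using f(2)[of x] m 0(1) by linarith+
  have "\<bar>?m - c\<bar> * s\<^sup>2 \<le> 2 * C * s\<^sup>2" using order_trans[OF mean_diff[OF f s, of a c]] 0(2) by simp
  then have mc: "\<bar>?m - c\<bar> \<le> 2 * C" using s by simp
  have b1: "\<bar>2 * C * \<bar>f x - c\<bar>\<bar> \<le> 2 * C * (2 * N)" "\<bar>2 * N * \<bar>f x - ?m\<bar>\<bar> \<le> 2 * N * (2 * N)" for x
    using mult_left_mono[OF d(1)[of x], of "2 * C"] mult_left_mono[OF d(2)[of x], of "2 * N"] C N0
    by (simp_all add: abs_mult)
  \<comment> \<open>At the finest scale one factor \<open>\<bar>f x - c\<bar>\<close> is split at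
    the mean. The distance of the mean from \<open>c\<close> is controlled by the starting bound,
    and next to \<open>\<bar>f x - ?m\<bar>\<close> the other factor is bounded by
    \<open>2 * N\<close>; this produces the coefficient of the error term.\<close>
  have "sint a s (\<lambda>x. (f x - c)\<^sup>2) \<le> sint a s (\<lambda>x. 2 * C * \<bar>f x - c\<bar> + 2 * N * \<bar>f x - ?m\<bar>)"
  proof (rule sint_mono[where B = "(2 * N)\<^sup>2" and B' = "2 * C * (2 * N) + 2 * N * (2 * N)"])
    show "\<bar>(f x - c)\<^sup>2\<bar> \<le> (2 * N)\<^sup>2" for x by (rule abs_power2_le[OF d(1)])
    show "\<bar>2 * C * \<bar>f x - c\<bar> + 2 * N * \<bar>f x - ?m\<bar>\<bar> \<le> 2 * C * (2 * N) + 2 * N * (2 * N)" for x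
      by (rule order_trans[OF abs_triangle_ineq add_mono[OF b1]])
    fix x
    have "(f x - c)\<^sup>2 = \<bar>f x - c\<bar> * \<bar>f x - c\<bar>" by (simp add: power2_eq_square abs_mult[symmetric])
    also have "\<dots> \<le> \<bar>f x - c\<bar> * (\<bar>?m - c\<bar> + \<bar>f x - ?m\<bar>)" by (intro mult_left_mono) auto
    also have "\<dots> = \<bar>f x - c\<bar> * \<bar>?m - c\<bar> + \<bar>f x - c\<bar> * \<bar>f x - ?m\<bar>" by (rule distrib_left)
    also have "\<dots> \<le> \<bar>f x - c\<bar> * (2 * C) + 2 * N * \<bar>f x - ?m\<bar>"
      by (intro add_mono mult_left_mono mult_right_mono mc d) auto
    finally show "(f x - c)\<^sup>2 \<le> 2 * C * \<bar>f x - c\<bar> + 2 * N * \<bar>f x - ?m\<bar>" by (simp add: mult.commute)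
  qed measurable
  also have "\<dots> = 2 * C * sint a s (\<lambda>x. \<bar>f x - c\<bar>) + 2 * N * sint a s (\<lambda>x. \<bar>f x - ?m\<bar>)"
    by (subst sint_add[OF _ b1(1) _ b1(2)]) (measurable, simp add: sint_cmult)
  also have "\<dots> \<le> 64 * C * sint a s (\<lambda>x. \<bar>f x - c\<bar>) + 2 * N * sint a s e"
    using C N0 base[of a] by (intro add_mono mult_left_mono mult_right_mono sint_nonneg) auto
  finally show ?case by simp
next
  case (Suc n)
  note f(1)[measurable] e(1)[measurable]
  have N0: "N \<ge> 0" using f(2)[of 0] by linarith
  define t where "t = 2 ^ n * s"
  have t: "t > 0" "2 ^ Suc n * s = 2 * t" using s by (auto simp: t_def)
  have d: "\<bar>f x - c\<bar> \<le> 2 * N" for x using f(2)[of x] Suc(2) by linarith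
  have d2: "\<bar>(f x - c)\<^sup>2\<bar> \<le> (2 * N)\<^sup>2" for x by (rule abs_power2_le[OF d])
  have d1: "\<bar>\<bar>f x - c\<bar>\<bar> \<le> 2 * N" for x using d by simp
  let ?J = "\<lambda>b. sint b t (\<lambda>x. \<bar>f x - c\<bar>)"
  \<comment> \<open>The parent satisfies the bound \<open>2 * C * (2 * t)\<^sup>2\<close>, and the
    integral over a child cannot exceed that over the parent; hence
    \<open>8 * C * t\<^sup>2\<close>.\<close>
  have child: "sint b t (\<lambda>x. (f x - c)\<^sup>2) \<le> 64 * C * ?J b + 2 * N * sint b t e" if J: "?J b \<le> 8 * C * t\<^sup>2" for b
  proof (cases "?J b \<le> 2 * C * t\<^sup>2")
    case True
    then show ?thesis using Suc.IH[OF Suc(2), of b] by (simp add: t_def)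
  next
    case False
    let ?m = "mean b t f"
    have osc_b: "sint b t (\<lambda>x. \<bar>f x - ?m\<bar>) \<le> C * t\<^sup>2" by (rule osc[OF t(1)])
    also have "\<dots> \<le> 2 * C * t\<^sup>2" using C by simp
    finally have "sint b t (\<lambda>x. (f x - ?m)\<^sup>2) \<le> 64 * C * sint b t (\<lambda>x. \<bar>f x - ?m\<bar>) + 2 * N * sint b t e"
      using Suc.IH[OF mean_bound[OF f t(1)], of b b] by (simp add: t_def)
    also have "\<dots> \<le> 64 * C * (C * t\<^sup>2) + 2 * N * sint b t e"
      using mult_left_mono[OF osc_b, of "64 * C"] C by simp
    finally have 1: "sint b t (\<lambda>x. (f x - ?m)\<^sup>2) \<le> 64 * C * (C * t\<^sup>2) + 2 * N * sint b t e" .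
    have "\<bar>?m - c\<bar> * t\<^sup>2 \<le> 8 * C * t\<^sup>2" using order_trans[OF mean_diff[OF f t(1)] J] .
    then have "\<bar>?m - c\<bar> \<le> 8 * C" using t(1) by simp
    from abs_power2_le[OF this] have "(?m - c)\<^sup>2 \<le> (8 * C)\<^sup>2" by simp
    then have 2: "(?m - c)\<^sup>2 * t\<^sup>2 \<le> (8 * C)\<^sup>2 * t\<^sup>2" by (intro mult_right_mono) auto
    \<comment> \<open>On a stopped square the linear term exceeds
      \<open>128 * C\<^sup>2 * t\<^sup>2\<close>. One half pays for the induction hypothesis with
      the new centre, the other half for the change of centre.\<close>
    have "64 * C * (2 * C * t\<^sup>2) \<le> 64 * C * ?J b" using False C by (intro mult_left_mono) auto
    moreover have "64 * C * (2 * C * t\<^sup>2) = 64 * C * (C * t\<^sup>2) + (8 * C)\<^sup>2 * t\<^sup>2" by (simp add: power2_eq_square)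
    ultimately show ?thesis unfolding sint_variance[OF f t(1), of b c] using 1 2 by linarith
  qed
  let ?b = "a + t *\<^sub>R axis 1 1" and ?c = "a + t *\<^sub>R axis 2 1" and ?d = "a + t *\<^sub>R axis 1 1 + t *\<^sub>R axis 2 1"
  have S: "sint a (2 * t) (\<lambda>x. \<bar>f x - c\<bar>) = ?J a + ?J ?b + ?J ?c + ?J ?d"
    by (rule sint_split[OF _ d1 t(1)]) measurable
  have "sint a (2 * t) (\<lambda>x. \<bar>f x - c\<bar>) \<le> 8 * C * t\<^sup>2" using Suc(3) unfolding t(2) by (simp add: power_mult_distrib)
  moreover have "?J p \<ge> 0" for p by (rule sint_nonneg) simp
  ultimately have Jb: "?J a \<le> 8 * C * t\<^sup>2" "?J ?b \<le> 8 * C * t\<^sup>2" "?J ?c \<le> 8 * C * t\<^sup>2" "?J ?d \<le> 8 * C * t\<^sup>2"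
    unfolding S by (smt (verit))+
  have S2: "sint a (2 * t) (\<lambda>x. (f x - c)\<^sup>2) = sint a t (\<lambda>x. (f x - c)\<^sup>2) + sint ?b t (\<lambda>x. (f x - c)\<^sup>2) + sint ?c t (\<lambda>x. (f x - c)\<^sup>2) + sint ?d t (\<lambda>x. (f x - c)\<^sup>2)"
    by (rule sint_split[OF _ d2 t(1)]) measurable
  have S3: "sint a (2 * t) e = sint a t e + sint ?b t e + sint ?c t e + sint ?d t e"
    by (rule sint_split[OF e t(1)])
  show ?case unfolding t(2) S S2 S3
    using child[OF Jb(1)] child[OF Jb(2)] child[OF Jb(3)] child[OF Jb(4)] by (simp add: distrib_left)
qed

text \<open>Supplies the error function of \<open>dyadic_variance_bound\<close>. A square of side
  \<open>s\<close> has diameter below \<open>2 * s\<close>, so replacing the mean by an integral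
  over the larger disc only increases the pointwise deviation. The bound \<open>8 * pi * N\<close>
  is \<open>2 * N\<close> times the area of that disc over \<open>s\<^sup>2\<close>. The function
  \<open>g\<close> is an integrable substitute for \<open>f\<close> that agrees with it on all pairs
  that matter, since \<open>f\<close> itself need not be integrable.\<close>

lemma sint_oscillation_le_L1_modulus:
  assumes f: "f \<in> borel_measurable borel" "\<And>x. \<bar>f x\<bar> \<le> N" and s: "s > 0"
  defines "e \<equiv> \<lambda>x. (LINT y|lborel. (if dist x y < 2 * s then \<bar>f x - f y\<bar> else 0)) / s\<^sup>2"
  shows "e \<in> borel_measurable borel" "\<bar>e x\<bar> \<le> 8 * pi * N"
    "sint a s (\<lambda>x. \<bar>f x - mean a s f\<bar>) \<le> sint a s e"
    "\<And>g. g \<in> borel_measurable borel \<Longrightarrow> (\<And>x y. x \<in> sq b t \<Longrightarrow> dist x y < 2 * s \<Longrightarrow> g x = f x \<and> g y = f y) \<Longrightarrow>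
       ennreal (sint b t e) \<le> ennreal (1 / s\<^sup>2) * L1_modulus (2 * s) g"
proof -
  note f(1)[measurable]
  have N0: "N \<ge> 0" using f(2)[of 0] by linarith
  let ?k = "\<lambda>x y. if dist x y < 2 * s then \<bar>f x - f y\<bar> else 0"
  show em: "e \<in> borel_measurable borel" unfolding e_def by measurable
  have k: "0 \<le> ?k x y" "?k x y \<le> 2 * N * indicator (ball x (2 * s)) y" for x y
    using f(2)[of x] f(2)[of y] by (auto simp: indicator_def)
  have Ib: "integrable lborel (\<lambda>y. 2 * N * indicator (ball x (2 * s)) y)" for x :: "real^2"
    using area_ball[of "2 * s" x] s by (intro integrable_mult_right integrable_real_indicator) auto
  have Ik: "integrable lborel (?k x)" for x
  proof (rule Bochner_Integration.integrable_bound[OF Ib[of x]])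
    show "AE y in lborel. norm (?k x y) \<le> norm (2 * N * indicator (ball x (2 * s)) y)"
      using k N0 by (intro AE_I2) (auto simp: indicator_def)
  qed measurable
  have e0: "0 \<le> e x" for x
    unfolding e_def using k(1) by (intro divide_nonneg_nonneg Bochner_Integration.integral_nonneg) auto
  have eB: "\<bar>e x\<bar> \<le> 8 * pi * N" for x
  proof -
    have "(LINT y|lborel. ?k x y) \<le> (LINT y|lborel. 2 * N * indicator (ball x (2 * s)) y)"
      by (intro Bochner_Integration.integral_mono Ik Ib k)
    also have "\<dots> = 2 * N * (pi * (2 * s)\<^sup>2)" using area_ball[of "2 * s" x] s by (simp add: measure_def)
    finally have "(LINT y|lborel. ?k x y) \<le> (8 * pi * N) * s\<^sup>2" by (simp add: power_mult_distrib mult_ac)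
    then show ?thesis using e0[of x] s by (simp add: e_def divide_le_eq)
  qed
  show "\<bar>e x\<bar> \<le> 8 * pi * N" by (rule eB)
  have m: "\<bar>mean a s f\<bar> \<le> N" by (rule mean_bound[OF f s])
  show "sint a s (\<lambda>x. \<bar>f x - mean a s f\<bar>) \<le> sint a s e"
  proof (rule sint_mono[where B = "2 * N" and B' = "8 * pi * N"])
    show "\<bar>\<bar>f x - mean a s f\<bar>\<bar> \<le> 2 * N" for x using f(2)[of x] m by linarith
    show "\<bar>e x\<bar> \<le> 8 * pi * N" for x by (rule eB)
    fix x assume x: "x \<in> sq a s"
    have "\<bar>mean a s f - f x\<bar> * s\<^sup>2 \<le> sint a s (\<lambda>y. \<bar>f y - f x\<bar>)" by (rule mean_diff[OF f s])
    also have "\<dots> \<le> (LINT y|lborel. ?k x y)"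
      unfolding sint_def
    proof (rule Bochner_Integration.integral_mono)
      show "integrable lborel (\<lambda>y. indicator (sq a s) y * \<bar>f y - f x\<bar>)"
      proof (rule sint_integrable)
        show "\<bar>\<bar>f y - f x\<bar>\<bar> \<le> 2 * N" for y using f(2)[of x] f(2)[of y] by linarith
      qed measurable
      show "indicator (sq a s) y * \<bar>f y - f x\<bar> \<le> ?k x y" for y
        using dist_sq[OF x, of y] by (cases "y \<in> sq a s") auto
    qed (rule Ik)
    finally show "\<bar>f x - mean a s f\<bar> \<le> e x" using s by (simp add: e_def abs_minus_commute pos_le_divide_eq)
  qed (use em in measurable)
  fix g assume [measurable]: "g \<in> borel_measurable borel"
    and g: "\<And>x y. x \<in> sq b t \<Longrightarrow> dist x y < 2 * s \<Longrightarrow> g x = f x \<and> g y = f y"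
  note em[measurable]
  have "ennreal (sint b t e) = (\<integral>\<^sup>+x. ennreal (indicator (sq b t) x * e x) \<partial>lborel)"
    unfolding sint_def using e0 by (intro nn_integral_eq_integral[symmetric] sint_integrable[OF em eB]) auto
  also have "\<dots> \<le> (\<integral>\<^sup>+x. ennreal (1 / s\<^sup>2) * (\<integral>\<^sup>+y. ennreal \<bar>g x - g y\<bar> * near (2 * s) x y \<partial>lborel) \<partial>lborel)"
  proof (intro nn_integral_mono)
    fix x
    show "ennreal (indicator (sq b t) x * e x) \<le> ennreal (1 / s\<^sup>2) * (\<integral>\<^sup>+y. ennreal \<bar>g x - g y\<bar> * near (2 * s) x y \<partial>lborel)"
    proof (cases "x \<in> sq b t")
      case True
      have "ennreal (LINT y|lborel. ?k x y) = (\<integral>\<^sup>+y. ennreal (?k x y) \<partial>lborel)"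
        using k(1) by (intro nn_integral_eq_integral[symmetric] Ik) auto
      also have "\<dots> = (\<integral>\<^sup>+y. ennreal \<bar>g x - g y\<bar> * near (2 * s) x y \<partial>lborel)"
        using g[OF True] by (intro nn_integral_cong) (auto simp: near_def)
      finally have *: "ennreal (LINT y|lborel. ?k x y) = (\<integral>\<^sup>+y. ennreal \<bar>g x - g y\<bar> * near (2 * s) x y \<partial>lborel)" .
      have "e x = (1 / s\<^sup>2) * (LINT y|lborel. ?k x y)" by (simp add: e_def)
      then have "ennreal (e x) = ennreal (1 / s\<^sup>2) * ennreal (LINT y|lborel. ?k x y)"
        using k(1) by (simp only:) (intro ennreal_mult Bochner_Integration.integral_nonneg, auto)
      then show ?thesis using True * by simp
    qed simp
  qed
  also have "\<dots> = ennreal (1 / s\<^sup>2) * L1_modulus (2 * s) g"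
    unfolding L1_modulus_def by (simp add: nn_integral_cmult)
  finally show "ennreal (sint b t e) \<le> ennreal (1 / s\<^sup>2) * L1_modulus (2 * s) g" .
qed

text \<open>The square is divided into \<open>2 ^ n\<close> parts per side. As \<open>n\<close>
  grows, L1-continuity makes the error at the finest scale, including its factor
  \<open>2 * N\<close>, arbitrarily small, so the final bound does not depend on \<open>N\<close>.
  This takes the place of Lebesgue differentiation.\<close>

lemma bounded_BMO_variance:
  assumes f: "f \<in> borel_measurable borel" "\<And>x. \<bar>f x\<bar> \<le> N" and C: "C \<ge> 0"
    and osc: "\<And>a t. t > 0 \<Longrightarrow> sint a t (\<lambda>x. \<bar>f x - mean a t f\<bar>) \<le> C * t\<^sup>2" and r: "r > 0"
  shows "sint a r (\<lambda>x. (f x - mean a r f)\<^sup>2) \<le> 64 * C\<^sup>2 * r\<^sup>2"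
proof (rule field_le_epsilon)
  fix d :: real assume d: "d > 0"
  note f(1)[measurable]
  have N0: "N \<ge> 0" using f(2)[of 0] by linarith
  \<comment> \<open>The square lies in the ball of radius \<open>2 * r\<close>, and partners at
    distance below \<open>2 * s < r\<close> stay within \<open>3 * r\<close>, so the cutoff is
    invisible there.\<close>
  define g where "g x = indicator (ball a (4 * r)) x * f x" for x
  have gm: "g \<in> borel_measurable borel"
    unfolding g_def[abs_def] using f(1) by (intro borel_measurable_times borel_measurable_indicator) auto
  have g: "integrable lborel g"
  proof (rule integrable_bounded_support[of _ N "norm a + 4 * r"])
    show "\<bar>g x\<bar> \<le> N" for x using f(2)[of x] N0 by (auto simp: g_def indicator_def)
    show "g x = 0" if "norm a + 4 * r < norm x" for x
      using that norm_triangle_ineq2[of x a] by (auto simp: g_def indicator_def dist_norm norm_minus_commute)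
  qed (rule gm)
  \<comment> \<open>At radius \<open>2 * s\<close> this yields
    \<open>sint a r e \<le> d / (2 * (N + 1))\<close>, which survives the factor
    \<open>2 * N\<close>.\<close>
  have "d / (8 * (N + 1)) > 0" using d N0 by simp
  then obtain s0 where s0: "s0 > 0" "\<And>s. 0 < s \<Longrightarrow> s < s0 \<Longrightarrow> L1_modulus s g \<le> ennreal (d / (8 * (N + 1)) * s\<^sup>2)"
    using L1_continuous_integrable[OF g] unfolding L1_continuous_def by blast
  obtain n where n: "2 * r / min s0 r < real n" using reals_Archimedean2 by blast
  define s where "s = r / 2 ^ n"
  have s: "s > 0" "2 ^ n * s = r" using r by (auto simp: s_def)
  have "real n < 2 ^ n" by (rule of_nat_less_two_power)
  then have "2 * r / min s0 r < 2 ^ n" using n by linarith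
  then have "2 * r < 2 ^ n * min s0 r" using s0(1) r by (simp add: pos_divide_less_eq)
  then have "2 * r / 2 ^ n < min s0 r"
    by (subst pos_divide_less_eq) (simp, simp only: mult.commute)
  then have ss: "2 * s < min s0 r" by (simp only: s_def times_divide_eq_right)
  define e where "e x = (LINT y|lborel. (if dist x y < 2 * s then \<bar>f x - f y\<bar> else 0)) / s\<^sup>2" for x
  note E = sint_oscillation_le_L1_modulus[OF f s(1), folded e_def[abs_def]]
  have E2: "\<bar>e x\<bar> \<le> 8 * pi * N" for x
    using sint_oscillation_le_L1_modulus(2)[OF f s(1), of x] by (simp only: e_def)
  let ?m = "mean a r f"
  have oscr: "sint a r (\<lambda>x. \<bar>f x - ?m\<bar>) \<le> C * r\<^sup>2" by (rule osc[OF r])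
  also have "\<dots> \<le> 2 * C * r\<^sup>2" using C by simp
  finally have "sint a r (\<lambda>x. (f x - ?m)\<^sup>2) \<le> 64 * C * sint a r (\<lambda>x. \<bar>f x - ?m\<bar>) + 2 * N * sint a r e"
    using dyadic_variance_bound[OF f s(1) C E(1) E2 E(3) osc mean_bound[OF f r], of a n a] unfolding s(2) by simp
  also have "64 * C * sint a r (\<lambda>x. \<bar>f x - ?m\<bar>) \<le> 64 * C * (C * r\<^sup>2)"
    using oscr C by (intro mult_left_mono) auto
  also have "2 * N * sint a r e \<le> d"
  proof -
    have "ennreal (sint a r e) \<le> ennreal (1 / s\<^sup>2) * L1_modulus (2 * s) g"
    proof (rule E(4))
      show "g \<in> borel_measurable borel" by (rule gm)
      fix x y assume x: "x \<in> sq a r" and xy: "dist x y < 2 * s"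
      have "a \<in> sq a r" using r by (simp add: sq_def)
      from dist_sq[OF this x] have "dist a x < 2 * r" .
      moreover have "dist a y \<le> dist a x + dist x y" by (rule dist_triangle)
      ultimately show "g x = f x \<and> g y = f y" using xy ss r by (auto simp: g_def indicator_def)
    qed
    also have "\<dots> \<le> ennreal (1 / s\<^sup>2) * ennreal (d / (8 * (N + 1)) * (2 * s)\<^sup>2)"
      using s0(2)[of "2 * s"] ss s by (intro mult_left_mono) auto
    also have "\<dots> = ennreal (1 / s\<^sup>2 * (d / (8 * (N + 1)) * (2 * s)\<^sup>2))"
      using d N0 by (intro ennreal_mult[symmetric]) auto
    also have "1 / s\<^sup>2 * (d / (8 * (N + 1)) * (2 * s)\<^sup>2) = d / (2 * (N + 1))"
      using s(1) N0 by (simp add: power_mult_distrib field_simps)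
    finally have "sint a r e \<le> d / (2 * (N + 1))" using d N0 by (simp add: ennreal_le_iff)
    then have "2 * N * sint a r e \<le> 2 * N * (d / (2 * (N + 1)))" using N0 by (intro mult_left_mono) auto
    also have "\<dots> \<le> d" using N0 d by (simp add: field_simps)
    finally show ?thesis .
  qed
  finally show "sint a r (\<lambda>x. (f x - ?m)\<^sup>2) \<le> 64 * C\<^sup>2 * r\<^sup>2 + d" by (simp add: power2_eq_square)
qed

section \<open>The L2 John-Nirenberg inequality\<close>

lemma sint_integrable_of_ball:
  fixes H :: "real^2 \<Rightarrow> real"
  assumes [measurable]: "H \<in> borel_measurable borel" and "t > 0"
    and "integrable lborel (\<lambda>x. indicator (ball a (2 * t)) x * H x)"
  shows "integrable lborel (\<lambda>x. indicator (sq a t) x * H x)"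
proof (rule Bochner_Integration.integrable_bound[OF assms(3)])
  have "a \<in> sq a t" using assms(2) by (simp add: sq_def)
  then have "x \<in> sq a t \<Longrightarrow> x \<in> ball a (2 * t)" for x using dist_sq by simp
  then show "AE x in lborel. norm (indicator (sq a t) x * H x) \<le> norm (indicator (ball a (2 * t)) x * H x)"
    by (intro AE_I2) (auto simp: indicator_def)
qed measurable

lemma truncate_contraction: "N \<ge> 0 \<Longrightarrow> \<bar>truncate N u - truncate N v\<bar> \<le> \<bar>u - v\<bar>"
  unfolding truncate_def by (auto simp: min_def max_def)

text \<open>Truncation is a contraction, so the truncations of \<open>H\<close> inherit the
  oscillation bound, and their variance bound is independent of the height. Their means converge by
  dominated convergence, and Fatou passes to \<open>H\<close>.\<close>

lemma BMO_square_variance: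
  fixes H :: "real^2 \<Rightarrow> real"
  assumes H[measurable]: "H \<in> borel_measurable borel" and C: "C \<ge> 0"
    and int: "\<And>a r. r > 0 \<Longrightarrow> integrable lborel (\<lambda>x. indicator (ball a r) x * H x)"
    and osc: "\<And>a r. r > 0 \<Longrightarrow> \<exists>c. (LINT x|lborel. indicator (ball a r) x * \<bar>H x - c\<bar>) \<le> C * r\<^sup>2"
    and r: "r > 0"
  shows "(\<integral>\<^sup>+x. indicator (sq a r) x * ennreal ((H x - mean a r H)\<^sup>2) \<partial>lborel) \<le> ennreal (4096 * C\<^sup>2 * r\<^sup>2)"
proof -
  define f where "f n x = truncate (real n) (H x)" for n :: nat and x
  have f[measurable]: "f n \<in> borel_measurable borel" and fB: "\<bar>f n x\<bar> \<le> real n" for n x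
    unfolding f_def by (measurable, simp add: abs_truncate_le)
  \<comment> \<open>The square lies in the ball of radius \<open>2 * t\<close> about its corner,
    which gives \<open>4 * C\<close> around the truncated centre; passing to the mean doubles this.
    Then \<open>64 * (8 * C)\<^sup>2\<close> is \<open>4096 * C\<^sup>2\<close>.\<close>
  have fosc: "sint a t (\<lambda>x. \<bar>f n x - mean a t (f n)\<bar>) \<le> (8 * C) * t\<^sup>2" if t: "t > 0" for a t n
  proof -
    obtain c where c: "(LINT x|lborel. indicator (ball a (2 * t)) x * \<bar>H x - c\<bar>) \<le> C * (2 * t)\<^sup>2"
      using osc[of "2 * t" a] t by auto
    let ?c = "truncate (real n) c"
    have aa: "a \<in> sq a t" using t by (simp add: sq_def)
    have I: "integrable lborel (\<lambda>x. indicator (ball a (2 * t)) x * \<bar>H x - c\<bar>)"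
    proof -
      have "integrable lborel (\<lambda>x. indicator (ball a (2 * t)) x * H x - indicator (ball a (2 * t)) x * c)"
        using int[of "2 * t" a] area_ball[of "2 * t" a] t
        by (intro Bochner_Integration.integrable_diff integrable_mult_left integrable_real_indicator) auto
      from integrable_abs[OF this] show ?thesis
        by (simp add: right_diff_distrib[symmetric] abs_mult)
    qed
    have cB: "\<bar>f n x - ?c\<bar> \<le> 2 * real n" for x
      using fB[of n x] abs_truncate_le(1)[of "real n" c] by simp
    have "sint a t (\<lambda>x. \<bar>f n x - ?c\<bar>) \<le> (LINT x|lborel. indicator (ball a (2 * t)) x * \<bar>H x - c\<bar>)"
      unfolding sint_def
    proof (rule Bochner_Integration.integral_mono[OF _ I])
      show "integrable lborel (\<lambda>x. indicator (sq a t) x * \<bar>f n x - ?c\<bar>)"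
      proof (rule sint_integrable)
        show "(\<lambda>x. \<bar>f n x - ?c\<bar>) \<in> borel_measurable borel" by measurable
        show "\<bar>\<bar>f n x - ?c\<bar>\<bar> \<le> 2 * real n" for x using cB by simp
      qed
      show "indicator (sq a t) x * \<bar>f n x - ?c\<bar> \<le> indicator (ball a (2 * t)) x * \<bar>H x - c\<bar>" for x
        using dist_sq[OF aa, of x] truncate_contraction[of "real n" "H x" c]
        by (cases "x \<in> sq a t") (auto simp: f_def)
    qed
    then have 1: "sint a t (\<lambda>x. \<bar>f n x - ?c\<bar>) \<le> 4 * C * t\<^sup>2" using c by (simp add: power_mult_distrib)
    then have 2: "\<bar>mean a t (f n) - ?c\<bar> * t\<^sup>2 \<le> 4 * C * t\<^sup>2"
      using mean_diff[OF f fB t, of a n ?c] by linarith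
    have "sint a t (\<lambda>x. \<bar>f n x - mean a t (f n)\<bar>) \<le> sint a t (\<lambda>x. \<bar>f n x - ?c\<bar> + \<bar>mean a t (f n) - ?c\<bar>)"
    proof (rule sint_mono[where B = "2 * real n" and B' = "2 * real n + \<bar>mean a t (f n) - ?c\<bar>"])
      show "\<bar>\<bar>f n x - mean a t (f n)\<bar>\<bar> \<le> 2 * real n" for x
        using fB[of n x] mean_bound[OF f fB t, of a n] by linarith
      show "\<bar>\<bar>f n x - ?c\<bar> + \<bar>mean a t (f n) - ?c\<bar>\<bar> \<le> 2 * real n + \<bar>mean a t (f n) - ?c\<bar>" for x
        using cB[of x] by linarith
      show "\<bar>f n x - mean a t (f n)\<bar> \<le> \<bar>f n x - ?c\<bar> + \<bar>mean a t (f n) - ?c\<bar>" for x by linarith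
    qed measurable
    also have "\<dots> = sint a t (\<lambda>x. \<bar>f n x - ?c\<bar>) + sint a t (\<lambda>x. \<bar>mean a t (f n) - ?c\<bar>)"
    proof (rule sint_add)
      show "\<bar>\<bar>f n x - ?c\<bar>\<bar> \<le> 2 * real n" for x using cB by simp
      show "\<bar>\<bar>mean a t (f n) - ?c\<bar>\<bar> \<le> \<bar>mean a t (f n) - ?c\<bar>" by simp
    qed measurable
    also have "\<dots> \<le> (8 * C) * t\<^sup>2" using 1 2 by (simp add: sint_const[OF t])
    finally show ?thesis .
  qed
  have var: "sint a r (\<lambda>x. (f n x - mean a r (f n))\<^sup>2) \<le> 4096 * C\<^sup>2 * r\<^sup>2" for n
    using bounded_BMO_variance[OF f fB _ fosc r, of a n] C by (simp add: power_mult_distrib)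
  have lim_f: "(\<lambda>n. f n x) \<longlonglongrightarrow> H x" for x
  proof (rule tendsto_eventually)
    obtain N where "\<bar>H x\<bar> \<le> real N" using real_arch_simple by blast
    then show "\<forall>\<^sub>F n in sequentially. f n x = H x"
      unfolding eventually_sequentially f_def by (intro exI[of _ N]) (auto intro: truncate_eq)
  qed
  have "(\<lambda>n. sint a r (f n)) \<longlonglongrightarrow> sint a r H"
    unfolding sint_def
  proof (rule integral_dominated_convergence[where w = "\<lambda>x. \<bar>indicator (sq a r) x * H x\<bar>"])
    show "integrable lborel (\<lambda>x. \<bar>indicator (sq a r) x * H x\<bar>)"
      using sint_integrable_of_ball[OF H r int[of "2 * r" a]] r by simp
    show "AE x in lborel. (\<lambda>n. indicator (sq a r) x * f n x) \<longlonglongrightarrow> indicator (sq a r) x * H x"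
      by (intro AE_I2 tendsto_intros lim_f)
    show "AE x in lborel. norm (indicator (sq a r) x * f n x) \<le> \<bar>indicator (sq a r) x * H x\<bar>" for n
      by (intro AE_I2) (auto simp: abs_mult f_def abs_truncate_le intro!: mult_left_mono)
  qed measurable
  then have lim_m: "(\<lambda>n. mean a r (f n)) \<longlonglongrightarrow> mean a r H"
    unfolding mean_def using r by (intro tendsto_intros) auto
  define u where "u n x = ennreal (indicator (sq a r) x * (f n x - mean a r (f n))\<^sup>2)" for n x
  have [measurable]: "u n \<in> borel_measurable borel" for n unfolding u_def by measurable
  have u_lim: "(\<lambda>n. u n x) \<longlonglongrightarrow> ennreal (indicator (sq a r) x * (H x - mean a r H)\<^sup>2)" for x
    unfolding u_def by (intro tendsto_ennrealI tendsto_intros lim_f lim_m)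
  have u_int: "(\<integral>\<^sup>+x. u n x \<partial>lborel) \<le> ennreal (4096 * C\<^sup>2 * r\<^sup>2)" for n
  proof -
    have b: "\<bar>f n x - mean a r (f n)\<bar> \<le> 2 * real n" for x
      using fB[of n x] mean_bound[OF f fB r, of a n] by linarith
    have "(\<integral>\<^sup>+x. u n x \<partial>lborel) = ennreal (sint a r (\<lambda>x. (f n x - mean a r (f n))\<^sup>2))"
      unfolding u_def sint_def
    proof (intro nn_integral_eq_integral sint_integrable)
      show "(\<lambda>x. (f n x - mean a r (f n))\<^sup>2) \<in> borel_measurable borel" by measurable
    qed (use abs_power2_le[OF b] in auto)
    then show ?thesis using var[of n] by (simp add: ennreal_leI)
  qed
  have "(\<integral>\<^sup>+x. indicator (sq a r) x * ennreal ((H x - mean a r H)\<^sup>2) \<partial>lborel) = (\<integral>\<^sup>+x. liminf (\<lambda>n. u n x) \<partial>lborel)"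
  proof (intro nn_integral_cong)
    fix x
    have "liminf (\<lambda>n. u n x) = ennreal (indicator (sq a r) x * (H x - mean a r H)\<^sup>2)"
      by (intro lim_imp_Liminf u_lim) simp
    then show "indicator (sq a r) x * ennreal ((H x - mean a r H)\<^sup>2) = liminf (\<lambda>n. u n x)"
      by (auto simp: indicator_def)
  qed
  also have "\<dots> \<le> liminf (\<lambda>n. \<integral>\<^sup>+x. u n x \<partial>lborel)"
    by (intro nn_integral_liminf) measurable
  also have "\<dots> \<le> limsup (\<lambda>n. \<integral>\<^sup>+x. u n x \<partial>lborel)" by (intro Liminf_le_Limsup) simp
  also have "\<dots> \<le> ennreal (4096 * C\<^sup>2 * r\<^sup>2)"
    by (intro Limsup_bounded always_eventually allI u_int)
  finally show ?thesis .
qed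

text \<open>Bounded mean oscillation in the form in which it is used: in L2, on balls, not divided
  by the area. The existential centre makes the passage from squares to balls and the subtraction of
  constants immediate.\<close>

definition L2_oscillation :: "(real^2 \<Rightarrow> real) \<Rightarrow> real \<Rightarrow> bool" where
  "L2_oscillation H K \<longleftrightarrow> K \<ge> 0 \<and> H \<in> borel_measurable borel \<and>
    (\<forall>z r. r > 0 \<longrightarrow> (\<exists>h. (\<integral>\<^sup>+x. ennreal ((H x - h)\<^sup>2) * near r z x \<partial>lborel) \<le> ennreal (K * r\<^sup>2)))"

text \<open>A disc of radius \<open>r\<close> lies in a square of side \<open>2 * r\<close>, whose
  mean serves as the centre; the side contributes the factor 4 in
  \<open>16384 = 4 * 4096\<close>.\<close>

lemma john_nirenberg_L2:
  fixes H :: "real^2 \<Rightarrow> real"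
  assumes H[measurable]: "H \<in> borel_measurable borel" and C: "C \<ge> 0"
    and int: "\<And>a r. r > 0 \<Longrightarrow> integrable lborel (\<lambda>x. indicator (ball a r) x * H x)"
    and osc: "\<And>a r. r > 0 \<Longrightarrow> \<exists>c. (LINT x|lborel. indicator (ball a r) x * \<bar>H x - c\<bar>) \<le> C * r\<^sup>2"
  shows "L2_oscillation H (16384 * C\<^sup>2)"
  unfolding L2_oscillation_def
proof (intro conjI allI impI H)
  fix z :: "real^2" and r :: real assume r: "r > 0"
  let ?a = "z - (\<chi> i. r)"
  have sub: "dist z x < r \<Longrightarrow> x \<in> sq ?a (2 * r)" for x
    using component_le_norm_cart[of "z - x" 1] component_le_norm_cart[of "z - x" 2] by (auto simp: sq_def dist_norm)
  have "(\<integral>\<^sup>+x. ennreal ((H x - mean ?a (2 * r) H)\<^sup>2) * near r z x \<partial>lborel)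
    \<le> (\<integral>\<^sup>+x. indicator (sq ?a (2 * r)) x * ennreal ((H x - mean ?a (2 * r) H)\<^sup>2) \<partial>lborel)"
    using sub by (intro nn_integral_mono) (auto simp: near_def)
  also have "\<dots> \<le> ennreal (4096 * C\<^sup>2 * (2 * r)\<^sup>2)"
    using r by (intro BMO_square_variance[OF H C int osc]) auto
  finally show "\<exists>h. (\<integral>\<^sup>+x. ennreal ((H x - h)\<^sup>2) * near r z x \<partial>lborel) \<le> ennreal (16384 * C\<^sup>2 * r\<^sup>2)"
    by (intro exI[of _ "mean ?a (2 * r) H"]) (simp add: power_mult_distrib mult.assoc)
qed simp

section \<open>Bilinear estimates for differences of a function of bounded mean oscillation\<close>

lemma ennreal_mult_le_weighted_squares:
  assumes "t > 0"
  shows "X * Y \<le> ennreal t * X\<^sup>2 + ennreal (1 / t) * (Y::ennreal)\<^sup>2"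
proof (cases X; cases Y)
  fix x y assume xy: "X = ennreal x" "Y = ennreal y" "0 \<le> x" "0 \<le> y"
  have "0 \<le> (t * x - y)\<^sup>2" by simp
  then have "2 * (t * (x * y)) \<le> t\<^sup>2 * x\<^sup>2 + y\<^sup>2" by (simp add: power2_diff power_mult_distrib mult_ac)
  moreover have "0 \<le> t * (x * y)" using assms xy by simp
  ultimately have "t * (x * y) \<le> t * (t * x\<^sup>2) + y\<^sup>2" by (simp add: power2_eq_square[of t] mult.assoc)
  then have "t * (x * y) / t \<le> (t * (t * x\<^sup>2) + y\<^sup>2) / t" using assms by (intro divide_right_mono) auto
  then have "x * y \<le> t * x\<^sup>2 + 1 / t * y\<^sup>2" using assms by (simp add: add_divide_distrib)
  then show ?thesis using xy assms
    by (simp add: ennreal_mult[symmetric] ennreal_power ennreal_plus[symmetric] ennreal_leI del: ennreal_plus)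
qed (use assms in \<open>auto simp: ennreal_mult_top power2_eq_square ennreal_top_mult\<close>)

text \<open>On one ball, |H x - H y| \<le> |H x - h| + |H y - h| splits the double integral into two
  products of single integrals. In each product Cauchy-Schwarz yields \<open>K * r\<^sup>2\<close>
  for the factor containing \<open>H - h\<close> and the area \<open>pi * r\<^sup>2\<close> for the
  other, hence \<open>K + pi\<close>.\<close>

lemma local_oscillation_bilinear:
  assumes osc: "L2_oscillation H K" and [measurable]: "f \<in> borel_measurable borel" "g \<in> borel_measurable borel"
    and r: "r > 0" and t: "t > 0"
  shows "(\<integral>\<^sup>+x. \<integral>\<^sup>+y. ennreal (\<bar>f x\<bar> * \<bar>H x - H y\<bar> * \<bar>g y\<bar>) * (near r z x * near r z y) \<partial>lborel \<partial>lborel) \<le>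
    ennreal ((K + pi) * r\<^sup>2) * (ennreal t * (\<integral>\<^sup>+x. ennreal ((f x)\<^sup>2) * near r z x \<partial>lborel)
      + ennreal (1 / t) * (\<integral>\<^sup>+x. ennreal ((g x)\<^sup>2) * near r z x \<partial>lborel))"
proof -
  have K: "K \<ge> 0" and [measurable]: "H \<in> borel_measurable borel" using osc by (auto simp: L2_oscillation_def)
  obtain h where h: "(\<integral>\<^sup>+x. ennreal ((H x - h)\<^sup>2) * near r z x \<partial>lborel) \<le> ennreal (K * r\<^sup>2)"
    using osc r unfolding L2_oscillation_def by blast
  let ?n = "near r z"
  have nn: "?n x * ?n x = ?n x" for x by (simp add: near_def)
  have sq_int: "(\<integral>\<^sup>+x. ennreal \<bar>k x\<bar> * ?n x \<partial>lborel)\<^sup>2 \<le> (\<integral>\<^sup>+x. ennreal ((k x)\<^sup>2) * ?n x \<partial>lborel) * ennreal (pi * r\<^sup>2)"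
    if [measurable]: "k \<in> borel_measurable borel" for k
  proof -
    have "(\<integral>\<^sup>+x. (ennreal \<bar>k x\<bar> * ?n x) * ?n x \<partial>lborel)\<^sup>2 \<le> (\<integral>\<^sup>+x. (ennreal \<bar>k x\<bar> * ?n x)\<^sup>2 \<partial>lborel) * (\<integral>\<^sup>+x. (?n x)\<^sup>2 \<partial>lborel)"
      by (intro Cauchy_Schwarz_nn_integral) measurable
    then show ?thesis using r
      by (simp add: mult.assoc nn power_mult_distrib ennreal_power power2_eq_square[of "?n _"] nn_integral_near)
  qed
  have sq_intH: "(\<integral>\<^sup>+x. ennreal (\<bar>k x\<bar> * \<bar>H x - h\<bar>) * ?n x \<partial>lborel)\<^sup>2 \<le> (\<integral>\<^sup>+x. ennreal ((k x)\<^sup>2) * ?n x \<partial>lborel) * ennreal (K * r\<^sup>2)"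
    if [measurable]: "k \<in> borel_measurable borel" for k
  proof -
    have "(\<integral>\<^sup>+x. (ennreal \<bar>k x\<bar> * ?n x) * (ennreal \<bar>H x - h\<bar> * ?n x) \<partial>lborel)\<^sup>2 \<le>
        (\<integral>\<^sup>+x. (ennreal \<bar>k x\<bar> * ?n x)\<^sup>2 \<partial>lborel) * (\<integral>\<^sup>+x. (ennreal \<bar>H x - h\<bar> * ?n x)\<^sup>2 \<partial>lborel)"
      by (intro Cauchy_Schwarz_nn_integral) measurable
    also have "(\<integral>\<^sup>+x. (ennreal \<bar>H x - h\<bar> * ?n x)\<^sup>2 \<partial>lborel) = (\<integral>\<^sup>+x. ennreal ((H x - h)\<^sup>2) * ?n x \<partial>lborel)"
      by (simp add: power_mult_distrib ennreal_power power2_eq_square[of "?n _"] nn)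
    also have "(\<integral>\<^sup>+x. (ennreal \<bar>k x\<bar> * ?n x)\<^sup>2 \<partial>lborel) = (\<integral>\<^sup>+x. ennreal ((k x)\<^sup>2) * ?n x \<partial>lborel)"
      by (simp add: power_mult_distrib ennreal_power power2_eq_square[of "?n _"] nn)
    also have "(\<integral>\<^sup>+x. (ennreal \<bar>k x\<bar> * ?n x) * (ennreal \<bar>H x - h\<bar> * ?n x) \<partial>lborel) = (\<integral>\<^sup>+x. ennreal (\<bar>k x\<bar> * \<bar>H x - h\<bar>) * ?n x \<partial>lborel)"
    proof (intro nn_integral_cong)
      fix x
      show "(ennreal \<bar>k x\<bar> * ?n x) * (ennreal \<bar>H x - h\<bar> * ?n x) = ennreal (\<bar>k x\<bar> * \<bar>H x - h\<bar>) * ?n x"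
        by (simp add: near_def ennreal_mult)
    qed
    finally show ?thesis by (rule order_trans) (intro mult_left_mono h, simp)
  qed
  let ?F = "\<integral>\<^sup>+x. ennreal ((f x)\<^sup>2) * ?n x \<partial>lborel" and ?G = "\<integral>\<^sup>+x. ennreal ((g x)\<^sup>2) * ?n x \<partial>lborel"
  let ?f = "\<integral>\<^sup>+x. ennreal \<bar>f x\<bar> * ?n x \<partial>lborel" and ?g = "\<integral>\<^sup>+x. ennreal \<bar>g x\<bar> * ?n x \<partial>lborel"
  let ?fH = "\<integral>\<^sup>+x. ennreal (\<bar>f x\<bar> * \<bar>H x - h\<bar>) * ?n x \<partial>lborel" and ?gH = "\<integral>\<^sup>+x. ennreal (\<bar>g x\<bar> * \<bar>H x - h\<bar>) * ?n x \<partial>lborel"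
  have "(\<integral>\<^sup>+x. \<integral>\<^sup>+y. ennreal (\<bar>f x\<bar> * \<bar>H x - H y\<bar> * \<bar>g y\<bar>) * (?n x * ?n y) \<partial>lborel \<partial>lborel) \<le>
    (\<integral>\<^sup>+x. \<integral>\<^sup>+y. (ennreal (\<bar>f x\<bar> * \<bar>H x - h\<bar>) * ?n x) * (ennreal \<bar>g y\<bar> * ?n y)
       + (ennreal \<bar>f x\<bar> * ?n x) * (ennreal (\<bar>g y\<bar> * \<bar>H y - h\<bar>) * ?n y) \<partial>lborel \<partial>lborel)"
  proof (intro nn_integral_mono)
    fix x y
    have "\<bar>f x\<bar> * \<bar>H x - H y\<bar> * \<bar>g y\<bar> \<le> \<bar>f x\<bar> * (\<bar>H x - h\<bar> + \<bar>H y - h\<bar>) * \<bar>g y\<bar>"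
      by (intro mult_right_mono mult_left_mono) auto
    also have "\<dots> = (\<bar>f x\<bar> * \<bar>H x - h\<bar>) * \<bar>g y\<bar> + \<bar>f x\<bar> * (\<bar>g y\<bar> * \<bar>H y - h\<bar>)"
      by (simp add: distrib_left distrib_right mult_ac)
    finally have "ennreal (\<bar>f x\<bar> * \<bar>H x - H y\<bar> * \<bar>g y\<bar>) \<le> ennreal ((\<bar>f x\<bar> * \<bar>H x - h\<bar>) * \<bar>g y\<bar> + \<bar>f x\<bar> * (\<bar>g y\<bar> * \<bar>H y - h\<bar>))"
      by (rule ennreal_leI)
    also have "\<dots> = ennreal (\<bar>f x\<bar> * \<bar>H x - h\<bar>) * ennreal \<bar>g y\<bar> + ennreal \<bar>f x\<bar> * ennreal (\<bar>g y\<bar> * \<bar>H y - h\<bar>)"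
      by (subst ennreal_plus) (auto simp: ennreal_mult)
    finally show "ennreal (\<bar>f x\<bar> * \<bar>H x - H y\<bar> * \<bar>g y\<bar>) * (?n x * ?n y) \<le>
      (ennreal (\<bar>f x\<bar> * \<bar>H x - h\<bar>) * ?n x) * (ennreal \<bar>g y\<bar> * ?n y)
       + (ennreal \<bar>f x\<bar> * ?n x) * (ennreal (\<bar>g y\<bar> * \<bar>H y - h\<bar>) * ?n y)"
      by (cases "dist z x < r \<and> dist z y < r") (auto simp: near_def)
  qed
  also have "\<dots> = ?fH * ?g + ?f * ?gH"
    by (simp add: nn_integral_add nn_integral_cmult nn_integral_multc)
  also have "\<dots> \<le> (ennreal t * ?fH\<^sup>2 + ennreal (1 / t) * ?g\<^sup>2) + (ennreal t * ?f\<^sup>2 + ennreal (1 / t) * ?gH\<^sup>2)"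
    by (intro add_mono ennreal_mult_le_weighted_squares t)
  also have "\<dots> \<le> (ennreal t * (?F * ennreal (K * r\<^sup>2)) + ennreal (1 / t) * (?G * ennreal (pi * r\<^sup>2)))
      + (ennreal t * (?F * ennreal (pi * r\<^sup>2)) + ennreal (1 / t) * (?G * ennreal (K * r\<^sup>2)))"
    by (intro add_mono mult_left_mono sq_int sq_intH) auto
  also have "\<dots> = (ennreal (K * r\<^sup>2) + ennreal (pi * r\<^sup>2)) * (ennreal t * ?F + ennreal (1 / t) * ?G)"
    by (simp add: distrib_left distrib_right add_ac mult_ac)
  also have "ennreal (K * r\<^sup>2) + ennreal (pi * r\<^sup>2) = ennreal ((K + pi) * r\<^sup>2)"
    using K by (simp add: ennreal_plus[symmetric] distrib_right del: ennreal_plus)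
  finally show ?thesis .
qed

text \<open>Localization to balls of radius \<open>2 s\<close>: for \<open>dist x y < s\<close> the set of centres
  of such balls containing both points has area at least \<open>\<pi> s\<^sup>2\<close>.\<close>

lemma oscillation_bilinear:
  assumes osc: "L2_oscillation H K" and [measurable]: "f \<in> borel_measurable borel" "g \<in> borel_measurable borel"
    and s: "s > 0" and t: "t > 0"
  shows "(\<integral>\<^sup>+x. \<integral>\<^sup>+y. ennreal (\<bar>f x\<bar> * \<bar>H x - H y\<bar> * \<bar>g y\<bar>) * near s x y \<partial>lborel \<partial>lborel) \<le>
    ennreal (16 * (K + pi) * s\<^sup>2) * (ennreal t * (\<integral>\<^sup>+x. ennreal ((f x)\<^sup>2) \<partial>lborel) + ennreal (1 / t) * (\<integral>\<^sup>+x. ennreal ((g x)\<^sup>2) \<partial>lborel))"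
proof -
  have K: "K \<ge> 0" and [measurable]: "H \<in> borel_measurable borel" using osc by (auto simp: L2_oscillation_def)
  let ?F = "\<integral>\<^sup>+x. ennreal ((f x)\<^sup>2) \<partial>lborel" and ?G = "\<integral>\<^sup>+x. ennreal ((g x)\<^sup>2) \<partial>lborel"
  let ?w = "\<lambda>x y. ennreal (\<bar>f x\<bar> * \<bar>H x - H y\<bar> * \<bar>g y\<bar>)"
  let ?n = "near (2 * s)"
  have near_le: "near s x y \<le> ennreal (1 / (pi * s\<^sup>2)) * (\<integral>\<^sup>+z. ?n z x * ?n z y \<partial>lborel)" for x y
  proof (cases "dist x y < s")
    case True
    have "near s x z \<le> ?n z x * ?n z y" for z
    proof (cases "dist x z < s")
      case z: True
      have "dist z y \<le> dist x z + dist x y" by (metis dist_commute dist_triangle)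
      then show ?thesis using z True s by (simp add: near_def dist_commute)
    qed (simp add: near_def)
    then have "(\<integral>\<^sup>+z. near s x z \<partial>lborel) \<le> (\<integral>\<^sup>+z. ?n z x * ?n z y \<partial>lborel)" by (intro nn_integral_mono)
    then have "ennreal (pi * s\<^sup>2) \<le> (\<integral>\<^sup>+z. ?n z x * ?n z y \<partial>lborel)" using s by (simp add: nn_integral_near)
    then have "ennreal (1 / (pi * s\<^sup>2)) * ennreal (pi * s\<^sup>2) \<le> ennreal (1 / (pi * s\<^sup>2)) * (\<integral>\<^sup>+z. ?n z x * ?n z y \<partial>lborel)"
      by (intro mult_left_mono) auto
    moreover have "ennreal (1 / (pi * s\<^sup>2)) * ennreal (pi * s\<^sup>2) = 1"
      using s by (simp add: ennreal_mult[symmetric])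
    ultimately show ?thesis using True by (simp add: near_def)
  qed (simp add: near_def)
  have "(\<integral>\<^sup>+x. \<integral>\<^sup>+y. ?w x y * near s x y \<partial>lborel \<partial>lborel) \<le>
    (\<integral>\<^sup>+x. \<integral>\<^sup>+y. ennreal (1 / (pi * s\<^sup>2)) * (\<integral>\<^sup>+z. ?w x y * (?n z x * ?n z y) \<partial>lborel) \<partial>lborel \<partial>lborel)"
  proof (intro nn_integral_mono)
    fix x y
    have "?w x y * near s x y \<le> ?w x y * (ennreal (1 / (pi * s\<^sup>2)) * (\<integral>\<^sup>+z. ?n z x * ?n z y \<partial>lborel))"
      by (intro mult_left_mono near_le) simp
    also have "\<dots> = ennreal (1 / (pi * s\<^sup>2)) * (\<integral>\<^sup>+z. ?w x y * (?n z x * ?n z y) \<partial>lborel)"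
      by (subst nn_integral_cmult) (measurable, simp add: mult.left_commute)
    finally show "?w x y * near s x y \<le> ennreal (1 / (pi * s\<^sup>2)) * (\<integral>\<^sup>+z. ?w x y * (?n z x * ?n z y) \<partial>lborel)" .
  qed
  also have "\<dots> = ennreal (1 / (pi * s\<^sup>2)) * (\<integral>\<^sup>+x. \<integral>\<^sup>+y. \<integral>\<^sup>+z. ?w x y * (?n z x * ?n z y) \<partial>lborel \<partial>lborel \<partial>lborel)"
    by (simp add: nn_integral_cmult)
  also have "(\<integral>\<^sup>+x. \<integral>\<^sup>+y. \<integral>\<^sup>+z. ?w x y * (?n z x * ?n z y) \<partial>lborel \<partial>lborel \<partial>lborel)
    = (\<integral>\<^sup>+x. \<integral>\<^sup>+z. \<integral>\<^sup>+y. ?w x y * (?n z x * ?n z y) \<partial>lborel \<partial>lborel \<partial>lborel)"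
    by (intro nn_integral_cong lborel_pair.Fubini') measurable
  also have "\<dots> = (\<integral>\<^sup>+z. \<integral>\<^sup>+x. \<integral>\<^sup>+y. ?w x y * (?n z x * ?n z y) \<partial>lborel \<partial>lborel \<partial>lborel)"
    by (intro lborel_pair.Fubini') measurable
  also have "\<dots> \<le> (\<integral>\<^sup>+z. ennreal ((K + pi) * (2 * s)\<^sup>2) * (ennreal t * (\<integral>\<^sup>+x. ennreal ((f x)\<^sup>2) * ?n z x \<partial>lborel)
      + ennreal (1 / t) * (\<integral>\<^sup>+x. ennreal ((g x)\<^sup>2) * ?n z x \<partial>lborel)) \<partial>lborel)"
    using s by (intro nn_integral_mono local_oscillation_bilinear[OF osc _ _ _ t]) auto
  also have "\<dots> = ennreal ((K + pi) * (2 * s)\<^sup>2) * (ennreal t * (\<integral>\<^sup>+z. \<integral>\<^sup>+x. ennreal ((f x)\<^sup>2) * ?n z x \<partial>lborel \<partial>lborel)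
      + ennreal (1 / t) * (\<integral>\<^sup>+z. \<integral>\<^sup>+x. ennreal ((g x)\<^sup>2) * ?n z x \<partial>lborel \<partial>lborel))"
    by (simp add: nn_integral_cmult nn_integral_add)
  also have "\<dots> = ennreal ((K + pi) * (2 * s)\<^sup>2) * (ennreal t * (ennreal (pi * (2 * s)\<^sup>2) * ?F) + ennreal (1 / t) * (ennreal (pi * (2 * s)\<^sup>2) * ?G))"
    using s by (subst (1 2) nn_integral_near_right) auto
  also have "\<dots> = ennreal ((K + pi) * (2 * s)\<^sup>2) * ennreal (pi * (2 * s)\<^sup>2) * (ennreal t * ?F + ennreal (1 / t) * ?G)"
    by (simp add: distrib_left mult_ac)
  finally have "(\<integral>\<^sup>+x. \<integral>\<^sup>+y. ?w x y * near s x y \<partial>lborel \<partial>lborel) \<le>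
    ennreal (1 / (pi * s\<^sup>2)) * (ennreal ((K + pi) * (2 * s)\<^sup>2) * ennreal (pi * (2 * s)\<^sup>2) * (ennreal t * ?F + ennreal (1 / t) * ?G))"
    by (simp add: mult_left_mono)
  also have "\<dots> = ennreal (1 / (pi * s\<^sup>2)) * ennreal ((K + pi) * (2 * s)\<^sup>2) * ennreal (pi * (2 * s)\<^sup>2) * (ennreal t * ?F + ennreal (1 / t) * ?G)"
    by (simp add: mult.assoc)
  \<comment> \<open>Of the 16, one 4 comes from the local estimate at radius \<open>2 * s\<close>
    and one from the area of admissible centres for a single point.\<close>
  also have "ennreal (1 / (pi * s\<^sup>2)) * ennreal ((K + pi) * (2 * s)\<^sup>2) * ennreal (pi * (2 * s)\<^sup>2) = ennreal (16 * (K + pi) * s\<^sup>2)"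
    using K s by (simp add: ennreal_mult[symmetric] power_mult_distrib)
  finally show ?thesis .
qed

section \<open>Commutators of mollification with functions of bounded mean oscillation\<close>

lemma ball_borel_sets [measurable]: "ball (x::real^2) r \<in> sets borel" "cball (x::real^2) r \<in> sets borel"
  by auto

definition loc_L1 :: "(real^2 \<Rightarrow> real) \<Rightarrow> bool" where
  "loc_L1 f \<longleftrightarrow> f \<in> borel_measurable borel \<and> (\<forall>R. integrable lborel (\<lambda>x. indicator (cball 0 R) x * f x))"

definition loc_L2 :: "(real^2 \<Rightarrow> real) \<Rightarrow> bool" where
  "loc_L2 f \<longleftrightarrow> f \<in> borel_measurable borel \<and> (\<forall>R. integrable lborel (\<lambda>x. indicator (cball 0 R) x * (f x)\<^sup>2))"

lemma loc_L1_borel [measurable_dest]: "loc_L1 f \<Longrightarrow> f \<in> borel_measurable borel"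
  and loc_L2_borel [measurable_dest]: "loc_L2 f \<Longrightarrow> f \<in> borel_measurable borel"
  by (simp_all add: loc_L1_def loc_L2_def)

lemma loc_L1_mult_integrable:
  assumes "loc_L1 f" and [measurable]: "k \<in> borel_measurable borel"
    and "\<And>x. \<bar>k x\<bar> \<le> B" "\<And>x. norm x > R \<Longrightarrow> k x = 0"
  shows "integrable lborel (\<lambda>x. f x * k x)"
proof -
  have "integrable lborel (\<lambda>x. (indicator (cball 0 R) x * f x) * k x)"
    using assms by (intro integrable_mult_bounded[of lborel "\<lambda>x. indicator (cball 0 R) x * f x" k B]) (auto simp: loc_L1_def)
  moreover have "(indicator (cball 0 R) x * f x) * k x = f x * k x" for x
    using assms(4)[of x] by (cases "norm x > R") auto
  ultimately show ?thesis by simp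
qed

lemma loc_L2_mult:
  assumes f: "loc_L2 f" and g: "loc_L2 g"
  shows "loc_L1 (\<lambda>x. f x * g x)"
  unfolding loc_L1_def
proof (intro conjI allI)
  note [measurable] = loc_L2_borel[OF f] loc_L2_borel[OF g]
  show "(\<lambda>x. f x * g x) \<in> borel_measurable borel" by measurable
  fix R
  have sq: "(indicator (cball 0 R) x * k)\<^sup>2 = indicator (cball 0 R) x * (k::real)\<^sup>2" for x :: "real^2" and k
    by (auto simp: indicator_def)
  have "integrable lborel (\<lambda>x. (indicator (cball 0 R) x * f x) * (indicator (cball 0 R) x * g x))"
  proof (rule integrable_mult_L2)
    show "integrable lborel (\<lambda>x. (indicator (cball 0 R) x * f x)\<^sup>2)" "integrable lborel (\<lambda>x. (indicator (cball 0 R) x * g x)\<^sup>2)"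
      unfolding sq using f g by (simp_all add: loc_L2_def)
  qed measurable
  moreover have "(indicator (cball 0 R) x * f x) * (indicator (cball 0 R) x * g x) = indicator (cball 0 R) x * (f x * g x)" for x
    by (auto simp: indicator_def)
  ultimately show "integrable lborel (\<lambda>x. indicator (cball 0 R) x * (f x * g x))" by simp
qed

lemma loc_L2_const: "loc_L2 (\<lambda>x. c)"
  unfolding loc_L2_def
proof (intro conjI allI)
  fix R
  show "integrable lborel (\<lambda>x::real^2. indicator (cball 0 R) x * c\<^sup>2)"
    using emeasure_bounded_finite[OF bounded_cball, of "0::real^2" R] by (intro integrable_mult_left integrable_real_indicator) auto
qed simp

lemma loc_L2_imp_L1: "loc_L2 f \<Longrightarrow> loc_L1 f"
  using loc_L2_mult[OF _ loc_L2_const[of 1], of f] by simp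

lemma loc_L1_add: "loc_L1 f \<Longrightarrow> loc_L1 g \<Longrightarrow> loc_L1 (\<lambda>x. f x + g x)"
  and loc_L1_diff: "loc_L1 f \<Longrightarrow> loc_L1 g \<Longrightarrow> loc_L1 (\<lambda>x. f x - g x)"
  by (auto simp: loc_L1_def distrib_left right_diff_distrib)

lemma L2_oscillation_imp_loc_L2:
  assumes "L2_oscillation H K"
  shows "loc_L2 H"
  unfolding loc_L2_def
proof (intro conjI allI)
  show [measurable]: "H \<in> borel_measurable borel" using assms by (simp add: L2_oscillation_def)
  fix R
  define r :: real where "r = \<bar>R\<bar> + 1"
  have r: "r > 0" "R < r" by (auto simp: r_def)
  obtain h where h: "(\<integral>\<^sup>+x. ennreal ((H x - h)\<^sup>2) * near r 0 x \<partial>lborel) \<le> ennreal (K * r\<^sup>2)"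
    using assms r unfolding L2_oscillation_def by blast
  have "(\<integral>\<^sup>+x. ennreal (norm (indicator (cball 0 R) x * (H x)\<^sup>2)) \<partial>lborel) \<le>
    (\<integral>\<^sup>+x. ennreal 2 * (ennreal ((H x - h)\<^sup>2) * near r 0 x) + ennreal (2 * h\<^sup>2) * near r 0 x \<partial>lborel)"
  proof (intro nn_integral_mono)
    fix x
    \<comment> \<open>This square is the difference of the two sides of the next inequality.\<close>
    have "0 \<le> (H x - 2 * h)\<^sup>2" by simp
    then have "(H x)\<^sup>2 \<le> 2 * (H x - h)\<^sup>2 + 2 * h\<^sup>2" by (simp add: power2_eq_square algebra_simps)
    then have "ennreal ((H x)\<^sup>2) \<le> ennreal (2 * (H x - h)\<^sup>2 + 2 * h\<^sup>2)" by (rule ennreal_leI)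
    also have "\<dots> = ennreal 2 * ennreal ((H x - h)\<^sup>2) + ennreal (2 * h\<^sup>2)" by (simp add: ennreal_plus ennreal_mult)
    finally show "ennreal (norm (indicator (cball 0 R) x * (H x)\<^sup>2)) \<le> ennreal 2 * (ennreal ((H x - h)\<^sup>2) * near r 0 x) + ennreal (2 * h\<^sup>2) * near r 0 x"
      using r by (cases "norm x \<le> R") (auto simp: near_def)
  qed
  also have "\<dots> = ennreal 2 * (\<integral>\<^sup>+x. ennreal ((H x - h)\<^sup>2) * near r 0 x \<partial>lborel) + ennreal (2 * h\<^sup>2) * ennreal (pi * r\<^sup>2)"
    using r by (simp add: nn_integral_add nn_integral_cmult nn_integral_near)
  also have "\<dots> < \<infinity>" using order_le_less_trans[OF h ennreal_less_top] by (simp add: ennreal_mult_less_top)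
  finally show "integrable lborel (\<lambda>x. indicator (cball 0 R) x * (H x)\<^sup>2)"
    by (intro integrableI_bounded) auto
qed

lemma L2_oscillation_shift: "L2_oscillation H K \<Longrightarrow> L2_oscillation (\<lambda>x. H x - h) K"
  unfolding L2_oscillation_def
proof (intro conjI allI impI; (elim conjE)?)
  fix z :: "real^2" and r :: real assume r: "0 < r"
    and "\<forall>z r. r > 0 \<longrightarrow> (\<exists>h. (\<integral>\<^sup>+x. ennreal ((H x - h)\<^sup>2) * near r z x \<partial>lborel) \<le> ennreal (K * r\<^sup>2))"
  then obtain h' where "(\<integral>\<^sup>+x. ennreal ((H x - h')\<^sup>2) * near r z x \<partial>lborel) \<le> ennreal (K * r\<^sup>2)" by blast
  then show "\<exists>h'. (\<integral>\<^sup>+x. ennreal ((H x - h - h')\<^sup>2) * near r z x \<partial>lborel) \<le> ennreal (K * r\<^sup>2)"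
    by (intro exI[of _ "h' - h"]) simp
qed simp_all

text \<open>Improves the O(s^2) of \<open>oscillation_bilinear\<close> to o(s^2). The product of the
  two truncations is bounded and sees only the L1 modulus of \<open>H\<close> on a ball; the
  remaining products contain a truncation error, small in L2, to which the bilinear bound
  applies.\<close>

lemma oscillation_pairing_truncated:
  assumes osc: "L2_oscillation H K" and [measurable]: "f \<in> borel_measurable borel" "g \<in> borel_measurable borel"
    and f2: "integrable lborel (\<lambda>x. (f x)\<^sup>2)" and g2: "integrable lborel (\<lambda>x. (g x)\<^sup>2)"
    and supp: "\<And>x. norm x > R \<Longrightarrow> f x = 0" "\<And>x. norm x > R \<Longrightarrow> g x = 0" and d: "d > 0"
  shows "\<exists>s0>0. \<forall>s. 0 < s \<and> s < s0 \<longrightarrow>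
    (\<integral>\<^sup>+x. \<integral>\<^sup>+y. ennreal (\<bar>f x\<bar> * \<bar>H x - H y\<bar> * \<bar>g y\<bar>) * near s x y \<partial>lborel \<partial>lborel) \<le> ennreal (d * s\<^sup>2)"
proof -
  have K: "K \<ge> 0" and [measurable]: "H \<in> borel_measurable borel" using osc by (auto simp: L2_oscillation_def)
  define F where "F = (LINT x|lborel. (f x)\<^sup>2)"
  define G where "G = (LINT x|lborel. (g x)\<^sup>2)"
  have F: "F \<ge> 0" "(\<integral>\<^sup>+x. ennreal ((f x)\<^sup>2) \<partial>lborel) = ennreal F" and G: "G \<ge> 0" "(\<integral>\<^sup>+x. ennreal ((g x)\<^sup>2) \<partial>lborel) = ennreal G"
    using f2 g2 by (auto simp: F_def G_def nn_integral_eq_integral)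
  define M where "M = 16 * (K + pi)"
  have M: "M > 0" using K pi_gt_zero by (simp add: M_def add_nonneg_pos)
  \<comment> \<open>The weight makes the contributions of the full \<open>f\<close> and
    \<open>g\<close> at most \<open>d / 8\<close>; the truncation errors
    \<open>t * d / (8 * M)\<close> are tuned to cost \<open>d / 8\<close> after division by
    \<open>t\<close>. With \<open>d / 2\<close> for the bounded part the total is
    \<open>d\<close>.\<close>
  define t where "t = d / (8 * M * (F + G + 1))"
  have t: "t > 0" using d M F G by (simp add: t_def)
  have "F + G + 1 \<noteq> 0" using F(1) G(1) by linarith
  then have "M * t * (F + G + 1) = d / 8" using M unfolding t_def by (simp add: divide_simps)
  moreover have "M * t * F \<le> M * t * (F + G + 1)" "M * t * G \<le> M * t * (F + G + 1)"
    using M t F G by (intro mult_left_mono; simp)+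
  ultimately have "M * t * F \<le> d / 8" "M * t * G \<le> d / 8" by linarith+
  then have tFG: "M * (t * F) \<le> d / 8" "M * (t * G) \<le> d / 8" by (simp_all only: mult.assoc)
  have td: "t * d / (8 * M) > 0" using t d M by simp
  have fm: "f \<in> borel_measurable lborel" and gm: "g \<in> borel_measurable lborel" by simp_all
  obtain N1 where N1: "N1 > 0" "(LINT x|lborel. (f x - truncate N1 (f x))\<^sup>2) \<le> t * d / (8 * M)"
    by (rule truncation_L2[OF fm f2 td])
  obtain N2 where N2: "N2 > 0" "(LINT x|lborel. (g x - truncate N2 (g x))\<^sup>2) \<le> t * d / (8 * M)"
    by (rule truncation_L2[OF gm g2 td])
  define f' where "f' x = f x - truncate N1 (f x)" for x
  define g' where "g' x = g x - truncate N2 (g x)" for x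
  have [measurable]: "f' \<in> borel_measurable borel" "g' \<in> borel_measurable borel" unfolding f'_def g'_def by measurable
  have F': "(\<integral>\<^sup>+x. ennreal ((f' x)\<^sup>2) \<partial>lborel) \<le> ennreal (t * d / (8 * M))"
    and G': "(\<integral>\<^sup>+x. ennreal ((g' x)\<^sup>2) \<partial>lborel) \<le> ennreal (t * d / (8 * M))"
    using integrable_truncated_sq(1)[OF fm f2, of N1] integrable_truncated_sq(1)[OF gm g2, of N2] N1 N2
    by (auto simp: f'_def g'_def nn_integral_eq_integral ennreal_leI)
  \<comment> \<open>\<open>H\<close> need not be integrable on the plane, but both functions vanish
    beyond radius \<open>R\<close>, so only pairs inside this ball contribute, and there
    \<open>k\<close> equals \<open>H\<close>.\<close>
  define k where "k x = indicator (cball 0 R) x * H x" for x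
  have "loc_L1 H" by (intro loc_L2_imp_L1 L2_oscillation_imp_loc_L2[OF osc])
  then have kI: "integrable lborel k" unfolding k_def[abs_def] loc_L1_def by blast
  have [measurable]: "k \<in> borel_measurable borel" using borel_measurable_integrable[OF kI] by simp
  have "d / (2 * N1 * N2) > 0" using d N1 N2 by simp
  then obtain s0 where s0: "s0 > 0" "\<And>s. 0 < s \<Longrightarrow> s < s0 \<Longrightarrow> L1_modulus s k \<le> ennreal (d / (2 * N1 * N2) * s\<^sup>2)"
    using L1_continuous_integrable[OF kI] unfolding L1_continuous_def by blast
  have "(\<integral>\<^sup>+x. \<integral>\<^sup>+y. ennreal (\<bar>f x\<bar> * \<bar>H x - H y\<bar> * \<bar>g y\<bar>) * near s x y \<partial>lborel \<partial>lborel) \<le> ennreal (d * s\<^sup>2)"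
    if s: "0 < s" "s < s0" for s
  proof -
    let ?w = "\<lambda>f g x y. ennreal (\<bar>f x\<bar> * \<bar>H x - H y\<bar> * \<bar>g y\<bar>) * near s x y"
    have "(\<integral>\<^sup>+x. \<integral>\<^sup>+y. ?w f g x y \<partial>lborel \<partial>lborel) \<le>
      (\<integral>\<^sup>+x. \<integral>\<^sup>+y. ennreal (N1 * N2) * (ennreal \<bar>k x - k y\<bar> * near s x y) + (?w f g' x y + ?w f' g x y) \<partial>lborel \<partial>lborel)"
    proof (intro nn_integral_mono)
      fix x y
      let ?D = "\<bar>H x - H y\<bar>"
      have n1: "\<bar>truncate N1 (f x)\<bar> \<le> N1" and n2: "\<bar>truncate N2 (g y)\<bar> \<le> N2" "\<bar>truncate N2 (g y)\<bar> \<le> \<bar>g y\<bar>"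
        using N1 N2 by (auto simp: abs_truncate_le)
      have "\<bar>f x\<bar> * ?D * \<bar>g y\<bar> \<le> N1 * N2 * \<bar>k x - k y\<bar> + (\<bar>f x\<bar> * ?D * \<bar>g' y\<bar> + \<bar>f' x\<bar> * ?D * \<bar>g y\<bar>)"
      proof (cases "norm x \<le> R \<and> norm y \<le> R")
        case True
        then have kD: "\<bar>k x - k y\<bar> = ?D" by (simp add: k_def)
        have "\<bar>f x\<bar> * \<bar>g y\<bar> \<le> \<bar>f x\<bar> * (\<bar>truncate N2 (g y)\<bar> + \<bar>g' y\<bar>)"
          by (intro mult_left_mono) (auto simp: g'_def)
        also have "\<dots> = \<bar>f x\<bar> * \<bar>truncate N2 (g y)\<bar> + \<bar>f x\<bar> * \<bar>g' y\<bar>" by (rule distrib_left)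
        also have "\<bar>f x\<bar> * \<bar>truncate N2 (g y)\<bar> \<le> (\<bar>truncate N1 (f x)\<bar> + \<bar>f' x\<bar>) * \<bar>truncate N2 (g y)\<bar>"
          by (intro mult_right_mono) (auto simp: f'_def)
        also have "\<dots> = \<bar>truncate N1 (f x)\<bar> * \<bar>truncate N2 (g y)\<bar> + \<bar>f' x\<bar> * \<bar>truncate N2 (g y)\<bar>" by (rule distrib_right)
        also have "\<bar>truncate N1 (f x)\<bar> * \<bar>truncate N2 (g y)\<bar> \<le> N1 * N2" using n1 n2 N1 by (intro mult_mono) auto
        also have "\<bar>f' x\<bar> * \<bar>truncate N2 (g y)\<bar> \<le> \<bar>f' x\<bar> * \<bar>g y\<bar>" using n2 by (intro mult_left_mono) auto
        finally have "\<bar>f x\<bar> * \<bar>g y\<bar> \<le> N1 * N2 + \<bar>f' x\<bar> * \<bar>g y\<bar> + \<bar>f x\<bar> * \<bar>g' y\<bar>" by simp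
        from mult_right_mono[OF this, of ?D] show ?thesis unfolding kD distrib_right by (simp add: mult_ac)
      qed (use supp[of x] supp[of y] N1 N2 in auto)
      then have "ennreal (\<bar>f x\<bar> * ?D * \<bar>g y\<bar>) \<le> ennreal (N1 * N2 * \<bar>k x - k y\<bar> + (\<bar>f x\<bar> * ?D * \<bar>g' y\<bar> + \<bar>f' x\<bar> * ?D * \<bar>g y\<bar>))"
        by (rule ennreal_leI)
      also have "\<dots> = ennreal (N1 * N2) * ennreal \<bar>k x - k y\<bar> + (ennreal (\<bar>f x\<bar> * ?D * \<bar>g' y\<bar>) + ennreal (\<bar>f' x\<bar> * ?D * \<bar>g y\<bar>))"
      proof -
        have "ennreal (N1 * N2 * \<bar>k x - k y\<bar>) = ennreal (N1 * N2) * ennreal \<bar>k x - k y\<bar>"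
          using N1 N2 by (intro ennreal_mult) auto
        then show ?thesis using N1 N2 by (simp add: ennreal_plus)
      qed
      finally show "?w f g x y \<le> ennreal (N1 * N2) * (ennreal \<bar>k x - k y\<bar> * near s x y) + (?w f g' x y + ?w f' g x y)"
        by (cases "dist x y < s") (auto simp: near_def)
    qed
    also have "\<dots> = ennreal (N1 * N2) * L1_modulus s k + ((\<integral>\<^sup>+x. \<integral>\<^sup>+y. ?w f g' x y \<partial>lborel \<partial>lborel) + (\<integral>\<^sup>+x. \<integral>\<^sup>+y. ?w f' g x y \<partial>lborel \<partial>lborel))"
      unfolding L1_modulus_def by (simp add: nn_integral_add nn_integral_cmult)
    also have "\<dots> \<le> ennreal (N1 * N2) * ennreal (d / (2 * N1 * N2) * s\<^sup>2)
       + (ennreal (M * s\<^sup>2) * (ennreal t * ennreal F + ennreal (1 / t) * ennreal (t * d / (8 * M)))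
       + ennreal (M * s\<^sup>2) * (ennreal (1 / t) * ennreal (t * d / (8 * M)) + ennreal t * ennreal G))"
    proof (intro add_mono)
      show "ennreal (N1 * N2) * L1_modulus s k \<le> ennreal (N1 * N2) * ennreal (d / (2 * N1 * N2) * s\<^sup>2)"
        by (intro mult_left_mono s0 s) simp
      have "(\<integral>\<^sup>+x. \<integral>\<^sup>+y. ?w f g' x y \<partial>lborel \<partial>lborel) \<le> ennreal (M * s\<^sup>2) * (ennreal t * (\<integral>\<^sup>+x. ennreal ((f x)\<^sup>2) \<partial>lborel) + ennreal (1 / t) * (\<integral>\<^sup>+x. ennreal ((g' x)\<^sup>2) \<partial>lborel))"
        unfolding M_def by (intro oscillation_bilinear[OF osc _ _ s(1) t]) auto
      also have "\<dots> \<le> ennreal (M * s\<^sup>2) * (ennreal t * ennreal F + ennreal (1 / t) * ennreal (t * d / (8 * M)))"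
        unfolding F(2) by (intro mult_left_mono add_mono G') auto
      finally show "(\<integral>\<^sup>+x. \<integral>\<^sup>+y. ?w f g' x y \<partial>lborel \<partial>lborel) \<le> ennreal (M * s\<^sup>2) * (ennreal t * ennreal F + ennreal (1 / t) * ennreal (t * d / (8 * M)))" .
      \<comment> \<open>The small function is now the first one, so the bilinear estimate is used
        with weight \<open>1 / t\<close>.\<close>
      have "(\<integral>\<^sup>+x. \<integral>\<^sup>+y. ?w f' g x y \<partial>lborel \<partial>lborel) \<le> ennreal (M * s\<^sup>2) * (ennreal (1 / t) * (\<integral>\<^sup>+x. ennreal ((f' x)\<^sup>2) \<partial>lborel) + ennreal (1 / (1 / t)) * (\<integral>\<^sup>+x. ennreal ((g x)\<^sup>2) \<partial>lborel))"
        unfolding M_def using t by (intro oscillation_bilinear[OF osc _ _ s(1)]) auto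
      also have "\<dots> \<le> ennreal (M * s\<^sup>2) * (ennreal (1 / t) * ennreal (t * d / (8 * M)) + ennreal (1 / (1 / t)) * ennreal G)"
        unfolding G(2) by (intro mult_left_mono add_mono F') auto
      finally show "(\<integral>\<^sup>+x. \<integral>\<^sup>+y. ?w f' g x y \<partial>lborel \<partial>lborel) \<le> ennreal (M * s\<^sup>2) * (ennreal (1 / t) * ennreal (t * d / (8 * M)) + ennreal t * ennreal G)"
        by simp
    qed
    also have "\<dots> = ennreal (N1 * N2 * (d / (2 * N1 * N2) * s\<^sup>2) + (M * s\<^sup>2 * (t * F + 1 / t * (t * d / (8 * M)))
       + M * s\<^sup>2 * (1 / t * (t * d / (8 * M)) + t * G)))"
      using N1 N2 M t d F G by (simp add: ennreal_mult[symmetric] ennreal_plus[symmetric] del: ennreal_plus)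
    also have "\<dots> \<le> ennreal (d * s\<^sup>2)"
    proof (intro ennreal_leI)
      have 1: "N1 * N2 * (d / (2 * N1 * N2) * s\<^sup>2) = d / 2 * s\<^sup>2" using N1 N2 by simp
      have "M * (t * F + 1 / t * (t * d / (8 * M))) \<le> d / 4" "M * (1 / t * (t * d / (8 * M)) + t * G) \<le> d / 4"
        using tFG M t by (simp_all add: distrib_left)
      from mult_right_mono[OF this(1), of "s\<^sup>2"] mult_right_mono[OF this(2), of "s\<^sup>2"]
      have "M * s\<^sup>2 * (t * F + 1 / t * (t * d / (8 * M))) \<le> d / 4 * s\<^sup>2" "M * s\<^sup>2 * (1 / t * (t * d / (8 * M)) + t * G) \<le> d / 4 * s\<^sup>2"
        by (simp_all add: mult_ac)
      then show "N1 * N2 * (d / (2 * N1 * N2) * s\<^sup>2) + (M * s\<^sup>2 * (t * F + 1 / t * (t * d / (8 * M)))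
       + M * s\<^sup>2 * (1 / t * (t * d / (8 * M)) + t * G)) \<le> d * s\<^sup>2" unfolding 1 by linarith
    qed
    finally show ?thesis .
  qed
  then show ?thesis using s0(1) by blast
qed

text \<open>Moving the convolution to the other factor in the second integral turns the difference
  into the double integral of f(x) (H(x) - H(y)) g(y) against the mollifier. The height
  \<open>c / e\<^sup>2\<close> then meets an o(e^2) bound. Neither integral needs to converge to
  anything by itself.\<close>

lemma convolution_commutator_tendsto_0:
  assumes osc: "L2_oscillation H K" and [measurable]: "f \<in> borel_measurable borel" "g \<in> borel_measurable borel"
    and f2: "integrable lborel (\<lambda>x. (f x)\<^sup>2)" and g2: "integrable lborel (\<lambda>x. (g x)\<^sup>2)"
    and f: "integrable lborel f" and g: "integrable lborel g"
    and supp: "\<And>x. norm x > R \<Longrightarrow> f x = 0" "\<And>x. norm x > R \<Longrightarrow> g x = 0"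
    and Hf: "integrable lborel (\<lambda>x. H x * f x)" and Hg: "integrable lborel (\<lambda>x. H x * g x)"
  shows "((\<lambda>e. (LINT x|lborel. H x * f x * convolution (moll e) g x) - (LINT x|lborel. H x * g x * convolution (moll e) f x)) \<longlongrightarrow> 0) (at_right 0)"
proof (rule tendsto_at_right_0I)
  fix d :: real assume d: "d > 0"
  have K: "K \<ge> 0" and [measurable]: "H \<in> borel_measurable borel" using osc by (auto simp: L2_oscillation_def)
  obtain c where c: "c > 0" "\<And>e x y. e > 0 \<Longrightarrow> ennreal (moll e (x - y)) \<le> ennreal (c / e\<^sup>2) * near e x y"
    using moll_le_near by blast
  have "d / c > 0" using d c by simp
  have "\<exists>s0>0. \<forall>s. 0 < s \<and> s < s0 \<longrightarrow>
    (\<integral>\<^sup>+x. \<integral>\<^sup>+y. ennreal (\<bar>f x\<bar> * \<bar>H x - H y\<bar> * \<bar>g y\<bar>) * near s x y \<partial>lborel \<partial>lborel) \<le> ennreal (d / c * s\<^sup>2)"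
    by (rule oscillation_pairing_truncated[where R = R, OF osc _ _ f2 g2]) (use supp \<open>d / c > 0\<close> in auto)
  then obtain e0 where e0: "e0 > 0" "\<And>e. 0 < e \<Longrightarrow> e < e0 \<Longrightarrow>
    (\<integral>\<^sup>+x. \<integral>\<^sup>+y. ennreal (\<bar>f x\<bar> * \<bar>H x - H y\<bar> * \<bar>g y\<bar>) * near e x y \<partial>lborel \<partial>lborel) \<le> ennreal (d / c * e\<^sup>2)" by blast
  have "\<bar>(LINT x|lborel. H x * f x * convolution (moll e) g x) - (LINT x|lborel. H x * g x * convolution (moll e) f x) - 0\<bar> \<le> d"
    if e: "0 < e" "e < e0" for e
  proof -
    note [measurable] = moll_borel[OF e(1)]
    let ?k = "\<lambda>x. \<integral>\<^sup>+y. ennreal (\<bar>f x\<bar> * \<bar>H x - H y\<bar> * \<bar>g y\<bar>) * near e x y \<partial>lborel"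
    have "(LINT x|lborel. H x * f x * convolution (moll e) g x) - (LINT x|lborel. H x * g x * convolution (moll e) f x)
      = (LINT x|lborel. H x * f x * convolution (moll e) g x) - (LINT x|lborel. f x * convolution (moll e) (\<lambda>x. H x * g x) x)"
      using convolution_adjoint[OF e(1) Hg f] by simp
    also have "\<dots> = (LINT x|lborel. H x * f x * convolution (moll e) g x - f x * convolution (moll e) (\<lambda>x. H x * g x) x)"
      by (intro Bochner_Integration.integral_diff[symmetric] integrable_mult_convolution e Hf g f Hg)
    finally have eq: "(LINT x|lborel. H x * f x * convolution (moll e) g x) - (LINT x|lborel. H x * g x * convolution (moll e) f x)
      = (LINT x|lborel. H x * f x * convolution (moll e) g x - f x * convolution (moll e) (\<lambda>x. H x * g x) x)" .
    have "ennreal \<bar>(LINT x|lborel. H x * f x * convolution (moll e) g x) - (LINT x|lborel. H x * g x * convolution (moll e) f x)\<bar>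
      \<le> (\<integral>\<^sup>+x. ennreal \<bar>H x * f x * convolution (moll e) g x - f x * convolution (moll e) (\<lambda>x. H x * g x) x\<bar> \<partial>lborel)"
      unfolding eq by (rule abs_integral_le_nn_integral)
    also have "\<dots> \<le> (\<integral>\<^sup>+x. ennreal (c / e\<^sup>2) * ?k x \<partial>lborel)"
    proof (intro nn_integral_mono)
      fix x
      have I1: "integrable lborel (\<lambda>y. moll e (x - y) * g y)" "integrable lborel (\<lambda>y. moll e (x - y) * (H y * g y))"
        by (intro convolution_integrable moll_test_functions e g Hg)+
      have "H x * f x * convolution (moll e) g x - f x * convolution (moll e) (\<lambda>x. H x * g x) x
        = (LINT y|lborel. H x * f x * (moll e (x - y) * g y)) - (LINT y|lborel. f x * (moll e (x - y) * (H y * g y)))"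
        unfolding convolution_def by simp
      also have "\<dots> = (LINT y|lborel. H x * f x * (moll e (x - y) * g y) - f x * (moll e (x - y) * (H y * g y)))"
        using I1 by (intro Bochner_Integration.integral_diff[symmetric] integrable_mult_right) auto
      finally have eqx: "H x * f x * convolution (moll e) g x - f x * convolution (moll e) (\<lambda>x. H x * g x) x
        = (LINT y|lborel. H x * f x * (moll e (x - y) * g y) - f x * (moll e (x - y) * (H y * g y)))" .
      have "ennreal \<bar>H x * f x * convolution (moll e) g x - f x * convolution (moll e) (\<lambda>x. H x * g x) x\<bar>
         \<le> (\<integral>\<^sup>+y. ennreal \<bar>H x * f x * (moll e (x - y) * g y) - f x * (moll e (x - y) * (H y * g y))\<bar> \<partial>lborel)"
        unfolding eqx by (rule abs_integral_le_nn_integral)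
      also have "\<dots> \<le> (\<integral>\<^sup>+y. ennreal (c / e\<^sup>2) * (ennreal (\<bar>f x\<bar> * \<bar>H x - H y\<bar> * \<bar>g y\<bar>) * near e x y) \<partial>lborel)"
      proof (intro nn_integral_mono)
        fix y
        have "H x * f x * (moll e (x - y) * g y) - f x * (moll e (x - y) * (H y * g y)) = moll e (x - y) * (f x * (H x - H y) * g y)"
          by (simp add: algebra_simps)
        then have "ennreal \<bar>H x * f x * (moll e (x - y) * g y) - f x * (moll e (x - y) * (H y * g y))\<bar>
          = ennreal (moll e (x - y)) * ennreal (\<bar>f x\<bar> * \<bar>H x - H y\<bar> * \<bar>g y\<bar>)"
          by (simp add: abs_mult moll_nonneg ennreal_mult)
        also have "\<dots> \<le> ennreal (c / e\<^sup>2) * near e x y * ennreal (\<bar>f x\<bar> * \<bar>H x - H y\<bar> * \<bar>g y\<bar>)"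
          by (intro mult_right_mono c e) simp
        finally show "ennreal \<bar>H x * f x * (moll e (x - y) * g y) - f x * (moll e (x - y) * (H y * g y))\<bar>
          \<le> ennreal (c / e\<^sup>2) * (ennreal (\<bar>f x\<bar> * \<bar>H x - H y\<bar> * \<bar>g y\<bar>) * near e x y)" by (simp add: mult_ac)
      qed
      also have "\<dots> = ennreal (c / e\<^sup>2) * ?k x" by (simp add: nn_integral_cmult)
      finally show "ennreal \<bar>H x * f x * convolution (moll e) g x - f x * convolution (moll e) (\<lambda>x. H x * g x) x\<bar> \<le> ennreal (c / e\<^sup>2) * ?k x" .
    qed
    also have "\<dots> = ennreal (c / e\<^sup>2) * (\<integral>\<^sup>+x. ?k x \<partial>lborel)" by (simp add: nn_integral_cmult)
    also have "\<dots> \<le> ennreal (c / e\<^sup>2) * ennreal (d / c * e\<^sup>2)" by (intro mult_left_mono e0 e) simp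
    also have "\<dots> = ennreal d" using c e d by (simp add: ennreal_mult[symmetric])
    finally show ?thesis using d by (simp add: ennreal_le_iff)
  qed
  then show "\<exists>e0>0. \<forall>e. 0 < e \<and> e < e0 \<longrightarrow>
    \<bar>(LINT x|lborel. H x * f x * convolution (moll e) g x) - (LINT x|lborel. H x * g x * convolution (moll e) f x) - 0\<bar> \<le> d" using e0(1) by blast
qed

section \<open>The Caccioppoli inequality\<close>

lemma test_functions_times_loc_L1:
  assumes "loc_L1 f" "\<phi> \<in> test_functions"
  shows "integrable lborel (\<lambda>x. f x * \<phi> x)"
proof -
  obtain R where R: "\<And>x. norm x > R \<Longrightarrow> \<phi> x = 0" using test_functions_support[OF assms(2)] by blast
  obtain B where B: "\<And>x. \<bar>\<phi> x\<bar> \<le> B" using test_functions_bounded[OF assms(2)] by blast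
  show ?thesis by (rule loc_L1_mult_integrable[OF assms(1) test_functions_borel[OF assms(2)] B R])
qed

lemma loc_L1_bounded:
  assumes [measurable]: "w \<in> borel_measurable borel" and B: "\<And>x. \<bar>w x\<bar> \<le> B"
  shows "loc_L1 w"
  unfolding loc_L1_def
proof (intro conjI allI)
  fix R
  show "integrable lborel (\<lambda>x. indicator (cball 0 R) x * w x)"
  proof (rule integrable_bounded_support[of _ B R])
    show "\<bar>indicator (cball 0 R) x * w x\<bar> \<le> B" for x using B[of x] by (auto simp: indicator_def)
    show "(\<lambda>x. indicator (cball 0 R) x * w x) \<in> borel_measurable borel" by measurable
  qed simp
qed (rule assms)

text \<open>The weak identity is tested with the function of y given by
  \<open>moll e (x - y) * \<eta> y\<close>. The product rule produces the derivative of the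
  mollifier, which is the derivative of the convolution, and a term in which the derivative falls on
  the cutoff.\<close>

lemma partial_deriv_weak_convolution:
  assumes w: "loc_L1 w" and g: "loc_L1 g"
    and weak: "\<And>\<phi>. \<phi> \<in> test_functions \<Longrightarrow> (LINT x|lborel. w x * partial_deriv i \<phi> x) = - (LINT x|lborel. g x * \<phi> x)"
    and \<eta>: "\<eta> \<in> test_functions" and e: "e > 0"
  shows "partial_deriv i (convolution (moll e) (\<lambda>y. w y * \<eta> y)) x =
    convolution (moll e) (\<lambda>y. g y * \<eta> y) x + convolution (moll e) (\<lambda>y. w y * partial_deriv i \<eta> y) x"
proof -
  note M = moll_test_functions[OF e] and d\<eta> = test_functions_partial_deriv[OF \<eta>, of i]
  have a: "integrable lborel (\<lambda>y. w y * \<eta> y)" "integrable lborel (\<lambda>y. g y * \<eta> y)" "integrable lborel (\<lambda>y. w y * partial_deriv i \<eta> y)"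
    by (intro test_functions_times_loc_L1 w g \<eta> d\<eta>)+
  let ?m = "\<lambda>y. moll e (x + (-1) *\<^sub>R y)"
  have m: "?m \<in> test_functions" by (intro test_functions_affine M) simp
  have \<phi>: "(\<lambda>y. ?m y * \<eta> y) \<in> test_functions"
    by (intro test_functions_mult m test_functions_C_k \<eta>)
  have dm: "partial_deriv i ?m y = - partial_deriv i (moll e) (x - y)" for y
    using partial_deriv_affine(1)[of "moll e" x "-1" y i, OF test_functions_differentiable[OF M]] by simp
  have d\<phi>: "partial_deriv i (\<lambda>y. ?m y * \<eta> y) y = moll e (x - y) * partial_deriv i \<eta> y - partial_deriv i (moll e) (x - y) * \<eta> y" for y
    using partial_deriv_mult[OF test_functions_differentiable[OF m] test_functions_differentiable[OF \<eta>], of i y] dm[of y] by simp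
  have I1: "integrable lborel (\<lambda>y. moll e (x - y) * (w y * partial_deriv i \<eta> y))"
    and I2: "integrable lborel (\<lambda>y. partial_deriv i (moll e) (x - y) * (w y * \<eta> y))"
    and I3: "integrable lborel (\<lambda>y. moll e (x - y) * (g y * \<eta> y))"
    by (intro convolution_integrable M a test_functions_partial_deriv)+
  have "(LINT y|lborel. w y * partial_deriv i (\<lambda>y. ?m y * \<eta> y) y) = - (LINT y|lborel. g y * (?m y * \<eta> y))"
    by (rule weak[OF \<phi>])
  moreover have "(LINT y|lborel. w y * partial_deriv i (\<lambda>y. ?m y * \<eta> y) y) =
    (LINT y|lborel. moll e (x - y) * (w y * partial_deriv i \<eta> y) - partial_deriv i (moll e) (x - y) * (w y * \<eta> y))"
    by (intro Bochner_Integration.integral_cong refl) (simp only: d\<phi>, simp add: algebra_simps)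
  moreover have "(LINT y|lborel. g y * (?m y * \<eta> y)) = (LINT y|lborel. moll e (x - y) * (g y * \<eta> y))"
    by (intro Bochner_Integration.integral_cong refl) (simp add: algebra_simps)
  ultimately have "(LINT y|lborel. moll e (x - y) * (w y * partial_deriv i \<eta> y)) - (LINT y|lborel. partial_deriv i (moll e) (x - y) * (w y * \<eta> y))
     = - (LINT y|lborel. moll e (x - y) * (g y * \<eta> y))"
    using Bochner_Integration.integral_diff[OF I1 I2] by simp
  then show ?thesis unfolding partial_deriv_convolution[OF M a(1)] unfolding convolution_def by linarith
qed

text \<open>The two weak identities are tested with \<open>partial_deriv 2 v\<close> and
  \<open>partial_deriv 1 v\<close>; the left sides coincide because mixed partials commute. This is
  what permits subtracting a constant from \<open>H\<close>.\<close>

lemma weak_curl_free: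
  assumes "\<And>\<phi>. \<phi> \<in> test_functions \<Longrightarrow> (LINT x|lborel. w x * partial_deriv 1 \<phi> x) = - (LINT x|lborel. g1 x * \<phi> x)"
    and "\<And>\<phi>. \<phi> \<in> test_functions \<Longrightarrow> (LINT x|lborel. w x * partial_deriv 2 \<phi> x) = - (LINT x|lborel. g2 x * \<phi> x)"
    and v: "v \<in> test_functions"
  shows "(LINT x|lborel. g2 x * partial_deriv 1 v x) = (LINT x|lborel. g1 x * partial_deriv 2 v x)"
  using assms(1)[OF test_functions_partial_deriv[OF v, of 2]] assms(2)[OF test_functions_partial_deriv[OF v, of 1]]
    mixed_partials_eq[OF test_functions_C_k[OF v], of 1 2] by simp

text \<open>The result is what formal testing with \<eta>^2 w would give: \<open>P1\<close>,
  \<open>P2\<close> are the components of the flux, \<open>Q\<close> its pairing with the gradient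
  of \<eta>, \<open>f1\<close>, \<open>f2\<close> those of \<eta> times the gradient of w, and
  \<open>b1\<close>, \<open>b2\<close> those of w times the gradient of \<eta>. In the limit
  \<open>H\<close> survives only next to derivatives of \<eta>.\<close>

lemma caccioppoli_identity_limit:
  assumes osc: "L2_oscillation H K" and wm: "w \<in> borel_measurable borel" and w: "\<And>x. 0 \<le> w x" "\<And>x. w x \<le> M"
    and g1: "loc_L2 g1" and g2: "loc_L2 g2"
    and weak1: "\<And>\<phi>. \<phi> \<in> test_functions \<Longrightarrow> (LINT x|lborel. w x * partial_deriv 1 \<phi> x) = - (LINT x|lborel. g1 x * \<phi> x)"
    and weak2: "\<And>\<phi>. \<phi> \<in> test_functions \<Longrightarrow> (LINT x|lborel. w x * partial_deriv 2 \<phi> x) = - (LINT x|lborel. g2 x * \<phi> x)"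
    and sub: "\<And>v. v \<in> test_functions \<Longrightarrow> (\<And>x. 0 \<le> v x) \<Longrightarrow>
      (LINT x|lborel. (g1 x + H x * g2 x) * partial_deriv 1 v x + (g2 x - H x * g1 x) * partial_deriv 2 v x) \<le> 0"
    and \<eta>: "\<eta> \<in> test_functions" "\<And>x. 0 \<le> \<eta> x"
  shows "(LINT x|lborel. (g1 x * \<eta> x)\<^sup>2) + (LINT x|lborel. (g2 x * \<eta> x)\<^sup>2) \<le>
    - 2 * (LINT x|lborel. (((g1 x + H x * g2 x) * partial_deriv 1 \<eta> x + (g2 x - H x * g1 x) * partial_deriv 2 \<eta> x) * (w x * \<eta> x)))"
proof -
  have H2: "loc_L2 H" by (rule L2_oscillation_imp_loc_L2[OF osc])
  note [measurable] = loc_L2_borel[OF g1] loc_L2_borel[OF g2] loc_L2_borel[OF H2] wm test_functions_borel[OF \<eta>(1)]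
    test_functions_borel[OF test_functions_partial_deriv[OF \<eta>(1)]]
  have wB: "\<bar>w x\<bar> \<le> M" for x using w[of x] by simp
  have w1: "loc_L1 w" by (rule loc_L1_bounded[OF wm wB])
  obtain R where R: "\<And>x. norm x > R \<Longrightarrow> \<eta> x = 0" using test_functions_support[OF \<eta>(1)] by blast
  obtain B where B: "\<And>x. \<bar>\<eta> x\<bar> \<le> B" using test_functions_bounded[OF \<eta>(1)] by blast
  note d\<eta> = test_functions_partial_deriv[OF \<eta>(1)]
  obtain B1 where B1: "\<And>x. \<bar>partial_deriv 1 \<eta> x\<bar> \<le> B1" using test_functions_bounded[OF d\<eta>] by blast
  obtain B2 where B2: "\<And>x. \<bar>partial_deriv 2 \<eta> x\<bar> \<le> B2" using test_functions_bounded[OF d\<eta>] by blast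
  define P1 where "P1 x = g1 x + H x * g2 x" for x
  define P2 where "P2 x = g2 x - H x * g1 x" for x
  have P: "loc_L1 P1" "loc_L1 P2" unfolding P1_def[abs_def] P2_def[abs_def]
    by (intro loc_L1_add loc_L1_diff loc_L2_mult loc_L2_imp_L1 g1 g2 H2)+
  define a where "a x = w x * \<eta> x" for x
  define f1 where "f1 x = g1 x * \<eta> x" for x
  define f2 where "f2 x = g2 x * \<eta> x" for x
  define b1 where "b1 x = w x * partial_deriv 1 \<eta> x" for x
  define b2 where "b2 x = w x * partial_deriv 2 \<eta> x" for x
  have int: "integrable lborel a" "integrable lborel b1" "integrable lborel b2" "integrable lborel f1" "integrable lborel f2"
    unfolding a_def[abs_def] b1_def[abs_def] b2_def[abs_def] f1_def[abs_def] f2_def[abs_def]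
    by (intro test_functions_times_loc_L1 w1 \<eta> d\<eta> loc_L2_imp_L1 g1 g2)+
  have [measurable]: "f1 \<in> borel_measurable borel" "f2 \<in> borel_measurable borel"
    using borel_measurable_integrable[OF int(4)] borel_measurable_integrable[OF int(5)] by simp_all
  have aB: "\<bar>a x\<bar> \<le> M * B" "\<bar>b1 x\<bar> \<le> M * B1" "\<bar>b2 x\<bar> \<le> M * B2" for x
    unfolding a_def b1_def b2_def abs_mult using wB[of x] B[of x] B1[of x] B2[of x] by (auto intro!: mult_mono)
  have \<eta>sq: "(\<lambda>x. \<eta> x * \<eta> x) \<in> test_functions" by (intro test_functions_mult \<eta> test_functions_C_k)
  have f_sq: "integrable lborel (\<lambda>x. (f1 x)\<^sup>2)" "integrable lborel (\<lambda>x. (f2 x)\<^sup>2)"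
    using test_functions_times_loc_L1[OF loc_L2_mult[OF g1 g1] \<eta>sq] test_functions_times_loc_L1[OF loc_L2_mult[OF g2 g2] \<eta>sq]
    by (simp_all add: f1_def f2_def power2_eq_square mult_ac)
  have Hf: "integrable lborel (\<lambda>x. H x * f1 x)" "integrable lborel (\<lambda>x. H x * f2 x)"
    using test_functions_times_loc_L1[OF loc_L2_mult[OF H2 g1] \<eta>(1)] test_functions_times_loc_L1[OF loc_L2_mult[OF H2 g2] \<eta>(1)]
    by (simp_all add: f1_def f2_def mult.assoc)
  define Q where "Q x = P1 x * partial_deriv 1 \<eta> x + P2 x * partial_deriv 2 \<eta> x" for x
  have Q: "integrable lborel Q" unfolding Q_def[abs_def]
    by (intro Bochner_Integration.integrable_add test_functions_times_loc_L1 P d\<eta>)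
  have P\<eta>: "integrable lborel (\<lambda>x. P1 x * \<eta> x)" "integrable lborel (\<lambda>x. P2 x * \<eta> x)"
    by (intro test_functions_times_loc_L1 P \<eta>)+
  \<comment> \<open>The expanded weak form, grouped by mode of convergence: three pairings of an
    integrable function with a bounded one, two L2 pairings, and one commutator whose two halves are
    kept together.\<close>
  define T where "T e = (LINT x|lborel. Q x * convolution (moll e) a x)
     + (LINT x|lborel. (P1 x * \<eta> x) * convolution (moll e) b1 x) + (LINT x|lborel. (P2 x * \<eta> x) * convolution (moll e) b2 x)
     + (LINT x|lborel. f1 x * convolution (moll e) f1 x) + (LINT x|lborel. f2 x * convolution (moll e) f2 x)
     + ((LINT x|lborel. H x * f2 x * convolution (moll e) f1 x) - (LINT x|lborel. H x * f1 x * convolution (moll e) f2 x))" for e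
  have T_le: "T e \<le> 0" if e: "e > 0" for e
  proof -
    let ?c = "convolution (moll e)"
    define v where "v x = \<eta> x * ?c a x" for x
    have Ca: "C_k k (?c a)" for k by (rule C_k_convolution[OF moll_test_functions[OF e] int(1)])
    have v: "v \<in> test_functions" unfolding v_def[abs_def] by (intro test_functions_mult \<eta> Ca)
    have "0 \<le> v x" for x
      unfolding v_def convolution_def a_def using w(1) \<eta>(2)
      by (intro mult_nonneg_nonneg Bochner_Integration.integral_nonneg moll_nonneg) auto
    from sub[OF v this]
    have le: "(LINT x|lborel. P1 x * partial_deriv 1 v x + P2 x * partial_deriv 2 v x) \<le> 0" by (simp add: P1_def P2_def)
    have da: "?c a differentiable (at x)" for x using Ca[of 1] by simp
    have dc: "partial_deriv 1 (?c a) x = ?c f1 x + ?c b1 x" "partial_deriv 2 (?c a) x = ?c f2 x + ?c b2 x" for x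
      unfolding a_def[abs_def] b1_def[abs_def] b2_def[abs_def] f1_def[abs_def] f2_def[abs_def]
      by (intro partial_deriv_weak_convolution weak1 weak2 \<eta> e w1 loc_L2_imp_L1 g1 g2; assumption)+
    have dv: "partial_deriv i v x = \<eta> x * partial_deriv i (?c a) x + partial_deriv i \<eta> x * ?c a x" for i x
      unfolding v_def[abs_def] by (rule partial_deriv_mult[OF test_functions_differentiable[OF \<eta>(1)] da])
    have "P1 x * partial_deriv 1 v x + P2 x * partial_deriv 2 v x = Q x * ?c a x + (P1 x * \<eta> x) * ?c b1 x + (P2 x * \<eta> x) * ?c b2 x
       + f1 x * ?c f1 x + f2 x * ?c f2 x + (H x * f2 x * ?c f1 x - H x * f1 x * ?c f2 x)" for x
      unfolding dv dc unfolding Q_def P1_def P2_def f1_def f2_def by (simp add: algebra_simps)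
    then have "(LINT x|lborel. P1 x * partial_deriv 1 v x + P2 x * partial_deriv 2 v x) =
      (LINT x|lborel. Q x * ?c a x + (P1 x * \<eta> x) * ?c b1 x + (P2 x * \<eta> x) * ?c b2 x
       + f1 x * ?c f1 x + f2 x * ?c f2 x + (H x * f2 x * ?c f1 x - H x * f1 x * ?c f2 x))" by simp
    also have "\<dots> = T e"
      unfolding T_def
      using integrable_mult_convolution[OF e Q int(1)] integrable_mult_convolution[OF e P\<eta>(1) int(2)]
        integrable_mult_convolution[OF e P\<eta>(2) int(3)] integrable_mult_convolution[OF e int(4) int(4)]
        integrable_mult_convolution[OF e int(5) int(5)] integrable_mult_convolution[OF e Hf(2) int(4)]
        integrable_mult_convolution[OF e Hf(1) int(5)]
      by (simp add: Bochner_Integration.integral_add Bochner_Integration.integral_diff)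
    finally show ?thesis using le by simp
  qed
  define L where "L = (LINT x|lborel. Q x * a x) + (LINT x|lborel. (P1 x * \<eta> x) * b1 x) + (LINT x|lborel. (P2 x * \<eta> x) * b2 x)
     + (LINT x|lborel. f1 x * f1 x) + (LINT x|lborel. f2 x * f2 x) + 0"
  have suppf: "norm x > R \<Longrightarrow> f1 x = 0" "norm x > R \<Longrightarrow> f2 x = 0" for x using R by (simp_all add: f1_def f2_def)
  have "(T \<longlongrightarrow> L) (at_right 0)"
    unfolding T_def[abs_def] L_def
    by (intro tendsto_add convolution_moll_tendsto_bounded[OF Q int(1) aB(1)] convolution_moll_tendsto_bounded[OF P\<eta>(1) int(2) aB(2)]
      convolution_moll_tendsto_bounded[OF P\<eta>(2) int(3) aB(3)] convolution_moll_tendsto_L2 int f_sq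
      convolution_commutator_tendsto_0[OF osc _ _ f_sq(2,1) int(5,4) suppf(2,1) Hf(2,1)]) auto
  moreover have "\<forall>\<^sub>F e in at_right 0. T e \<le> 0"
    using eventually_at_right_less[of 0] by (rule eventually_mono) (rule T_le)
  ultimately have L: "L \<le> 0" by (rule tendsto_upperbound) simp
  have I: "integrable lborel (\<lambda>x. P1 x * partial_deriv 1 \<eta> x * a x)" "integrable lborel (\<lambda>x. P2 x * partial_deriv 2 \<eta> x * a x)"
    using aB(1) borel_measurable_integrable[OF int(1)]
    by (intro integrable_mult_bounded[where B = "M * B"] test_functions_times_loc_L1 P d\<eta>; simp)+
  have e1: "(LINT x|lborel. (P1 x * \<eta> x) * b1 x) = (LINT x|lborel. P1 x * partial_deriv 1 \<eta> x * a x)"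
    and e2: "(LINT x|lborel. (P2 x * \<eta> x) * b2 x) = (LINT x|lborel. P2 x * partial_deriv 2 \<eta> x * a x)"
    by (intro Bochner_Integration.integral_cong refl; simp add: a_def b1_def b2_def mult_ac)+
  have e3: "(LINT x|lborel. Q x * a x) = (LINT x|lborel. P1 x * partial_deriv 1 \<eta> x * a x) + (LINT x|lborel. P2 x * partial_deriv 2 \<eta> x * a x)"
    unfolding Q_def distrib_right by (rule Bochner_Integration.integral_add[OF I])
  have "(LINT x|lborel. f1 x * f1 x) + (LINT x|lborel. f2 x * f2 x) \<le> - 2 * (LINT x|lborel. Q x * a x)"
  proof -
    \<comment> \<open>Each derivative term occurs twice, once from the outer cutoff and once from
      the cutoff under the convolution; this is the factor 2 of the Caccioppoli inequality.\<close>
    have *: "C + D \<le> - 2 * (A + B)" if "A + B + A + B + C + D + 0 \<le> 0" for A B C D :: real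
      using that by (simp add: algebra_simps)
    show ?thesis using L unfolding L_def e1 e2 e3 by (rule *)
  qed
  then show ?thesis unfolding Q_def P1_def P2_def f1_def f2_def a_def by (simp add: power2_eq_square)
qed

text \<open>\<Lambda> depends neither on R nor on \<tau>, and \<eta> does not depend on \<tau>, so
  later one may absorb with a small \<tau> or let \<tau> grow. Only the part of the energy with R
  \<le> |x| appears on the right because the gradient of \<eta> lives on an annulus.\<close>

lemma energy_inequality:
  assumes osc: "L2_oscillation H K" and wm: "w \<in> borel_measurable borel" and w: "\<And>x. 0 \<le> w x" "\<And>x. w x \<le> M"
    and g1: "loc_L2 g1" and g2: "loc_L2 g2"
    and weak1: "\<And>\<phi>. \<phi> \<in> test_functions \<Longrightarrow> (LINT x|lborel. w x * partial_deriv 1 \<phi> x) = - (LINT x|lborel. g1 x * \<phi> x)"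
    and weak2: "\<And>\<phi>. \<phi> \<in> test_functions \<Longrightarrow> (LINT x|lborel. w x * partial_deriv 2 \<phi> x) = - (LINT x|lborel. g2 x * \<phi> x)"
    and sub: "\<And>v. v \<in> test_functions \<Longrightarrow> (\<And>x. 0 \<le> v x) \<Longrightarrow>
      (LINT x|lborel. (g1 x + H x * g2 x) * partial_deriv 1 v x + (g2 x - H x * g1 x) * partial_deriv 2 v x) \<le> 0"
  shows "\<exists>\<Lambda>\<ge>0. \<forall>R>0. \<exists>\<eta>\<in>test_functions. (\<forall>x. 0 \<le> \<eta> x \<and> \<eta> x \<le> 1) \<and>
    (\<forall>x. norm x \<le> R \<longrightarrow> \<eta> x = 1) \<and> (\<forall>\<tau>>0. (LINT x|lborel. (g1 x * \<eta> x)\<^sup>2 + (g2 x * \<eta> x)\<^sup>2) \<le>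
      2 * \<tau> * (LINT x|lborel. indicator {x. R \<le> norm x} x * ((g1 x * \<eta> x)\<^sup>2 + (g2 x * \<eta> x)\<^sup>2)) + \<Lambda> / \<tau>)"
proof -
  have K: "K \<ge> 0" using osc by (simp add: L2_oscillation_def)
  have H2: "loc_L2 H" by (rule L2_oscillation_imp_loc_L2[OF osc])
  note [measurable] = loc_L2_borel[OF g1] loc_L2_borel[OF g2] loc_L2_borel[OF H2] wm
  have M0: "M \<ge> 0" using w[of 0] by linarith
  obtain C where C: "C > 0" "\<And>R. R > 0 \<Longrightarrow> \<exists>\<eta>\<in>test_functions. (\<forall>x. 0 \<le> \<eta> x \<and> \<eta> x \<le> 1) \<and>
    (\<forall>x. norm x \<le> R \<longrightarrow> \<eta> x = 1) \<and> (\<forall>x. norm x > 2 * R \<longrightarrow> \<eta> x = 0) \<and>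
    (\<forall>x i. \<bar>partial_deriv i \<eta> x\<bar> \<le> C / R)" using cutoff_functions by blast
  \<comment> \<open>\<open>8 * M\<^sup>2 * C\<^sup>2\<close> comes from the weighted Young
    inequality and the gradient bound \<open>C / R\<close>. The last factor times R^2 bounds the
    integral of \<open>1 + (H x - h)\<^sup>2\<close>: \<open>4 * pi\<close> is the area of the disc
    of radius 2R, \<open>9 * K\<close> the oscillation at radius 3R.\<close>
  define \<Lambda> where "\<Lambda> = 8 * M\<^sup>2 * C\<^sup>2 * (4 * pi + 9 * K)"
  have "\<Lambda> \<ge> 0" using K by (simp add: \<Lambda>_def)
  moreover have "\<exists>\<eta>\<in>test_functions. (\<forall>x. 0 \<le> \<eta> x \<and> \<eta> x \<le> 1) \<and>
    (\<forall>x. norm x \<le> R \<longrightarrow> \<eta> x = 1) \<and> (\<forall>\<tau>>0. (LINT x|lborel. (g1 x * \<eta> x)\<^sup>2 + (g2 x * \<eta> x)\<^sup>2) \<le>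
      2 * \<tau> * (LINT x|lborel. indicator {x. R \<le> norm x} x * ((g1 x * \<eta> x)\<^sup>2 + (g2 x * \<eta> x)\<^sup>2)) + \<Lambda> / \<tau>)" if R: "R > 0" for R
  proof -
    from C(2)[OF R] obtain \<eta> where \<eta>_all: "\<eta> \<in> test_functions" "\<forall>x. 0 \<le> \<eta> x \<and> \<eta> x \<le> 1"
      "\<forall>x. norm x \<le> R \<longrightarrow> \<eta> x = 1" "\<forall>x. norm x > 2 * R \<longrightarrow> \<eta> x = 0" "\<forall>x i. \<bar>partial_deriv i \<eta> x\<bar> \<le> C / R"
      by (elim bexE conjE)
    then have \<eta>: "\<eta> \<in> test_functions" "\<And>x. 0 \<le> \<eta> x" "\<And>x. \<eta> x \<le> 1" "\<And>x. norm x \<le> R \<Longrightarrow> \<eta> x = 1"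
      "\<And>x. norm x > 2 * R \<Longrightarrow> \<eta> x = 0" "\<And>x i. \<bar>partial_deriv i \<eta> x\<bar> \<le> C / R" by simp_all
    note d\<eta> = test_functions_partial_deriv[OF \<eta>(1)]
    note [measurable] = test_functions_borel[OF \<eta>(1)] test_functions_borel[OF d\<eta>]
    have d0: "partial_deriv i \<eta> x = 0" if "norm x < R" for i x
    proof -
      have "open {x::real^2. norm x < R}" by (intro open_Collect_less continuous_intros)
      then have "(\<eta> has_derivative (\<lambda>h. 0)) (at x)"
        using that \<eta>(4) by (intro has_derivative_transform_within_open[of "\<lambda>x. 1" "\<lambda>h. 0" x UNIV "{x. norm x < R}" \<eta>, simplified]) auto
      then show ?thesis by (rule partial_deriv_eqI)
    qed
    have d1: "partial_deriv i \<eta> x = 0" if "norm x > 2 * R" for i x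
      using partial_deriv_eq_0_outside[of "2 * R" \<eta>] \<eta>(5) that by blast
    \<comment> \<open>\<open>near\<close> describes an open ball, so its radius must exceed that of
      the closed ball of radius \<open>2 * R\<close> supporting \<eta>.\<close>
    have "3 * R > 0" using R by simp
    then obtain h where h: "(\<integral>\<^sup>+x. ennreal ((H x - h)\<^sup>2) * near (3 * R) 0 x \<partial>lborel) \<le> ennreal (K * (3 * R)\<^sup>2)"
      using osc unfolding L2_oscillation_def by blast
    define P1 where "P1 x = g1 x + (H x - h) * g2 x" for x
    define P2 where "P2 x = g2 x - (H x - h) * g1 x" for x
    have osc': "L2_oscillation (\<lambda>x. H x - h) K" by (rule L2_oscillation_shift[OF osc])
    note Hh2 = L2_oscillation_imp_loc_L2[OF osc']
    have P: "loc_L1 P1" "loc_L1 P2" unfolding P1_def[abs_def] P2_def[abs_def]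
      by (intro loc_L1_add loc_L1_diff loc_L2_mult[OF Hh2] loc_L2_imp_L1 g1 g2)+
    have sub': "(LINT x|lborel. (g1 x + (H x - h) * g2 x) * partial_deriv 1 v x + (g2 x - (H x - h) * g1 x) * partial_deriv 2 v x) \<le> 0"
      if v: "v \<in> test_functions" "\<And>x. 0 \<le> v x" for v
    proof -
      note dv = test_functions_partial_deriv[OF v(1)]
      have I: "integrable lborel (\<lambda>x. (g1 x + H x * g2 x) * partial_deriv 1 v x + (g2 x - H x * g1 x) * partial_deriv 2 v x)"
        by (intro Bochner_Integration.integrable_add test_functions_times_loc_L1 dv loc_L1_add loc_L1_diff loc_L2_mult H2 loc_L2_imp_L1 g1 g2)
      have J: "integrable lborel (\<lambda>x. g2 x * partial_deriv 1 v x)" "integrable lborel (\<lambda>x. g1 x * partial_deriv 2 v x)"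
        by (intro test_functions_times_loc_L1 dv loc_L2_imp_L1 g1 g2)+
      have J': "integrable lborel (\<lambda>x. h * (g2 x * partial_deriv 1 v x - g1 x * partial_deriv 2 v x))"
        using J by simp
      have Z0: "(LINT x|lborel. h * (g2 x * partial_deriv 1 v x - g1 x * partial_deriv 2 v x)) = 0"
        using J weak_curl_free[OF weak1 weak2 v(1)] by simp
      have pe: "(g1 x + (H x - h) * g2 x) * partial_deriv 1 v x + (g2 x - (H x - h) * g1 x) * partial_deriv 2 v x =
        ((g1 x + H x * g2 x) * partial_deriv 1 v x + (g2 x - H x * g1 x) * partial_deriv 2 v x) - h * (g2 x * partial_deriv 1 v x - g1 x * partial_deriv 2 v x)" for x
        by (simp add: algebra_simps)
      show ?thesis unfolding pe Bochner_Integration.integral_diff[OF I J'] Z0 using sub[OF v] by simp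
    qed
    define E where "E x = (g1 x * \<eta> x)\<^sup>2 + (g2 x * \<eta> x)\<^sup>2" for x
    have \<eta>sq: "(\<lambda>x. \<eta> x * \<eta> x) \<in> test_functions" by (intro test_functions_mult \<eta> test_functions_C_k)
    have E1: "integrable lborel (\<lambda>x. (g1 x * \<eta> x)\<^sup>2)" and E2: "integrable lborel (\<lambda>x. (g2 x * \<eta> x)\<^sup>2)"
      using test_functions_times_loc_L1[OF loc_L2_mult[OF g1 g1] \<eta>sq] test_functions_times_loc_L1[OF loc_L2_mult[OF g2 g2] \<eta>sq]
      by (simp_all add: power2_eq_square mult_ac)
    have EI: "integrable lborel E" unfolding E_def[abs_def] by (intro Bochner_Integration.integrable_add E1 E2)
    have E0: "E x \<ge> 0" for x by (simp add: E_def)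
    have [measurable]: "E \<in> borel_measurable borel" using borel_measurable_integrable[OF EI] by simp
    have ann[measurable]: "{x::real^2. R \<le> norm x} \<in> sets borel" by measurable
    have EA: "integrable lborel (\<lambda>x. indicator {x. R \<le> norm x} x * E x)"
    proof -
      have "integrable lborel (\<lambda>x. E x * indicator {x. R \<le> norm x} x)"
      proof (rule integrable_mult_bounded[OF EI])
        show "indicator {x::real^2. R \<le> norm x} \<in> borel_measurable (lborel :: (real^2) measure)" by measurable
        show "\<bar>indicator {x. R \<le> norm x} x :: real\<bar> \<le> 1" for x :: "real^2" by (auto simp: indicator_def)
      qed
      then show ?thesis by (simp add: mult.commute)
    qed
    have cac: "(LINT x|lborel. E x) \<le> - 2 * (LINT x|lborel. (P1 x * partial_deriv 1 \<eta> x + P2 x * partial_deriv 2 \<eta> x) * (w x * \<eta> x))"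
      unfolding E_def P1_def P2_def Bochner_Integration.integral_add[OF E1 E2]
      by (rule caccioppoli_identity_limit[OF osc' wm w g1 g2 weak1 weak2 sub' \<eta>(1,2)])
    have wB: "\<bar>w x * \<eta> x\<bar> \<le> M" for x
      using mult_mono[of "w x" M "\<eta> x" 1] w[of x] \<eta>(2,3)[of x] M0 by (simp add: abs_mult)
    have QI: "integrable lborel (\<lambda>x. (P1 x * partial_deriv 1 \<eta> x + P2 x * partial_deriv 2 \<eta> x) * (w x * \<eta> x))"
      by (rule integrable_mult_bounded[OF _ _ wB])
         (intro Bochner_Integration.integrable_add test_functions_times_loc_L1 P d\<eta>, measurable)
    define Z where "Z x = indicator (cball 0 (2 * R)) x * (1 + (H x - h)\<^sup>2)" for x
    have Zint: "integrable lborel Z" and Zle: "(LINT x|lborel. Z x) \<le> (4 * pi + 9 * K) * R\<^sup>2"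
    proof -
      have [measurable]: "Z \<in> borel_measurable borel" unfolding Z_def[abs_def] by measurable
      have Z0: "Z x \<ge> 0" for x by (simp add: Z_def)
      have "(\<integral>\<^sup>+x. ennreal (Z x) \<partial>lborel) \<le> (\<integral>\<^sup>+x. indicator (cball 0 (2 * R)) x + ennreal ((H x - h)\<^sup>2) * near (3 * R) 0 x \<partial>lborel)"
      proof (intro nn_integral_mono)
        fix x
        show "ennreal (Z x) \<le> indicator (cball 0 (2 * R)) x + ennreal ((H x - h)\<^sup>2) * near (3 * R) 0 x"
          using R by (cases "norm x \<le> 2 * R") (auto simp: Z_def near_def ennreal_plus)
      qed
      also have "\<dots> = ennreal (pi * (2 * R)\<^sup>2) + (\<integral>\<^sup>+x. ennreal ((H x - h)\<^sup>2) * near (3 * R) 0 x \<partial>lborel)"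
        using R area_cball[of "2 * R" 0] by (subst nn_integral_add) auto
      also have "\<dots> \<le> ennreal (pi * (2 * R)\<^sup>2) + ennreal (K * (3 * R)\<^sup>2)" by (intro add_left_mono h)
      also have "\<dots> = ennreal ((4 * pi + 9 * K) * R\<^sup>2)"
        using K by (simp add: ennreal_plus[symmetric] power_mult_distrib algebra_simps del: ennreal_plus)
      finally have *: "(\<integral>\<^sup>+x. ennreal (Z x) \<partial>lborel) \<le> ennreal ((4 * pi + 9 * K) * R\<^sup>2)" .
      then have "(\<integral>\<^sup>+x. ennreal (norm (Z x)) \<partial>lborel) < \<infinity>"
        using Z0 order_le_less_trans[OF * ennreal_less_top] by simp
      then show I: "integrable lborel Z" by (intro integrableI_bounded) auto
      have "ennreal (LINT x|lborel. Z x) \<le> ennreal ((4 * pi + 9 * K) * R\<^sup>2)"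
        using * nn_integral_eq_integral[OF I] Z0 by simp
      then show "(LINT x|lborel. Z x) \<le> (4 * pi + 9 * K) * R\<^sup>2" using K by (subst (asm) ennreal_le_iff) auto
    qed
    have main: "(LINT x|lborel. E x) \<le> 2 * \<tau> * (LINT x|lborel. indicator {x. R \<le> norm x} x * E x) + \<Lambda> / \<tau>" if \<tau>: "\<tau> > 0" for \<tau>
    proof -
      let ?q = "\<lambda>x. (P1 x * partial_deriv 1 \<eta> x + P2 x * partial_deriv 2 \<eta> x) * (w x * \<eta> x)"
      let ?k = "8 * M\<^sup>2 * (C / R)\<^sup>2 / \<tau>"
      have double_neg: "- 2 * p \<le> 2 * B" if "\<bar>p\<bar> \<le> B" for p B :: real
        using that by (simp add: abs_le_iff)
      \<comment> \<open>On the annulus this is X Y \<le> \<tau> X^2 + Y^2 / \<tau>, with the size of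
        \<eta> times the gradient in X and everything else in Y; elsewhere the left side is
        0.\<close>
      have pt: "- 2 * ?q x \<le> 2 * \<tau> * (indicator {x. R \<le> norm x} x * E x) + ?k * Z x" for x
      proof (cases "R \<le> norm x \<and> norm x \<le> 2 * R")
        case True
        define A where "A = \<bar>g1 x\<bar> + \<bar>g2 x\<bar>"
        define c where "c = C / R"
        have c0: "c \<ge> 0" using C(1) R by (simp add: c_def)
        let ?t = "\<bar>H x - h\<bar>"
        have "\<bar>P1 x\<bar> \<le> \<bar>g1 x\<bar> + ?t * \<bar>g2 x\<bar>"
          unfolding P1_def using abs_triangle_ineq[of "g1 x" "(H x - h) * g2 x"] by (simp add: abs_mult)
        moreover have "\<bar>P2 x\<bar> \<le> \<bar>g2 x\<bar> + ?t * \<bar>g1 x\<bar>"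
          unfolding P2_def using abs_triangle_ineq4[of "g2 x" "(H x - h) * g1 x"] by (simp add: abs_mult)
        ultimately have PP: "\<bar>P1 x\<bar> + \<bar>P2 x\<bar> \<le> (1 + ?t) * A" by (simp add: A_def algebra_simps)
        have "\<bar>P1 x * partial_deriv 1 \<eta> x + P2 x * partial_deriv 2 \<eta> x\<bar> \<le> \<bar>P1 x\<bar> * c + \<bar>P2 x\<bar> * c"
          using abs_triangle_ineq[of "P1 x * partial_deriv 1 \<eta> x" "P2 x * partial_deriv 2 \<eta> x"]
            mult_left_mono[OF \<eta>(6)[of 1 x], of "\<bar>P1 x\<bar>"] mult_left_mono[OF \<eta>(6)[of 2 x], of "\<bar>P2 x\<bar>"]
          by (simp add: abs_mult c_def)
        also have "\<dots> \<le> (1 + ?t) * A * c" unfolding distrib_right[symmetric] by (intro mult_right_mono PP c0)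
        finally have "\<bar>P1 x * partial_deriv 1 \<eta> x + P2 x * partial_deriv 2 \<eta> x\<bar> * \<bar>w x * \<eta> x\<bar> \<le> ((1 + ?t) * A * c) * (M * \<eta> x)"
          using w[of x] \<eta>(2)[of x] c0 by (intro mult_mono) (auto simp: abs_mult A_def intro!: mult_right_mono mult_nonneg_nonneg)
        then have "\<bar>?q x\<bar> \<le> ((1 + ?t) * A * c) * (M * \<eta> x)" by (simp only: abs_mult[of _ "w x * \<eta> x"])
        then have 1: "- 2 * ?q x \<le> 2 * (((1 + ?t) * A * c) * (M * \<eta> x))" by (rule double_neg)
        define X where "X = A * \<eta> x"
        define Y where "Y = 2 * M * c * (1 + ?t)"
        have 2: "2 * (((1 + ?t) * A * c) * (M * \<eta> x)) = X * Y" by (simp add: X_def Y_def)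
        have 3: "X * Y \<le> \<tau> * X\<^sup>2 + Y\<^sup>2 / \<tau>"
        proof -
          have "0 \<le> (\<tau> * X - Y)\<^sup>2" by simp
          then have "2 * (\<tau> * (X * Y)) \<le> \<tau> * (\<tau> * X\<^sup>2) + Y\<^sup>2" by (simp add: power2_diff power_mult_distrib power2_eq_square[of \<tau>] mult_ac)
          moreover have "0 \<le> \<tau> * (X * Y)" using \<tau> M0 c0 \<eta>(2)[of x] by (simp add: X_def Y_def A_def)
          ultimately have "\<tau> * (X * Y) \<le> \<tau> * (\<tau> * X\<^sup>2) + Y\<^sup>2" by linarith
          then have "\<tau> * (X * Y) / \<tau> \<le> (\<tau> * (\<tau> * X\<^sup>2) + Y\<^sup>2) / \<tau>" using \<tau> by (intro divide_right_mono) auto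
          then show ?thesis using \<tau> by (simp add: add_divide_distrib)
        qed
        have 4: "\<tau> * X\<^sup>2 \<le> \<tau> * (2 * E x)"
        proof (intro mult_left_mono)
          have "A\<^sup>2 \<le> 2 * ((g1 x)\<^sup>2 + (g2 x)\<^sup>2)"
            using sum_squares_bound[of "\<bar>g1 x\<bar>" "\<bar>g2 x\<bar>"] by (simp add: A_def power2_sum)
          from mult_right_mono[OF this, of "(\<eta> x)\<^sup>2"]
          show "X\<^sup>2 \<le> 2 * E x" by (simp add: X_def E_def power_mult_distrib algebra_simps)
        qed (use \<tau> in simp)
        have 5: "Y\<^sup>2 / \<tau> \<le> ?k * Z x"
        proof -
          have "(1 + ?t)\<^sup>2 \<le> 2 * (1 + (H x - h)\<^sup>2)" using sum_squares_bound[of 1 ?t] by (simp add: power2_sum)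
          from mult_left_mono[OF this, of "(2 * M * c)\<^sup>2 / \<tau>"]
          have le: "(2 * M * c)\<^sup>2 / \<tau> * (1 + ?t)\<^sup>2 \<le> (2 * M * c)\<^sup>2 / \<tau> * (2 * (1 + (H x - h)\<^sup>2))" using \<tau> by simp
          have "Y\<^sup>2 / \<tau> = (2 * M * c)\<^sup>2 / \<tau> * (1 + ?t)\<^sup>2" unfolding Y_def power_mult_distrib[of "2 * M * c"] by simp
          also note le
          also have "(2 * M * c)\<^sup>2 / \<tau> * (2 * (1 + (H x - h)\<^sup>2)) = ?k * (1 + (H x - h)\<^sup>2)"
            unfolding c_def[symmetric] power_mult_distrib by simp
          also have "1 + (H x - h)\<^sup>2 = Z x" using True by (simp add: Z_def)
          finally show ?thesis .
        qed
        note 1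
        also note 2
        also note 3
        also note add_mono[OF 4 5]
        also have "\<tau> * (2 * E x) = 2 * \<tau> * (indicator {x. R \<le> norm x} x * E x)" using True by simp
        finally show ?thesis .
      next
        case False
        then have "?q x = 0" using d0[of x] d1[of x] by force
        moreover have "0 \<le> 2 * \<tau> * (indicator {x. R \<le> norm x} x * E x)" using \<tau> E0[of x] by simp
        moreover have "0 \<le> ?k * Z x" using \<tau> by (simp add: Z_def)
        ultimately show ?thesis by linarith
      qed
      have "(LINT x|lborel. E x) \<le> (LINT x|lborel. - 2 * ?q x)" using cac by simp
      also have "\<dots> \<le> (LINT x|lborel. 2 * \<tau> * (indicator {x. R \<le> norm x} x * E x) + ?k * Z x)"
        by (intro Bochner_Integration.integral_mono pt integrable_mult_right QI Bochner_Integration.integrable_add EA Zint)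
      also have "\<dots> = 2 * \<tau> * (LINT x|lborel. indicator {x. R \<le> norm x} x * E x) + ?k * (LINT x|lborel. Z x)"
        using EA Zint by (subst Bochner_Integration.integral_add) auto
      also have "?k * (LINT x|lborel. Z x) \<le> ?k * ((4 * pi + 9 * K) * R\<^sup>2)"
        using \<tau> by (intro mult_left_mono Zle) auto
      also have "?k * ((4 * pi + 9 * K) * R\<^sup>2) = \<Lambda> / \<tau>" using R by (simp add: \<Lambda>_def power_divide)
      finally show ?thesis by simp
    qed
    show ?thesis using \<eta>(1-4) main unfolding E_def by (intro bexI[of _ \<eta>]) auto
  qed
  ultimately show ?thesis by blast
qed

section \<open>The Liouville theorem\<close>

text \<open>The energy inequality is used twice: with \<tau> = 1/4 to see that the total energy is
  finite, and then with arbitrary \<tau> as R tends to infinity. Finiteness is what makes the tail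
  vanish in this limit.\<close>

lemma gradient_AE_zero:
  assumes osc: "L2_oscillation H K" and wm: "w \<in> borel_measurable borel" and w: "\<And>x. 0 \<le> w x" "\<And>x. w x \<le> M"
    and g1: "loc_L2 g1" and g2: "loc_L2 g2"
    and weak1: "\<And>\<phi>. \<phi> \<in> test_functions \<Longrightarrow> (LINT x|lborel. w x * partial_deriv 1 \<phi> x) = - (LINT x|lborel. g1 x * \<phi> x)"
    and weak2: "\<And>\<phi>. \<phi> \<in> test_functions \<Longrightarrow> (LINT x|lborel. w x * partial_deriv 2 \<phi> x) = - (LINT x|lborel. g2 x * \<phi> x)"
    and sub: "\<And>v. v \<in> test_functions \<Longrightarrow> (\<And>x. 0 \<le> v x) \<Longrightarrow>
      (LINT x|lborel. (g1 x + H x * g2 x) * partial_deriv 1 v x + (g2 x - H x * g1 x) * partial_deriv 2 v x) \<le> 0"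
  shows "AE x in lborel. g1 x = 0 \<and> g2 x = 0"
proof -
  note [measurable] = loc_L2_borel[OF g1] loc_L2_borel[OF g2]
  have "\<exists>\<Lambda>\<ge>0. \<forall>R>0. \<exists>\<eta>\<in>test_functions. (\<forall>x. 0 \<le> \<eta> x \<and> \<eta> x \<le> 1) \<and>
    (\<forall>x. norm x \<le> R \<longrightarrow> \<eta> x = 1) \<and> (\<forall>\<tau>>0. (LINT x|lborel. (g1 x * \<eta> x)\<^sup>2 + (g2 x * \<eta> x)\<^sup>2) \<le>
      2 * \<tau> * (LINT x|lborel. indicator {x. R \<le> norm x} x * ((g1 x * \<eta> x)\<^sup>2 + (g2 x * \<eta> x)\<^sup>2)) + \<Lambda> / \<tau>)"
    by (rule energy_inequality[OF osc wm w g1 g2 weak1 weak2 sub])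
  then obtain \<Lambda> where \<Lambda>: "\<Lambda> \<ge> 0" and en': "\<forall>R>0. \<exists>\<eta>\<in>test_functions. (\<forall>x. 0 \<le> \<eta> x \<and> \<eta> x \<le> 1) \<and>
    (\<forall>x. norm x \<le> R \<longrightarrow> \<eta> x = 1) \<and> (\<forall>\<tau>>0. (LINT x|lborel. (g1 x * \<eta> x)\<^sup>2 + (g2 x * \<eta> x)\<^sup>2) \<le>
      2 * \<tau> * (LINT x|lborel. indicator {x. R \<le> norm x} x * ((g1 x * \<eta> x)\<^sup>2 + (g2 x * \<eta> x)\<^sup>2)) + \<Lambda> / \<tau>)"
    by (elim exE conjE)
  define e where "e x = (g1 x)\<^sup>2 + (g2 x)\<^sup>2" for x
  have e0: "e x \<ge> 0" for x by (simp add: e_def)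
  have em[measurable]: "e \<in> borel_measurable borel" unfolding e_def[abs_def] by measurable
  have tail_m[measurable]: "{x::real^2. R \<le> norm x} \<in> sets borel" for R by measurable
  have eloc: "integrable lborel (\<lambda>x. indicator (cball 0 R) x * e x)" for R
    using g1 g2 by (simp add: e_def loc_L2_def distrib_left)
  \<comment> \<open>\<open>E\<close> is the density times the squared cutoff. Hiding the cutoff
    leaves only what is used: \<open>E\<close> lies between 0 and \<open>e\<close> and equals
    \<open>e\<close> on the ball of radius \<open>R\<close>.\<close>
  have step: "\<exists>E. integrable lborel E \<and> (\<forall>x. 0 \<le> E x \<and> E x \<le> e x \<and> (norm x \<le> R \<longrightarrow> E x = e x)) \<and>
     (\<forall>\<tau>>0. (LINT x|lborel. E x) \<le> 2 * \<tau> * (LINT x|lborel. indicator {x. R \<le> norm x} x * E x) + \<Lambda> / \<tau>)" if R: "R > 0" for R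
  proof -
    from en'[THEN spec, THEN mp, OF R] obtain \<eta> where \<eta>: "\<eta> \<in> test_functions" "\<forall>x. 0 \<le> \<eta> x \<and> \<eta> x \<le> 1" "\<forall>x. norm x \<le> R \<longrightarrow> \<eta> x = 1"
      and le: "\<forall>\<tau>>0. (LINT x|lborel. (g1 x * \<eta> x)\<^sup>2 + (g2 x * \<eta> x)\<^sup>2) \<le>
      2 * \<tau> * (LINT x|lborel. indicator {x. R \<le> norm x} x * ((g1 x * \<eta> x)\<^sup>2 + (g2 x * \<eta> x)\<^sup>2)) + \<Lambda> / \<tau>"
      by (elim bexE conjE)
    have eq: "(g1 x * \<eta> x)\<^sup>2 + (g2 x * \<eta> x)\<^sup>2 = e x * (\<eta> x)\<^sup>2" for x
      by (simp add: e_def power_mult_distrib distrib_right)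
    have \<eta>sq: "(\<lambda>x. \<eta> x * \<eta> x) \<in> test_functions" by (intro test_functions_mult \<eta> test_functions_C_k)
    have "loc_L1 e" using eloc em by (simp add: loc_L1_def)
    from test_functions_times_loc_L1[OF this \<eta>sq] have "integrable lborel (\<lambda>x. e x * (\<eta> x)\<^sup>2)" by (simp add: power2_eq_square)
    moreover have "e x * (\<eta> x)\<^sup>2 \<le> e x" for x
      using mult_left_mono[of "(\<eta> x)\<^sup>2" 1 "e x"] e0[of x] \<eta>(2) by (simp add: power_le_one)
    ultimately show ?thesis using le \<eta>(3) e0 unfolding eq by (intro exI[of _ "\<lambda>x. e x * (\<eta> x)\<^sup>2"]) auto
  qed
  have bound: "(LINT x|lborel. indicator (cball 0 R) x * e x) \<le> 8 * \<Lambda>" if "R > 0" for R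
  proof -
    from step[OF that] obtain E where E: "integrable lborel E" "\<forall>x. 0 \<le> E x \<and> E x \<le> e x \<and> (norm x \<le> R \<longrightarrow> E x = e x)"
      and le: "\<forall>\<tau>>0. (LINT x|lborel. E x) \<le> 2 * \<tau> * (LINT x|lborel. indicator {x. R \<le> norm x} x * E x) + \<Lambda> / \<tau>"
      by (elim exE conjE)
    have "(LINT x|lborel. indicator {x. R \<le> norm x} x * E x) \<le> (LINT x|lborel. E x)"
      using E e0 by (intro integral_mono_AE') (auto simp: indicator_def)
    \<comment> \<open>At this weight half of the energy reappears on the right and is absorbed,
      since it is finite for each \<open>R\<close>; what remains is 2 * 4 * \<Lambda>.\<close>
    moreover have "(LINT x|lborel. E x) \<le> 2 * (1/4) * (LINT x|lborel. indicator {x. R \<le> norm x} x * E x) + \<Lambda> / (1/4)"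
      using le by (rule allE[of _ "1/4"]) simp
    ultimately have "(LINT x|lborel. E x) \<le> 8 * \<Lambda>" by simp
    moreover have "(LINT x|lborel. indicator (cball 0 R) x * e x) \<le> (LINT x|lborel. E x)"
      using E e0 by (intro integral_mono_AE') (auto simp: indicator_def)
    ultimately show ?thesis by linarith
  qed
  have cball_lim: "(\<lambda>n. indicator (cball 0 (real (Suc n))) x * c) \<longlonglongrightarrow> c"
    and tail_lim: "(\<lambda>n. indicator {x. real (Suc n) \<le> norm x} x * c) \<longlonglongrightarrow> 0" for x :: "real^2" and c :: real
  proof -
    obtain N where N: "norm x < real N" using reals_Archimedean2 by blast
    then show "(\<lambda>n. indicator (cball 0 (real (Suc n))) x * c) \<longlonglongrightarrow> c"
      "(\<lambda>n. indicator {x. real (Suc n) \<le> norm x} x * c) \<longlonglongrightarrow> 0"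
      by (intro tendsto_eventually; force simp: eventually_sequentially intro!: exI[of _ N])+
  qed
  have eI: "integrable lborel e"
  proof (rule integrableI_bounded)
    have "(\<integral>\<^sup>+x. ennreal (norm (e x)) \<partial>lborel) = (\<integral>\<^sup>+x. liminf (\<lambda>n. ennreal (indicator (cball 0 (real (Suc n))) x * e x)) \<partial>lborel)"
    proof (intro nn_integral_cong)
      fix x
      have "liminf (\<lambda>n. ennreal (indicator (cball 0 (real (Suc n))) x * e x)) = ennreal (e x)"
        by (intro lim_imp_Liminf tendsto_ennrealI cball_lim) simp
      then show "ennreal (norm (e x)) = liminf (\<lambda>n. ennreal (indicator (cball 0 (real (Suc n))) x * e x))"
        using e0[of x] by simp
    qed
    also have "\<dots> \<le> liminf (\<lambda>n. \<integral>\<^sup>+x. ennreal (indicator (cball 0 (real (Suc n))) x * e x) \<partial>lborel)"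
      by (intro nn_integral_liminf) measurable
    also have "\<dots> \<le> limsup (\<lambda>n. \<integral>\<^sup>+x. ennreal (indicator (cball 0 (real (Suc n))) x * e x) \<partial>lborel)"
      by (intro Liminf_le_Limsup) simp
    also have "\<dots> \<le> ennreal (8 * \<Lambda>)"
    proof (intro Limsup_bounded always_eventually allI)
      fix n
      have "(\<integral>\<^sup>+x. ennreal (indicator (cball 0 (real (Suc n))) x * e x) \<partial>lborel) = ennreal (LINT x|lborel. indicator (cball 0 (real (Suc n))) x * e x)"
        using e0 by (intro nn_integral_eq_integral eloc) auto
      then show "(\<integral>\<^sup>+x. ennreal (indicator (cball 0 (real (Suc n))) x * e x) \<partial>lborel) \<le> ennreal (8 * \<Lambda>)"
        using bound[of "real (Suc n)"] by (simp add: ennreal_leI)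
    qed
    finally show "(\<integral>\<^sup>+x. ennreal (norm (e x)) \<partial>lborel) < \<infinity>"
      by (rule order_le_less_trans) simp
  qed simp
  have le_tau: "(LINT x|lborel. e x) \<le> \<Lambda> / \<tau>" if \<tau>: "\<tau> > 0" for \<tau>
  proof -
    have "(\<lambda>n. LINT x|lborel. indicator (cball 0 (real (Suc n))) x * e x) \<longlonglongrightarrow> (LINT x|lborel. e x)"
      using e0 by (intro integral_dominated_convergence[where w = e] eI AE_I2 cball_lim) (measurable, auto simp: indicator_def)
    moreover have "(\<lambda>n. LINT x|lborel. indicator {x. real (Suc n) \<le> norm x} x * e x) \<longlonglongrightarrow> (LINT x|(lborel::(real^2) measure). 0)"
      using e0 by (intro integral_dominated_convergence[where w = e] eI AE_I2 tail_lim) (measurable, auto simp: indicator_def)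
    then have "(\<lambda>n. 2 * \<tau> * (LINT x|lborel. indicator {x. real (Suc n) \<le> norm x} x * e x) + \<Lambda> / \<tau>) \<longlonglongrightarrow> 2 * \<tau> * (LINT x|(lborel::(real^2) measure). 0) + \<Lambda> / \<tau>"
      by (intro tendsto_intros)
    moreover have "(LINT x|lborel. indicator (cball 0 (real (Suc n))) x * e x) \<le> 2 * \<tau> * (LINT x|lborel. indicator {x. real (Suc n) \<le> norm x} x * e x) + \<Lambda> / \<tau>" for n
    proof -
      have "real (Suc n) > 0" by simp
      from step[OF this] obtain E where E: "integrable lborel E" "\<forall>x. 0 \<le> E x \<and> E x \<le> e x \<and> (norm x \<le> real (Suc n) \<longrightarrow> E x = e x)"
        and le: "\<forall>\<tau>>0. (LINT x|lborel. E x) \<le> 2 * \<tau> * (LINT x|lborel. indicator {x. real (Suc n) \<le> norm x} x * E x) + \<Lambda> / \<tau>"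
        by (elim exE conjE)
      have tI: "integrable lborel (\<lambda>x. indicator {x. real (Suc n) \<le> norm x} x * e x)"
        using e0 by (intro Bochner_Integration.integrable_bound[OF eI]) (measurable, auto simp: indicator_def)
      have "(LINT x|lborel. indicator (cball 0 (real (Suc n))) x * e x) \<le> (LINT x|lborel. E x)"
        using E e0 by (intro integral_mono_AE') (auto simp: indicator_def)
      also have "\<dots> \<le> 2 * \<tau> * (LINT x|lborel. indicator {x. real (Suc n) \<le> norm x} x * E x) + \<Lambda> / \<tau>" using le \<tau> by blast
      also have "\<dots> \<le> 2 * \<tau> * (LINT x|lborel. indicator {x. real (Suc n) \<le> norm x} x * e x) + \<Lambda> / \<tau>"
      proof -
        have "(LINT x|lborel. indicator {x. real (Suc n) \<le> norm x} x * E x) \<le> (LINT x|lborel. indicator {x. real (Suc n) \<le> norm x} x * e x)"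
          using E e0 by (intro integral_mono_AE' tI) (auto simp: indicator_def)
        then show ?thesis using \<tau> by simp
      qed
      finally show ?thesis .
    qed
    ultimately show ?thesis using LIMSEQ_le by fastforce
  qed
  have "(LINT x|lborel. e x) = 0"
  proof (rule ccontr)
    let ?S = "LINT x|lborel. e x"
    assume "?S \<noteq> 0"
    moreover have "?S \<ge> 0" using e0 by (intro Bochner_Integration.integral_nonneg) auto
    ultimately have S: "?S > 0" by simp
    \<comment> \<open>The weight is chosen so that the bound reads S \<le> S \<Lambda> / (\<Lambda>
      + 1), impossible for positive S.\<close>
    have "?S \<le> \<Lambda> / ((\<Lambda> + 1) / ?S)" using \<Lambda> S by (intro le_tau) simp
    then have "?S * (\<Lambda> + 1) \<le> \<Lambda> * ?S" using \<Lambda> by (simp add: pos_le_divide_eq)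
    then show False using S by (simp add: algebra_simps)
  qed
  then have "AE x in lborel. e x = 0" using integral_nonneg_eq_0_iff_AE[OF eI] e0 by auto
  then show ?thesis by (rule eventually_mono) (simp add: e_def add_nonneg_eq_0_iff)
qed

text \<open>Mollifications of \<open>w\<close> have zero gradient, hence are constant on balls, and
  they converge to \<open>w\<close> in L1. So \<open>w\<close> is L1-close to constants on every
  ball; the constants are then replaced by means over squares centred at the origin and matched on
  the smallest square.\<close>

lemma weak_gradient_zero_imp_AE_constant:
  assumes wm[measurable]: "w \<in> borel_measurable borel" and wB: "\<And>x. \<bar>w x\<bar> \<le> M"
    and weak: "\<And>\<phi> i. \<phi> \<in> test_functions \<Longrightarrow> (LINT x|lborel. w x * partial_deriv i \<phi> x) = 0"
  shows "\<exists>c. AE x in lborel. w x = c"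
proof -
  have w1: "loc_L1 w" by (rule loc_L1_bounded[OF wm wB])
  have M0: "M \<ge> 0" using wB[of 0] by linarith
  obtain C where "C > 0" and cut: "\<And>R. R > 0 \<Longrightarrow> \<exists>\<eta>\<in>test_functions. (\<forall>x. 0 \<le> \<eta> x \<and> \<eta> x \<le> 1) \<and>
    (\<forall>x. norm x \<le> R \<longrightarrow> \<eta> x = 1) \<and> (\<forall>x. norm x > 2 * R \<longrightarrow> \<eta> x = 0) \<and>
    (\<forall>x i. \<bar>partial_deriv i \<eta> x\<bar> \<le> C / R)" using cutoff_functions by blast
  have near_const: "\<exists>c. (\<integral>\<^sup>+x. indicator (ball 0 R) x * ennreal \<bar>w x - c\<bar> \<partial>lborel) \<le> ennreal d" if R: "R > 0" and d: "d > 0" for R d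
  proof -
    have "R + 1 > 0" using R by simp
    from cut[OF this] obtain \<zeta> where \<zeta>: "\<zeta> \<in> test_functions" "\<forall>x. norm x \<le> R + 1 \<longrightarrow> \<zeta> x = 1"
      by (elim bexE conjE)
    define a where "a x = w x * \<zeta> x" for x
    have aI: "integrable lborel a" unfolding a_def[abs_def] by (intro test_functions_times_loc_L1 w1 \<zeta>)
    obtain e0 where e0: "e0 > 0" "\<forall>e. 0 < e \<and> e < e0 \<longrightarrow> (\<integral>\<^sup>+x. ennreal \<bar>convolution (moll e) a x - a x\<bar> \<partial>lborel) \<le> ennreal d"
      using convolution_moll_L1[OF aI d] by blast
    \<comment> \<open>A scale below 1 keeps the mollifier centred in the ball of radius
      \<open>R\<close> inside the ball of radius \<open>R + 1\<close>, where the cutoff is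
      identically 1.\<close>
    define e where "e = min e0 1 / 2"
    have e: "0 < e" "e < e0" "e < 1" using e0(1) by (auto simp: e_def)
    have d\<zeta>: "partial_deriv i \<zeta> y = 0" if "norm y < R + 1" for i y
    proof -
      have "open {y::real^2. norm y < R + 1}" by (intro open_Collect_less continuous_intros)
      then have "(\<zeta> has_derivative (\<lambda>h. 0)) (at y)"
        using that \<zeta>(2) by (intro has_derivative_transform_within_open[of "\<lambda>x. 1" "\<lambda>h. 0" y UNIV "{y. norm y < R + 1}" \<zeta>, simplified]) auto
      then show ?thesis by (rule partial_deriv_eqI)
    qed
    have pd: "convolution (partial_deriv i (moll e)) a x = 0" if x: "x \<in> ball 0 R" for i x
    proof -
      have z: "loc_L1 (\<lambda>x. 0)" by (simp add: loc_L1_def)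
      have "(moll e (x - y)) * (w y * partial_deriv i \<zeta> y) = 0" for y
      proof (cases "norm (x - y) \<ge> e")
        case False
        then have "norm y < R + 1" using x e(3) norm_triangle_ineq4[of x "x - y"] by simp
        then show ?thesis using d\<zeta> by simp
      qed (simp add: moll_eq_0 e(1))
      then have "convolution (moll e) (\<lambda>y. w y * partial_deriv i \<zeta> y) x = 0"
        unfolding convolution_def by (simp only: Bochner_Integration.integral_zero)
      moreover have "partial_deriv i (convolution (moll e) (\<lambda>y. w y * \<zeta> y)) x =
          convolution (moll e) (\<lambda>y. 0 * \<zeta> y) x + convolution (moll e) (\<lambda>y. w y * partial_deriv i \<zeta> y) x"
        using weak by (intro partial_deriv_weak_convolution w1 z \<zeta> e) simp
      moreover have "convolution (moll e) (\<lambda>y. 0 * \<zeta> y) x = 0" by (simp add: convolution_def)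
      ultimately show ?thesis
        unfolding a_def[abs_def, symmetric] partial_deriv_convolution[OF moll_test_functions[OF e(1)] aI] by simp
    qed
    have "\<exists>c. \<forall>x\<in>ball 0 R. convolution (moll e) a x = c"
    proof (rule has_derivative_zero_constant)
      fix x :: "real^2" assume x: "x \<in> ball 0 R"
      have "(convolution (moll e) a has_derivative (\<lambda>h. 0)) (at x)"
        using convolution_has_derivative[OF moll_test_functions[OF e(1)] aI, of x] by (simp add: pd[OF x])
      then show "(convolution (moll e) a has_derivative (\<lambda>h. 0)) (at x within ball 0 R)" by (rule has_derivative_at_withinI)
    qed simp
    then obtain c where c: "\<And>x. x \<in> ball 0 R \<Longrightarrow> convolution (moll e) a x = c" by blast
    have "(\<integral>\<^sup>+x. indicator (ball 0 R) x * ennreal \<bar>w x - c\<bar> \<partial>lborel) \<le> (\<integral>\<^sup>+x. ennreal \<bar>convolution (moll e) a x - a x\<bar> \<partial>lborel)"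
    proof (intro nn_integral_mono)
      fix x
      show "indicator (ball 0 R) x * ennreal \<bar>w x - c\<bar> \<le> ennreal \<bar>convolution (moll e) a x - a x\<bar>"
      proof (cases "x \<in> ball 0 R")
        case True
        then have "a x = w x" using \<zeta>(2) by (simp add: a_def)
        then show ?thesis using True c[OF True] by (simp add: abs_minus_commute)
      qed simp
    qed
    also have "\<dots> \<le> ennreal d" using e0(2) e by blast
    finally show ?thesis by blast
  qed
  \<comment> \<open>Squares centred at the origin with half side \<open>Suc n\<close>. They exhaust
    the plane, and even the smallest has positive area.\<close>
  define p :: "nat \<Rightarrow> real^2" where "p n = (\<chi> i. - real (Suc n))" for n
  define r where "r n = 2 * real (Suc n)" for n
  have r: "r n > 0" for n by (simp add: r_def)
  have p0: "0 \<in> sq (p n) (r n)" for n by (simp add: sq_def p_def r_def)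
  define m where "m n = mean (p n) (r n) w" for n
  have AE_sq: "AE x in lborel. x \<in> sq (p n) (r n) \<longrightarrow> w x = m n" for n
  proof -
    have wc: "\<bar>\<bar>w x - c\<bar>\<bar> \<le> M + \<bar>c\<bar>" for c x using wB[of x] by linarith
    \<comment> \<open>The constant from \<open>near_const\<close> depends on \<open>d\<close>, while
      the mean does not. Passing to the mean at most doubles the error, hence \<open>d / 2\<close>;
      the ball of radius \<open>2 * r n\<close> about the origin contains the square.\<close>
    have small: "sint (p n) (r n) (\<lambda>x. \<bar>w x - m n\<bar>) \<le> d" if d: "d > 0" for d
    proof -
      obtain c where c: "(\<integral>\<^sup>+x. indicator (ball 0 (2 * r n)) x * ennreal \<bar>w x - c\<bar> \<partial>lborel) \<le> ennreal (d / 2)"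
        using near_const[of "2 * r n" "d / 2"] r[of n] d by auto
      have sI: "integrable lborel (\<lambda>x. indicator (sq (p n) (r n)) x * \<bar>w x - c\<bar>)"
      proof (rule sint_integrable)
        show "\<bar>\<bar>w x - c\<bar>\<bar> \<le> M + \<bar>c\<bar>" for x by (rule wc)
      qed measurable
      have "ennreal (sint (p n) (r n) (\<lambda>x. \<bar>w x - c\<bar>)) = (\<integral>\<^sup>+x. ennreal (indicator (sq (p n) (r n)) x * \<bar>w x - c\<bar>) \<partial>lborel)"
        unfolding sint_def by (intro nn_integral_eq_integral[symmetric] sI) auto
      also have "\<dots> \<le> (\<integral>\<^sup>+x. indicator (ball 0 (2 * r n)) x * ennreal \<bar>w x - c\<bar> \<partial>lborel)"
      proof (intro nn_integral_mono)
        fix x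
        show "ennreal (indicator (sq (p n) (r n)) x * \<bar>w x - c\<bar>) \<le> indicator (ball 0 (2 * r n)) x * ennreal \<bar>w x - c\<bar>"
          using dist_sq[OF p0[of n], of x] by (cases "x \<in> sq (p n) (r n)") auto
      qed
      also note c
      finally have 1: "sint (p n) (r n) (\<lambda>x. \<bar>w x - c\<bar>) \<le> d / 2" using d by (simp add: ennreal_le_iff)
      have 2: "\<bar>m n - c\<bar> * (r n)\<^sup>2 \<le> sint (p n) (r n) (\<lambda>x. \<bar>w x - c\<bar>)"
        unfolding m_def by (rule mean_diff[OF wm wB r])
      have "sint (p n) (r n) (\<lambda>x. \<bar>w x - m n\<bar>) \<le> sint (p n) (r n) (\<lambda>x. \<bar>w x - c\<bar> + \<bar>m n - c\<bar>)"
      proof (rule sint_mono)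
        show "\<bar>\<bar>w x - m n\<bar>\<bar> \<le> M + \<bar>m n\<bar>" for x by (rule wc)
        show "\<bar>\<bar>w x - c\<bar> + \<bar>m n - c\<bar>\<bar> \<le> M + \<bar>c\<bar> + \<bar>m n - c\<bar>" for x using wc[of x c] by linarith
        show "\<bar>w x - m n\<bar> \<le> \<bar>w x - c\<bar> + \<bar>m n - c\<bar>" for x by linarith
      qed measurable
      also have "\<dots> = sint (p n) (r n) (\<lambda>x. \<bar>w x - c\<bar>) + sint (p n) (r n) (\<lambda>x. \<bar>m n - c\<bar>)"
      proof (rule sint_add)
        show "\<bar>\<bar>w x - c\<bar>\<bar> \<le> M + \<bar>c\<bar>" for x by (rule wc)
        show "\<bar>\<bar>m n - c\<bar>\<bar> \<le> \<bar>m n - c\<bar>" by simp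
      qed measurable
      also have "\<dots> = sint (p n) (r n) (\<lambda>x. \<bar>w x - c\<bar>) + \<bar>m n - c\<bar> * (r n)\<^sup>2" by (simp add: sint_const[OF r])
      finally show ?thesis using 1 2 by linarith
    qed
    have "sint (p n) (r n) (\<lambda>x. \<bar>w x - m n\<bar>) \<le> 0"
    proof (rule field_le_epsilon)
      show "sint (p n) (r n) (\<lambda>x. \<bar>w x - m n\<bar>) \<le> 0 + d" if "0 < d" for d using small[OF that] by simp
    qed
    moreover have "sint (p n) (r n) (\<lambda>x. \<bar>w x - m n\<bar>) \<ge> 0" by (rule sint_nonneg) simp
    ultimately have z: "(LINT x|lborel. indicator (sq (p n) (r n)) x * \<bar>w x - m n\<bar>) = 0"
      unfolding sint_def[symmetric] by (rule antisym)
    have I: "integrable lborel (\<lambda>x. indicator (sq (p n) (r n)) x * \<bar>w x - m n\<bar>)"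
    proof (rule sint_integrable)
      show "\<bar>\<bar>w x - m n\<bar>\<bar> \<le> M + \<bar>m n\<bar>" for x by (rule wc)
    qed measurable
    have "AE x in lborel. indicator (sq (p n) (r n)) x * \<bar>w x - m n\<bar> = 0"
      using integral_nonneg_eq_0_iff_AE[OF I] z by simp
    then show ?thesis by (rule eventually_mono) (auto simp: indicator_def)
  qed
  \<comment> \<open>The squares are nested, so two different constants would force the smallest
    square to be null.\<close>
  have m_eq: "m n = m 0" for n
  proof (rule ccontr)
    assume ne: "m n \<noteq> m 0"
    have "AE x in lborel. x \<notin> sq (p 0) (r 0)"
      using AE_sq[of n] AE_sq[of 0]
    proof eventually_elim
      case (elim x)
      have "x \<in> sq (p 0) (r 0) \<Longrightarrow> x \<in> sq (p n) (r n)" by (auto simp: sq_def p_def r_def)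
      then show ?case using elim ne by auto
    qed
    then have "emeasure lborel (sq (p 0) (r 0)) = 0" by (subst (asm) AE_iff_measurable[OF _ refl]) (auto simp: sq_borel)
    then show False using emeasure_sq[OF r[of 0], of "p 0"] r[of 0] by simp
  qed
  have "AE x in lborel. \<forall>n. x \<in> sq (p n) (r n) \<longrightarrow> w x = m 0"
    unfolding AE_all_countable
  proof
    show "AE x in lborel. x \<in> sq (p n) (r n) \<longrightarrow> w x = m 0" for n
      using AE_sq[of n] unfolding m_eq[of n] .
  qed
  then have "AE x in lborel. w x = m 0"
  proof (rule eventually_mono)
    fix x assume *: "\<forall>n. x \<in> sq (p n) (r n) \<longrightarrow> w x = m 0"
    obtain n where n: "norm x < real n" using reals_Archimedean2 by blast
    have "\<bar>x $ i\<bar> < real n" for i using component_le_norm_cart[of x i] n by linarith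
    from this[of 1] this[of 2] have "x \<in> sq (p n) (r n)" by (auto simp: sq_def p_def r_def abs_less_iff)
    then show "w x = m 0" using * by blast
  qed
  then show ?thesis by blast
qed

text \<open>Convolved with the indicator of a large disc, \<phi> becomes constant near the origin
  with value the integral of \<phi>, so its derivative there, the integral of the partial
  derivative, is 0. This lets a constant be added to \<open>u\<close> without changing the weak
  gradient.\<close>

lemma integral_partial_deriv_eq_0:
  assumes \<phi>: "\<phi> \<in> test_functions"
  shows "(LINT x|lborel. partial_deriv i \<phi> x) = 0"
proof -
  note d\<phi> = test_functions_partial_deriv[OF \<phi>, of i]
  note [measurable] = test_functions_borel[OF \<phi>] test_functions_borel[OF d\<phi>]
  obtain R where R: "R > 0" "\<And>x. norm x > R \<Longrightarrow> \<phi> x = 0" using test_functions_support[OF \<phi>] by blast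
  let ?g = "indicator (cball 0 (R + 1)) :: real^2 \<Rightarrow> real"
  have g: "integrable lborel ?g"
    using area_cball[of "R + 1" "0::real^2"] R by (intro integrable_real_indicator) auto
  have conv: "convolution \<psi> ?g x = (LINT y|lborel. \<psi> y)"
    if [measurable]: "\<psi> \<in> borel_measurable borel" and z: "\<And>x. norm x > R \<Longrightarrow> \<psi> x = 0" and x: "norm x < 1" for \<psi> x
  proof -
    have "\<psi> (x - y) * ?g y = \<psi> (x - y)" for y
      using z[of "x - y"] x norm_triangle_ineq2[of y x] by (cases "norm y \<le> R + 1") (auto simp: norm_minus_commute)
    then have "convolution \<psi> ?g x = (LINT y|lborel. \<psi> (x - y))" by (simp only: convolution_def)
    then show ?thesis using lborel_integral_affine[of \<psi> "-1" x] by simp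
  qed
  have "(convolution \<phi> ?g has_derivative (\<lambda>h. 0)) (at 0)"
  proof (rule has_derivative_transform_within_open[of "\<lambda>x. LINT y|lborel. \<phi> y" _ _ _ "ball 0 1"])
    show "\<And>x. x \<in> ball 0 1 \<Longrightarrow> (LINT y|lborel. \<phi> y) = convolution \<phi> ?g x" using conv[of \<phi>] R by simp
  qed auto
  then have "partial_deriv i (convolution \<phi> ?g) 0 = 0" by (rule partial_deriv_eqI)
  moreover have "convolution (partial_deriv i \<phi>) ?g 0 = (LINT x|lborel. partial_deriv i \<phi> x)"
    using partial_deriv_eq_0_outside[of R \<phi>] R by (intro conv) auto
  ultimately show ?thesis by (simp add: partial_deriv_convolution[OF \<phi> g])
qed

text \<open>Bridge from \<open>lebesgue\<close>, on which the notions are defined, to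
  \<open>lborel\<close>, whose product structure the proof uses. Measurability of \<open>f\<close>
  comes from completeness of Lebesgue measure.\<close>

lemma lebesgue_lborel_transfer:
  fixes f g :: "real^2 \<Rightarrow> real"
  assumes g: "g \<in> borel_measurable borel" and ae: "AE x in lborel. f x = g x"
  shows "integral\<^sup>L lebesgue f = integral\<^sup>L lborel g" "integrable lebesgue f \<longleftrightarrow> integrable lborel g"
proof -
  have gl: "g \<in> borel_measurable lborel" "g \<in> borel_measurable lebesgue" using g by (auto intro: measurable_completion)
  have ae': "AE x in lebesgue. f x = g x" using ae by (rule AE_completion)
  have f: "f \<in> borel_measurable lebesgue"
    by (rule borel_measurable_AE[OF gl(2)]) (use ae' in \<open>auto simp: eq_commute\<close>)
  show "integral\<^sup>L lebesgue f = integral\<^sup>L lborel g"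
    using integral_cong_AE[OF f gl(2) ae'] integral_completion[OF gl(1)] by simp
  show "integrable lebesgue f \<longleftrightarrow> integrable lborel g"
    using integrable_cong_AE[OF f gl(2) ae'] integrable_completion[OF gl(1)] by simp
qed

text \<open>Local integrability speaks only of cutoffs of \<open>H\<close>; measurability of
  \<open>H\<close> itself comes from writing it as the pointwise limit of its cutoffs to growing
  balls.\<close>

lemma locally_integrable_borel_representative:
  fixes H :: "real^2 \<Rightarrow> real"
  assumes "locally_integrable H"
  obtains H' where "H' \<in> borel_measurable borel" "AE x in lborel. H x = H' x"
proof -
  have m: "(\<lambda>x. indicator (cball 0 (real n)) x *\<^sub>R H x) \<in> borel_measurable lebesgue" for n
    using assms unfolding locally_integrable_def set_integrable_def by (intro borel_measurable_integrable) auto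
  have "H \<in> borel_measurable lebesgue"
  proof (rule borel_measurable_LIMSEQ_real[OF _ m])
    fix x :: "real^2"
    obtain N where N: "norm x < real N" using reals_Archimedean2 by blast
    show "(\<lambda>n. indicator (cball 0 (real n)) x *\<^sub>R H x) \<longlonglongrightarrow> H x"
      by (intro tendsto_eventually) (use N in \<open>force simp: eventually_sequentially intro!: exI[of _ N]\<close>)
  qed
  from completion_ex_borel_measurable_real[OF this] that show ?thesis by auto
qed

lemma BMO_imp_L2_oscillation:
  assumes "H \<in> BMO" and H'm[measurable]: "H' \<in> borel_measurable borel" and ae: "AE x in lborel. H x = H' x"
  obtains K where "L2_oscillation H' K"
proof -
  have loc: "locally_integrable H" using assms(1) by (simp add: BMO_def)
  obtain C where C: "\<And>a r. r > 0 \<Longrightarrow> average (ball a r) (\<lambda>x. \<bar>H x - average (ball a r) H\<bar>) \<le> C"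
    using assms(1) unfolding BMO_def by blast
  have int: "integrable lborel (\<lambda>x. indicator (ball a r) x * H' x)" for a r
  proof -
    have "set_integrable lebesgue (cball a r) H" using loc by (simp add: locally_integrable_def)
    then have "set_integrable lebesgue (ball a r) H" by (rule set_integrable_subset) auto
    then have "integrable lebesgue (\<lambda>x. indicator (ball a r) x * H x)" by (simp add: set_integrable_def)
    moreover have "integrable lebesgue (\<lambda>x. indicator (ball a r) x * H x) \<longleftrightarrow> integrable lborel (\<lambda>x. indicator (ball a r) x * H' x)"
    proof (rule lebesgue_lborel_transfer)
      show "AE x in lborel. indicator (ball a r) x * H x = indicator (ball a r) x * H' x" using ae by eventually_elim simp
    qed measurable
    ultimately show ?thesis by simp
  qed
  \<comment> \<open>The factor \<open>pi\<close> turns averages over balls into plain integrals;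
    \<open>\<bar>C\<bar>\<close> appears because the bound is obtained without a sign.\<close>
  have "L2_oscillation H' (16384 * (\<bar>C\<bar> * pi)\<^sup>2)"
  proof (rule john_nirenberg_L2)
    fix a :: "real^2" and r :: real assume r: "r > 0"
    let ?c = "average (ball a r) H"
    have area: "measure lebesgue (ball a r) = pi * r\<^sup>2"
      using area_ball[of r a] r by (simp add: measure_def)
    have "(LINT x:ball a r|lebesgue. \<bar>H x - ?c\<bar>) \<le> C * (pi * r\<^sup>2)"
      using C[OF r, of a] r unfolding average_def[of _ "\<lambda>x. \<bar>H x - ?c\<bar>"] area by (simp add: pos_divide_le_eq)
    also have "\<dots> \<le> \<bar>C\<bar> * pi * r\<^sup>2" using r by (simp add: mult_right_mono)
    finally have le: "(LINT x|lebesgue. indicator (ball a r) x * \<bar>H x - ?c\<bar>) \<le> \<bar>C\<bar> * pi * r\<^sup>2"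
      by (simp add: set_lebesgue_integral_def)
    have "(LINT x|lebesgue. indicator (ball a r) x * \<bar>H x - ?c\<bar>) = (LINT x|lborel. indicator (ball a r) x * \<bar>H' x - ?c\<bar>)"
    proof (rule lebesgue_lborel_transfer)
      show "AE x in lborel. indicator (ball a r) x * \<bar>H x - ?c\<bar> = indicator (ball a r) x * \<bar>H' x - ?c\<bar>" using ae by eventually_elim simp
    qed measurable
    with le show "\<exists>c. (LINT x|lborel. indicator (ball a r) x * \<bar>H' x - c\<bar>) \<le> \<bar>C\<bar> * pi * r\<^sup>2" by auto
  qed (use int H'm in auto)
  then show ?thesis using that by blast
qed

lemma L2_loc_component:
  fixes i :: 2
  assumes G: "G \<in> L2_loc"
  obtains g where "loc_L2 g" "AE x in lborel. G x $ i = g x"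
proof -
  have "(\<lambda>x. G x $ i) = (\<lambda>v. v $ i) \<circ> G" by auto
  moreover have "(\<lambda>v::real^2. v $ i) \<in> borel_measurable borel"
    by (intro borel_measurable_continuous_onI continuous_intros)
  ultimately have Gm: "(\<lambda>x. G x $ i) \<in> borel_measurable lebesgue"
    using G by (auto simp: L2_loc_def intro: measurable_comp)
  from completion_ex_borel_measurable_real[OF Gm] obtain g where g[measurable]: "g \<in> borel_measurable borel"
    and ae: "AE x in lborel. G x $ i = g x" by auto
  have "loc_L2 g" unfolding loc_L2_def
  proof (intro conjI allI g)
    fix R
    have "set_integrable lebesgue (cball 0 R) (\<lambda>x. (norm (G x))\<^sup>2)" using G by (simp add: L2_loc_def locally_integrable_def)
    then have I: "integrable lebesgue (\<lambda>x. indicator (cball 0 R) x * (norm (G x))\<^sup>2)" by (simp add: set_integrable_def)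
    have "integrable lebesgue (\<lambda>x. indicator (cball 0 R) x * (G x $ i)\<^sup>2)"
    proof (rule Bochner_Integration.integrable_bound[OF I])
      show "(\<lambda>x. indicator (cball 0 R) x * (G x $ i)\<^sup>2) \<in> borel_measurable lebesgue"
        using Gm by (intro borel_measurable_times borel_measurable_power borel_measurable_indicator) auto
      show "AE x in lebesgue. norm (indicator (cball 0 R) x * (G x $ i)\<^sup>2) \<le> norm (indicator (cball 0 R) x * (norm (G x))\<^sup>2)"
        using component_le_norm_cart[of _ i] by (intro AE_I2) (auto simp: indicator_def abs_le_square_iff[symmetric])
    qed
    moreover have "integrable lebesgue (\<lambda>x. indicator (cball 0 R) x * (G x $ i)\<^sup>2) \<longleftrightarrow> integrable lborel (\<lambda>x. indicator (cball 0 R) x * (g x)\<^sup>2)"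
    proof (rule lebesgue_lborel_transfer)
      show "AE x in lborel. indicator (cball 0 R) x * (G x $ i)\<^sup>2 = indicator (cball 0 R) x * (g x)\<^sup>2" using ae by eventually_elim simp
    qed measurable
    ultimately show "integrable lborel (\<lambda>x. indicator (cball 0 R) x * (g x)\<^sup>2)" by simp
  qed
  then show ?thesis using that ae by blast
qed

lemma coeff_matrix_inner_gradient:
  "(coeff_matrix H x *v G x) \<bullet> gradient v x =
    (G x $ 1 + H x * G x $ 2) * partial_deriv 1 v x + (G x $ 2 - H x * G x $ 1) * partial_deriv 2 v x"
  by (simp add: coeff_matrix_def matrix_vector_mult_def inner_vec_def sum_2 mat_def gradient_def)

theorem theorem3p2:
  fixes b :: distributional_field and u :: "real^2 \<Rightarrow> real"
  assumes "b \<in> div_free_BMO_inverse"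
    and "weak_subsolution b u"
    and "\<exists>M. AE x in lebesgue. \<bar>u x\<bar> \<le> M"
  shows "\<exists>c. AE x in lebesgue. u x = c"
proof -
  obtain H G where H: "H \<in> BMO" and G: "G \<in> L2_loc" "weak_gradient u G"
    and sub: "\<And>v. v \<in> test_functions \<Longrightarrow> (\<And>x. 0 \<le> v x) \<Longrightarrow> (LINT x|lebesgue. (coeff_matrix H x *v G x) \<bullet> gradient v x) \<le> 0"
    and u: "u \<in> borel_measurable lebesgue"
    using assms(2) unfolding weak_subsolution_def H1_loc_def BMO_stream_function_def L2_loc_def by blast
  have "locally_integrable H" using H by (simp add: BMO_def)
  then obtain H' where H'[measurable]: "H' \<in> borel_measurable borel" and aeH: "AE x in lborel. H x = H' x"
    by (rule locally_integrable_borel_representative)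
  obtain K where osc: "L2_oscillation H' K" by (rule BMO_imp_L2_oscillation[OF H H' aeH])
  obtain g1 where g1: "loc_L2 g1" "AE x in lborel. G x $ 1 = g1 x" by (rule L2_loc_component[OF G(1)])
  obtain g2 where g2: "loc_L2 g2" "AE x in lborel. G x $ 2 = g2 x" by (rule L2_loc_component[OF G(1)])
  note [measurable] = loc_L2_borel[OF g1(1)] loc_L2_borel[OF g2(1)]
  from completion_ex_borel_measurable_real[OF u] obtain u' where u'[measurable]: "u' \<in> borel_measurable borel"
    and aeu: "AE x in lborel. u x = u' x" by auto
  obtain M0 where "AE x in lebesgue. \<bar>u x\<bar> \<le> M0" using assms(3) by blast
  then have M0: "AE x in lborel. \<bar>u x\<bar> \<le> M0" by (simp add: AE_completion_iff)
  define M where "M = \<bar>M0\<bar>"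
  \<comment> \<open>Truncating the Borel representative makes the bounds on \<open>w\<close> hold
    everywhere and not only almost everywhere; adding \<open>M\<close> makes it nonnegative.\<close>
  define w where "w x = truncate M (u' x) + M" for x
  have [measurable]: "w \<in> borel_measurable borel" unfolding w_def[abs_def] by measurable
  have aew: "AE x in lborel. u x = w x - M"
    using aeu M0 by eventually_elim (simp add: w_def M_def truncate_eq)
  have w: "0 \<le> w x" "w x \<le> 2 * M" for x
    using abs_truncate_le(1)[of M "u' x"] by (auto simp: w_def M_def)
  have wB: "\<bar>w x\<bar> \<le> 2 * M" for x using w[of x] by simp
  have w1: "loc_L1 w" by (rule loc_L1_bounded[OF _ wB]) measurable
  have weak: "(LINT x|lborel. w x * partial_deriv i \<phi> x) = - (LINT x|lborel. g x * \<phi> x)"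
    if \<phi>: "\<phi> \<in> test_functions" and g: "loc_L2 g" "AE x in lborel. G x $ i = g x" for \<phi> i g
  proof -
    note d\<phi> = test_functions_partial_deriv[OF \<phi>, of i]
    note [measurable] = test_functions_borel[OF \<phi>] test_functions_borel[OF d\<phi>] loc_L2_borel[OF g(1)]
    have 1: "(LINT x|lebesgue. u x * partial_deriv i \<phi> x) = (LINT x|lborel. (w x - M) * partial_deriv i \<phi> x)"
    proof (rule lebesgue_lborel_transfer)
      show "AE x in lborel. u x * partial_deriv i \<phi> x = (w x - M) * partial_deriv i \<phi> x" using aew by eventually_elim simp
    qed measurable
    have 2: "(LINT x|lebesgue. G x $ i * \<phi> x) = (LINT x|lborel. g x * \<phi> x)"
    proof (rule lebesgue_lborel_transfer)
      show "AE x in lborel. G x $ i * \<phi> x = g x * \<phi> x" using g(2) by eventually_elim simp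
    qed measurable
    have "(LINT x|lebesgue. u x * partial_deriv i \<phi> x) = - (LINT x|lebesgue. G x $ i * \<phi> x)"
      using G(2) \<phi> unfolding weak_gradient_def by blast
    \<comment> \<open>The added constant drops out, because partial derivatives of test functions
      integrate to 0.\<close>
    moreover have "(LINT x|lborel. (w x - M) * partial_deriv i \<phi> x) = (LINT x|lborel. w x * partial_deriv i \<phi> x) - M * (LINT x|lborel. partial_deriv i \<phi> x)"
      unfolding left_diff_distrib using test_functions_times_loc_L1[OF w1 d\<phi>] test_functions_integrable[OF d\<phi>] by simp
    ultimately show ?thesis unfolding 1 2 integral_partial_deriv_eq_0[OF \<phi>] by simp
  qed
  have sub': "(LINT x|lborel. (g1 x + H' x * g2 x) * partial_deriv 1 v x + (g2 x - H' x * g1 x) * partial_deriv 2 v x) \<le> 0"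
    if v: "v \<in> test_functions" "\<And>x. 0 \<le> v x" for v
  proof -
    note [measurable] = test_functions_borel[OF test_functions_partial_deriv[OF v(1)]]
    have "(LINT x|lebesgue. (coeff_matrix H x *v G x) \<bullet> gradient v x) =
      (LINT x|lborel. (g1 x + H' x * g2 x) * partial_deriv 1 v x + (g2 x - H' x * g1 x) * partial_deriv 2 v x)"
    proof (rule lebesgue_lborel_transfer)
      show "AE x in lborel. (coeff_matrix H x *v G x) \<bullet> gradient v x =
         (g1 x + H' x * g2 x) * partial_deriv 1 v x + (g2 x - H' x * g1 x) * partial_deriv 2 v x"
        using aeH g1(2) g2(2) by eventually_elim (simp add: coeff_matrix_inner_gradient)
    qed measurable
    then show ?thesis using sub[OF v] by simp
  qed
  have wm: "w \<in> borel_measurable borel" by measurable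
  have zero: "AE x in lborel. g1 x = 0 \<and> g2 x = 0"
    by (rule gradient_AE_zero[OF osc wm w g1(1) g2(1) weak[OF _ g1] weak[OF _ g2] sub'])
  have "(LINT x|lborel. w x * partial_deriv i \<phi> x) = 0" if \<phi>: "\<phi> \<in> test_functions" for \<phi> i
  proof -
    have "(LINT x|lborel. g1 x * \<phi> x) = 0"
    proof (rule integral_eq_zero_AE)
      show "AE x in lborel. g1 x * \<phi> x = 0" using zero by eventually_elim simp
    qed
    moreover have "(LINT x|lborel. g2 x * \<phi> x) = 0"
    proof (rule integral_eq_zero_AE)
      show "AE x in lborel. g2 x * \<phi> x = 0" using zero by eventually_elim simp
    qed
    ultimately have "(LINT x|lborel. g1 x * \<phi> x) = 0" "(LINT x|lborel. g2 x * \<phi> x) = 0" .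
    then show ?thesis using weak[OF \<phi> g1] weak[OF \<phi> g2] exhaust_2[of i] by auto
  qed
  then obtain c where "AE x in lborel. w x = c"
    using weak_gradient_zero_imp_AE_constant[OF wm wB] by blast
  then have "AE x in lborel. u x = c - M" using aew by eventually_elim simp
  then have "AE x in lebesgue. u x = c - M" by (rule AE_completion)
  then show ?thesis by blast
qed

end
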